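(* There exist absolute constants $c, c_0 > 0$ such that the following holds. Let $n \ge 1$, let $\epsilon, \delta \in (0, c_0)$, and let $A \in \mathbb{R}^{n\times n}$ be symmetric (not necessarily PSD) with $\max_{i,j}|A_{ij}| \le 1$. If Algorithm U below is run with expected sample size $s \ge \frac{c}{\epsilon^2 \delta}\log\frac{1}{\epsilon\delta}$, then with probability at least $1-\delta$ its output $\hat\lambda_1 \ge \dots \ge \hat\lambda_n$ is an additive $\epsilon n$-approximation to the spectrum of $A$.
   Context: Algorithm U (uniform sampling): input a symmetric $A \in \mathbb{R}^{n\times n}$ and a number $s>0$. If $s \ge n$, let $S = I_n$. Otherwise, include each index $i \in [n]$ independently with probability $p = s/n$; if $i_1<\dots<i_k$ are the included indices, let $S \in \mathbb{R}^{k\times n}$ be the matrix whose $r$-th row is $e_{i_r}^T/\sqrt{p}$. Output the $k$ eigenvalues of the $k\times k$ matrix $SAS^T$ together with $n-k$ additional zeros, sorted in non-increasing order. A sequence $\hat\lambda_1\ge\dots\ge\hat\lambda_n$ is an additive $\alpha$-approximation to the spectrum of a symmetric $A\in\mathbb{R}^{n\times n}$ with eigenvalues $\lambda_1(A)\ge\dots\ge\lambda_n(A)$ if $|\hat\lambda_i - \lambda_i(A)| \le \alpha$ for all $i\in[n]$. *)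

theory Defs
  imports "Jordan_Normal_Form.Char_Poly" "HOL-Probability.Product_PMF"
begin

text \<open>Eigenvalues of a square real matrix, with multiplicity, sorted in
non-increasing order: the unique non-increasing list of length dim_row A whose
associated monic linear factors multiply to the characteristic polynomial.
(For symmetric real matrices such a list exists.)\<close>
definition eigs :: "real mat \<Rightarrow> real list" where
  "eigs A = (THE xs. sorted (rev xs) \<and> length xs = dim_row A \<and>
       char_poly A = prod_list (map (\<lambda>a. [:- a, 1:]) xs))"

text \<open>Output of Algorithm U for a given realisation of the coin flips
(b i = index i is included), inclusion probability p.
S A S^T has entries A(i_r,i_t)/p for included indices i_1 < ... < i_k.\<close>
definition algU_output :: "real mat \<Rightarrow> real \<Rightarrow> (nat \<Rightarrow> bool) \<Rightarrow> real list" where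
  "algU_output A p b =
     (let n = dim_row A;
          I = sorted_list_of_set {i. i < n \<and> b i};
          k = length I;
          M = Matrix.mat k k (\<lambda>(r, t). A $$ (I ! r, I ! t) / p)
      in rev (sort (eigs M @ replicate (n - k) 0)))"

definition algU :: "real mat \<Rightarrow> real \<Rightarrow> real list pmf" where
  "algU A s =
     (let n = dim_row A in
      if s \<ge> real n then return_pmf (eigs A)
      else map_pmf (algU_output A (s / real n))
             (Pi_pmf {..<n} False (\<lambda>_. bernoulli_pmf (s / real n))))"

definition additive_approx :: "real list \<Rightarrow> real mat \<Rightarrow> real \<Rightarrow> bool" where
  "additive_approx lam A \<alpha> \<longleftrightarrow> length lam = dim_row A \<and>
     (\<forall>i < dim_row A. \<bar>lam ! i - eigs A ! i\<bar> \<le> \<alpha>)"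

end

theory Submission
  imports Defs "Jordan_Normal_Form.Spectral_Radius"
begin

text \<open>
  Let \<open>p = s / n\<close>, let \<open>D\<close> be the diagonal matrix of the scaled coins \<open>b i / p\<close>, and let
  \<open>\<theta> = e n\<close> with \<open>e\<^sup>2\<close> of order \<open>(log s) / s\<close>. Outside an event of probability \<open>O(1 / s\<^sup>2)\<close>, all
  eigenvalues move by \<open>O(\<theta>)\<close>.

  Eigenvectors with \<open>\<bar>\<lambda>\<bar> \<ge> \<nu>\<close> have squared row norms at most \<open>n / \<nu>\<^sup>2\<close>, because the rows of \<open>A\<close> have
  squared norm at most \<open>n\<close>. A matrix Bernstein inequality with intrinsic dimension, so that its
  logarithmic factor depends on \<open>s\<close> and not on \<open>n\<close>, then shows that the Gram matrix \<open>V\<^sup>T D V\<close> of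
  these eigenvectors is within \<open>O(\<theta> / \<nu>)\<close> of the identity, and that the Gram matrix weighted by
  \<open>min \<bar>\<lambda>\<bar> \<nu>\<close>, over all \<open>\<bar>\<lambda>\<bar> \<ge> \<theta>\<close>, is within \<open>sqrt (\<theta> \<nu>)\<close> of its mean. The part of \<open>A\<close> with
  \<open>\<bar>\<lambda>\<bar> < \<theta>\<close> contributes \<open>O(\<theta>)\<close> to the spectral norm after sampling, by decoupling the rows from the
  columns and applying the same inequality twice.

  On this event the numbers of eigenvalues beyond each threshold are compared by variational
  arguments at the scale \<open>\<nu>\<close> of the eigenvalue in question. The coupling to the smaller
  eigenvalues enters only to second order, which is why the crude bound \<open>sqrt (\<theta> \<nu>)\<close> suffices.
  The Bernstein inequality bounds the moments \<open>E tr X\<^bsup>2q\<^esup>\<close> recursively, by resampling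
  one coin at a time.
\<close>

subsection \<open>Spectral theorem for real symmetric matrices\<close>


text \<open>With \<open>Q\<close> moments, the Bernstein inequality resolves deviations of order
  sqrt (Q \<rho> \<gamma> / p) for vectors of squared length at most \<rho> whose Gram matrix has
  norm at most \<gamma>. Eigenvectors at level \<nu> have \<rho> = n / \<nu>^2 and \<gamma> = 1;
  this gives sqrt (Q / s) n / \<nu>, which is \<theta> / \<nu> up to a constant. An eigenvalue near
  \<nu> thus moves by O(\<theta>) at every scale, whereas the Gram matrix of all eigenvectors beyond
  \<theta> is controlled only up to an error of order 1, useless for eigenvalues of order n. This is
  why each eigenvalue beyond \<theta> gets events of its own. The coupling sqrt (\<theta> \<nu>) is
  squared and divided by a spectral gap of order \<nu>, as in second-order perturbation theory, and
  \<theta> remains. The tail needs decoupling because its sampled form is quadratic in the coins,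
  while the Bernstein inequality treats sums linear in them. Vectors are functions on finite index
  sets, so that a principal submatrix is the same function summed over a smaller set.\<close>

definition ip :: "'a set \<Rightarrow> ('a \<Rightarrow> real) \<Rightarrow> ('a \<Rightarrow> real) \<Rightarrow> real" where
  "ip J x y = (\<Sum>i\<in>J. x i * y i)"

lemma ip_commute: "ip J x y = ip J y x"
  by (simp add: ip_def mult.commute)

lemma ip_nonneg [simp]: "0 \<le> ip J x x"
  by (simp add: ip_def sum_nonneg)

lemma ip_diff_left: "ip J (\<lambda>i. x i - y i) z = ip J x z - ip J y z"
  by (simp add: ip_def algebra_simps sum_subtractf)

lemma ip_diff_right: "ip J z (\<lambda>i. x i - y i) = ip J z x - ip J z y"
  by (simp add: ip_def algebra_simps sum_subtractf)

lemma ip_scale_left: "ip J (\<lambda>i. c * x i) z = c * ip J x z"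
  by (simp add: ip_def sum_distrib_left mult.assoc)

lemma ip_scale_right: "ip J z (\<lambda>i. c * x i) = c * ip J z x"
  by (simp add: ip_def sum_distrib_left mult_ac)

lemma ip_sum_left: "ip J (\<lambda>i. \<Sum>k\<in>K. f k i) z = (\<Sum>k\<in>K. ip J (f k) z)"
proof -
  have "ip J (\<lambda>i. \<Sum>k\<in>K. f k i) z = (\<Sum>i\<in>J. \<Sum>k\<in>K. f k i * z i)"
    by (simp add: ip_def sum_distrib_right)
  also have "\<dots> = (\<Sum>k\<in>K. ip J (f k) z)"
    unfolding ip_def by (rule sum.swap)
  finally show ?thesis .
qed

lemma ip_sum_right: "ip J z (\<lambda>i. \<Sum>k\<in>K. f k i) = (\<Sum>k\<in>K. ip J z (f k))"
  using ip_sum_left[of J f K z] by (simp add: ip_commute[of J z])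

lemma ip_zero_iff: "finite J \<Longrightarrow> ip J x x = 0 \<longleftrightarrow> (\<forall>i\<in>J. x i = 0)"
  unfolding ip_def by (subst sum_nonneg_eq_0_iff) auto

lemma ip_cauchy_schwarz: "(ip J x y)\<^sup>2 \<le> ip J x x * ip J y y"
  using Cauchy_Schwarz_ineq_sum[of x y J] by (simp add: ip_def power2_eq_square)

lemma ip_cauchy_schwarz_sqrt: "\<bar>ip J x y\<bar> \<le> sqrt (ip J x x) * sqrt (ip J y y)"
  using real_sqrt_le_mono[OF ip_cauchy_schwarz[of J x y]] by (simp add: real_sqrt_mult)

lemma sum_delta_real:
  fixes f :: "'a \<Rightarrow> real"
  assumes "finite J" "k \<in> J"
  shows "(\<Sum>i\<in>J. (if i = k then 1 else 0) * f i) = f k"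
    and "(\<Sum>i\<in>J. (if k = i then 1 else 0) * f i) = f k"
    and "(\<Sum>i\<in>J. f i * (if i = k then 1 else 0)) = f k"
    and "(\<Sum>i\<in>J. f i * (if k = i then 1 else 0)) = f k"
  using assms by (simp_all add: if_distrib[where f = "\<lambda>c. c * _"] if_distrib[where f = "\<lambda>c. _ * c"] cong: if_cong)

text \<open>Basis vectors are indexed by the coordinate set itself, which makes \<open>u\<close> a
  square orthogonal matrix; the second clause is the completeness relation that yields
  Parseval.\<close>

definition onb :: "'a set \<Rightarrow> ('a \<Rightarrow> 'a \<Rightarrow> real) \<Rightarrow> bool" where
  "onb J u \<longleftrightarrow> (\<forall>l\<in>J. \<forall>k\<in>J. ip J (u l) (u k) = (if l = k then 1 else 0)) \<and>
     (\<forall>i\<in>J. \<forall>k\<in>J. (\<Sum>l\<in>J. u l i * u l k) = (if i = k then 1 else 0))"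

definition spectral :: "'a set \<Rightarrow> ('a \<Rightarrow> 'a \<Rightarrow> real) \<Rightarrow> ('a \<Rightarrow> real) \<Rightarrow> ('a \<Rightarrow> 'a \<Rightarrow> real) \<Rightarrow> bool" where
  "spectral J a lam u \<longleftrightarrow> onb J u \<and> (\<forall>i\<in>J. \<forall>k\<in>J. a i k = (\<Sum>l\<in>J. lam l * u l i * u l k))"

lemma onb_ip: "\<lbrakk>onb J u; l \<in> J; k \<in> J\<rbrakk> \<Longrightarrow> ip J (u l) (u k) = (if l = k then 1 else 0)"
  by (simp add: onb_def)

lemma onb_parseval:
  assumes "finite J" "onb J u"
  shows "(\<Sum>l\<in>J. ip J (u l) x * ip J (u l) y) = ip J x y"
proof -
  have "(\<Sum>l\<in>J. ip J (u l) x * ip J (u l) y) = (\<Sum>l\<in>J. \<Sum>i\<in>J. \<Sum>k\<in>J. x i * (y k * (u l i * u l k)))"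
    unfolding ip_def sum_product by (simp add: mult_ac)
  also have "\<dots> = (\<Sum>i\<in>J. \<Sum>k\<in>J. x i * (y k * (\<Sum>l\<in>J. u l i * u l k)))"
    by (subst sum.swap, rule sum.cong[OF refl], subst sum.swap) (simp add: sum_distrib_left)
  also have "\<dots> = (\<Sum>i\<in>J. x i * (\<Sum>k\<in>J. y k * (if i = k then 1 else 0)))"
    using assms(2) by (simp add: onb_def sum_distrib_left)
  also have "\<dots> = ip J x y"
    unfolding ip_def by (rule sum.cong[OF refl], subst sum_delta_real[OF assms(1)]) auto
  finally show ?thesis .
qed

lemma onb_compose:
  assumes "finite J" "onb J h" "onb J u"
  shows "onb J (\<lambda>l i. \<Sum>k\<in>J. u l k * h k i)"
  unfolding onb_def
proof (intro conjI ballI)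
  fix l m assume lm: "l \<in> J" "m \<in> J"
  have "ip J (\<lambda>i. \<Sum>k\<in>J. u l k * h k i) (\<lambda>i. \<Sum>k\<in>J. u m k * h k i)
     = (\<Sum>k\<in>J. u l k * (\<Sum>k'\<in>J. u m k' * ip J (h k) (h k')))"
    unfolding ip_sum_left ip_sum_right ip_scale_left ip_scale_right
    by (simp add: sum_distrib_left mult_ac)
  also have "\<dots> = (\<Sum>k\<in>J. u l k * (\<Sum>k'\<in>J. u m k' * (if k = k' then 1 else 0)))"
    using assms(2) by (simp add: onb_def)
  also have "\<dots> = ip J (u l) (u m)"
    unfolding ip_def by (rule sum.cong[OF refl], subst sum_delta_real[OF assms(1)]) auto
  finally show "ip J (\<lambda>i. \<Sum>k\<in>J. u l k * h k i) (\<lambda>i. \<Sum>k\<in>J. u m k * h k i) = (if l = m then 1 else 0)"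
    using assms(3) lm by (simp add: onb_def)
next
  fix i j assume ij: "i \<in> J" "j \<in> J"
  have "(\<Sum>l\<in>J. (\<Sum>k\<in>J. u l k * h k i) * (\<Sum>k\<in>J. u l k * h k j))
     = (\<Sum>l\<in>J. ip J (u l) (\<lambda>k. h k i) * ip J (u l) (\<lambda>k. h k j))"
    by (simp add: ip_def)
  also have "\<dots> = (\<Sum>k\<in>J. h k i * h k j)"
    by (simp add: onb_parseval[OF assms(1,3)]) (simp add: ip_def)
  finally show "(\<Sum>l\<in>J. (\<Sum>k\<in>J. u l k * h k i) * (\<Sum>k\<in>J. u l k * h k j)) = (if i = j then 1 else 0)"
    using assms(2) ij by (simp add: onb_def)
qed

text \<open>An eigenvalue exists over the complex numbers. The Hermitian form \<open>q\<close> of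
  its eigenvector is real by symmetry, hence so is the eigenvalue, and the real or the imaginary
  part of the eigenvector is a nonzero real eigenvector.\<close>

lemma symmetric_eigenvector:
  fixes a :: "'a \<Rightarrow> 'a \<Rightarrow> real"
  assumes fin: "finite J" and ne: "J \<noteq> {}" and sym: "\<And>i k. i \<in> J \<Longrightarrow> k \<in> J \<Longrightarrow> a i k = a k i"
  shows "\<exists>l v. ip J v v = 1 \<and> (\<forall>i\<in>J. (\<Sum>k\<in>J. a i k * v k) = l * v i)"
proof -
  define n where "n = card J"
  obtain h where h: "bij_betw h {..<n} J"
    using ex_bij_betw_nat_finite[OF fin] by (auto simp: n_def lessThan_atLeast0)
  define g where "g = inv_into {..<n} h"
  have hJ: "h r \<in> J" if "r < n" for r using h that by (auto simp: bij_betw_def)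
  have gJ: "g i < n" "h (g i) = i" if "i \<in> J" for i
    using h that unfolding g_def
    by (metis bij_betw_def inv_into_into lessThan_iff, metis bij_betw_inv_into_right)
  define A :: "complex mat" where "A = Matrix.mat n n (\<lambda>(r, t). of_real (a (h r) (h t)))"
  have A: "A \<in> carrier_mat n n" by (simp add: A_def)
  have "n \<noteq> 0" using ne fin by (simp add: n_def)
  then obtain z where "eigenvalue A z"
    using spectrum_non_empty[OF A] by (auto simp: spectrum_def)
  then obtain w where w: "w \<in> carrier_vec n" "w \<noteq> 0\<^sub>v n" "A *\<^sub>v w = z \<cdot>\<^sub>v w"
    using A by (auto simp: eigenvalue_def eigenvector_def)
  define c where "c i = w $ g i" for i
  have sumJ: "(\<Sum>t = 0..<n. F (h t) t) = (\<Sum>k\<in>J. F k (g k))" for F :: "'a \<Rightarrow> nat \<Rightarrow> complex"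
    by (rule sum.reindex_bij_witness[of _ g h])
       (use h gJ hJ in \<open>auto simp: g_def bij_betw_def inv_into_f_f\<close>)
  have ev: "(\<Sum>k\<in>J. of_real (a i k) * c k) = z * c i" if i: "i \<in> J" for i
  proof -
    have "(A *\<^sub>v w) $ g i = (z \<cdot>\<^sub>v w) $ g i" by (simp add: w)
    then have "(\<Sum>t = 0..<n. of_real (a i (h t)) * w $ t) = z * w $ g i"
      using w(1) gJ[OF i] by (simp add: A_def scalar_prod_def)
    then show ?thesis using sumJ[of "\<lambda>k t. of_real (a i k) * w $ t"] by (simp add: c_def)
  qed
  obtain r where r: "r < n" "w $ r \<noteq> 0" using w(1,2) by (metis carrier_vecD eq_vecI index_zero_vec)
  have cne: "\<exists>i\<in>J. c i \<noteq> 0"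
    using r hJ[OF r(1)] h by (intro bexI[of _ "h r"]) (auto simp: c_def g_def bij_betw_def inv_into_f_f)
  define N where "N = (\<Sum>i\<in>J. (cmod (c i))\<^sup>2)"
  have N: "N > 0"
    using cne fin unfolding N_def by (meson sum_pos2 zero_le_power2 zero_less_norm_iff zero_less_power)
  define q where "q = (\<Sum>i\<in>J. \<Sum>k\<in>J. cnj (c i) * (of_real (a i k) * c k))"
  have q1: "q = z * of_real N"
  proof -
    have "q = (\<Sum>i\<in>J. cnj (c i) * (z * c i))"
      unfolding q_def by (simp add: sum_distrib_left[symmetric] ev)
    also have "\<dots> = z * of_real N"
      by (simp add: N_def sum_distrib_left complex_norm_square mult_ac del: of_real_power)
    finally show ?thesis .
  qed
  have "cnj q = (\<Sum>i\<in>J. \<Sum>k\<in>J. c i * (of_real (a i k) * cnj (c k)))"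
    by (simp add: q_def)
  also have "\<dots> = (\<Sum>k\<in>J. \<Sum>i\<in>J. c i * (of_real (a i k) * cnj (c k)))" by (rule sum.swap)
  also have "\<dots> = q"
    unfolding q_def by (intro sum.cong refl) (simp add: sym mult_ac)
  finally have "Im q = 0" by (simp add: complex_eq_iff)
  then have "Im z = 0" using q1 N by simp
  then have zr: "z = of_real (Re z)" by (simp add: complex_eq_iff)
  have re: "(\<Sum>k\<in>J. a i k * Re (c k)) = Re z * Re (c i)"
   and im: "(\<Sum>k\<in>J. a i k * Im (c k)) = Re z * Im (c i)" if "i \<in> J" for i
    using arg_cong[OF ev[OF that], of Re] arg_cong[OF ev[OF that], of Im] zr
    using \<open>Im z = 0\<close> by simp_all
  have "\<exists>v. (\<exists>i\<in>J. v i \<noteq> 0) \<and> (\<forall>i\<in>J. (\<Sum>k\<in>J. a i k * v k) = Re z * v i)"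
  proof (cases "\<exists>i\<in>J. Re (c i) \<noteq> 0")
    case True then show ?thesis using re by (intro exI[of _ "\<lambda>i. Re (c i)"]) blast
  next
    case False
    then have "\<exists>i\<in>J. Im (c i) \<noteq> 0" using cne by (auto simp: complex_eq_iff)
    then show ?thesis using im by (intro exI[of _ "\<lambda>i. Im (c i)"]) blast
  qed
  then obtain v where v: "\<exists>i\<in>J. v i \<noteq> 0" "\<forall>i\<in>J. (\<Sum>k\<in>J. a i k * v k) = Re z * v i" by blast
  have pos: "ip J v v > 0" using v(1) ip_zero_iff[OF fin, of v] ip_nonneg[of J v] by (metis less_eq_real_def)
  let ?s = "1 / sqrt (ip J v v)"
  have "ip J (\<lambda>i. ?s * v i) (\<lambda>i. ?s * v i) = ?s * (?s * ip J v v)"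
    by (simp only: ip_scale_left ip_scale_right)
  also have "\<dots> = 1" using pos by (simp add: field_simps)
  finally have "ip J (\<lambda>i. ?s * v i) (\<lambda>i. ?s * v i) = 1" .
  moreover have "(\<Sum>k\<in>J. a i k * (?s * v k)) = Re z * (?s * v i)" if "i \<in> J" for i
  proof -
    have "(\<Sum>k\<in>J. a i k * (?s * v k)) = ?s * (\<Sum>k\<in>J. a i k * v k)"
      by (simp add: sum_distrib_left mult_ac)
    then show ?thesis using v(2) that by simp
  qed
  ultimately show ?thesis by blast
qed

text \<open>The reflection that exchanges \<open>v\<close> with the coordinate vector of
  \<open>j\<close> is orthogonal and has \<open>v\<close> as its row \<open>j\<close>; this
  completes a unit vector to an orthonormal basis.\<close>

lemma householder:
  assumes fin: "finite K" and j: "j \<in> K" and v: "ip K v v = 1"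
  shows "\<exists>h. onb K h \<and> (\<forall>i\<in>K. h j i = v i)"
proof -
  define e where "e i = (if i = j then 1 else 0 :: real)" for i
  define z where "z i = v i - e i" for i
  \<comment> \<open>If \<open>v\<close> already is the coordinate vector, division by zero gives c =
    0 and the reflection degenerates to the identity, as desired.\<close>
  define c where "c = 2 / ip K z z"
  define h where "h k i = (if i = k then 1 else 0) - c * z k * z i" for k i
  have ev: "ip K e x = x j" for x
    using sum_delta_real(1)[OF fin j, of x] by (simp add: ip_def e_def)
  have ej: "e j = 1" by (simp add: e_def)
  have zz: "ip K z z = 2 - 2 * v j"
    unfolding z_def ip_diff_left ip_diff_right
    using ev[of v] ev[of e] v ip_commute[of K v e] by (simp add: ej)
  have sq: "ip K (h l) (h k) = (if l = k then 1 else 0)" if lk: "l \<in> K" "k \<in> K" for l k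
  proof -
    let ?d = "\<lambda>l i. if i = l then 1 else 0 :: real"
    have d: "ip K (?d l) x = x l" if "l \<in> K" for l x
      using sum_delta_real(1)[OF fin that, of x] by (simp add: ip_def)
    have h': "h k = (\<lambda>i. ?d k i - (c * z k) * z i)" for k
      by (simp add: h_def fun_eq_iff)
    have "ip K (h l) (h k) = ip K (?d l) (?d k) - c * z k * ip K (?d l) z
        - (c * z l * ip K z (?d k) - c * z l * (c * z k * ip K z z))"
      unfolding h' ip_diff_left ip_diff_right ip_scale_left ip_scale_right by (simp add: algebra_simps)
    also have "\<dots> = ?d k l - c * z k * z l - (c * z l * z k - c * z l * (c * z k * ip K z z))"
      using d[OF lk(1), of "?d k"] d[OF lk(1), of z] d[OF lk(2), of z] ip_commute[of K z "?d k"]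
      by (simp only:)
    also have "\<dots> = (if l = k then 1 else 0)"
      by (simp add: c_def)
    finally show ?thesis .
  qed
  have hs: "h k i = h i k" for i k by (simp add: h_def)
  have "onb K h"
  proof -
    have "(\<Sum>l\<in>K. h l i * h l k) = ip K (h i) (h k)" for i k
      unfolding ip_def by (intro sum.cong refl) (metis hs)
    then show ?thesis unfolding onb_def using sq by auto
  qed
  moreover have "h j i = v i" if "i \<in> K" for i
  proof (cases "ip K z z = 0")
    case True
    then have "\<forall>i\<in>K. z i = 0" using ip_zero_iff[OF fin] by blast
    then show ?thesis using that j by (simp add: h_def z_def e_def)
  next
    case False
    have "c * z j = -1"
      using zz False unfolding c_def by (simp add: z_def e_def field_simps)
    then show ?thesis by (simp add: h_def z_def e_def)
  qed
  ultimately show ?thesis by blast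
qed

text \<open>Deflation: in an orthonormal basis that has an eigenvector at position \<open>j\<close>,
  row and column \<open>j\<close> vanish off the diagonal, so the induction hypothesis applies to
  the remaining block.\<close>

theorem spectral_exists:
  fixes a :: "'a \<Rightarrow> 'a \<Rightarrow> real"
  assumes "finite J" "\<And>i k. i \<in> J \<Longrightarrow> k \<in> J \<Longrightarrow> a i k = a k i"
  shows "\<exists>lam u. spectral J a lam u"
  using assms
proof (induction J arbitrary: a rule: finite_induct)
  case empty
  then show ?case by (simp add: spectral_def onb_def)
next
  case (insert j J)
  let ?K = "insert j J"
  have finK: "finite ?K" using insert.hyps by simp
  obtain l0 v where v: "ip ?K v v = 1" "\<And>i. i \<in> ?K \<Longrightarrow> (\<Sum>k\<in>?K. a i k * v k) = l0 * v i"
    using symmetric_eigenvector[OF finK insert_not_empty, of a] insert.prems by blast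
  obtain h where h: "onb ?K h" "\<And>i. i \<in> ?K \<Longrightarrow> h j i = v i"
    using householder[OF finK _ v(1), of j] by auto
  define b where "b k l = (\<Sum>i\<in>?K. \<Sum>m\<in>?K. h k i * a i m * h l m)" for k l
  have bsym: "b k l = b l k" if "k \<in> ?K" "l \<in> ?K" for k l
  proof -
    have "b k l = (\<Sum>m\<in>?K. \<Sum>i\<in>?K. h k i * a i m * h l m)" unfolding b_def by (rule sum.swap)
    also have "\<dots> = b l k" unfolding b_def
      by (intro sum.cong refl) (use insert.prems in \<open>auto simp: mult_ac\<close>)
    finally show ?thesis .
  qed
  have bj: "b k j = (if k = j then l0 else 0)" if k: "k \<in> ?K" for k
  proof -
    have "b k j = (\<Sum>i\<in>?K. h k i * (\<Sum>m\<in>?K. a i m * v m))"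
      unfolding b_def by (intro sum.cong refl) (simp add: sum_distrib_left mult.assoc h(2) del: sum.insert)
    also have "\<dots> = l0 * ip ?K (h k) (h j)"
      unfolding ip_def sum_distrib_left[of l0]
      by (intro sum.cong refl) (simp add: v(2) h(2) del: sum.insert)
    also have "\<dots> = (if k = j then l0 else 0)"
      using onb_ip[OF h(1) k, of j] by simp
    finally show ?thesis .
  qed
  have "\<exists>lam u. spectral J b lam u"
    by (rule insert.IH) (use bsym in auto)
  then obtain lam u where u: "onb J u" "\<And>i k. i \<in> J \<Longrightarrow> k \<in> J \<Longrightarrow> b i k = (\<Sum>l\<in>J. lam l * u l i * u l k)"
    by (auto simp: spectral_def)
  define lam' where "lam' l = (if l = j then l0 else lam l)" for l
  define u' where "u' l i = (if l = j \<or> i = j then (if l = i then 1 else 0) else u l i)" for l i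
  have J: "l \<noteq> j" if "l \<in> J" for l using that insert.hyps by auto
  have u'J: "u' l i = u l i" if "l \<in> J" "i \<in> J" for l i using J that by (simp add: u'_def)
  have u'j: "u' l j = 0" "u' j l = 0" if "l \<in> J" for l using J[OF that] by (simp_all add: u'_def)
  have u'jj: "u' j j = 1" by (simp add: u'_def)
  have "onb ?K u'"
    using u(1) insert.hyps J unfolding onb_def ip_def by (auto simp: u'j u'J u'jj)
  have b_dec: "b k m = (\<Sum>l\<in>?K. lam' l * u' l k * u' l m)" if km: "k \<in> ?K" "m \<in> ?K" for k m
  proof -
    have lamJ: "(\<Sum>l\<in>J. lam' l * u' l k * u' l m) = (\<Sum>l\<in>J. lam l * u l k * u l m)" if "k \<in> J" "m \<in> J"
      using that J by (intro sum.cong refl) (auto simp: lam'_def u'J)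
    consider "k = j" "m = j" | "k = j" "m \<in> J" | "k \<in> J" "m = j" | "k \<in> J" "m \<in> J" using km by auto
    then show ?thesis
    proof cases
      case 1 then show ?thesis using bj[of j] insert.hyps by (simp add: u'j u'jj lam'_def)
    next
      case 2 then show ?thesis using bj[of m] bsym[of j m] insert.hyps J by (auto simp: u'j u'jj lam'_def)
    next
      case 3 then show ?thesis using bj[of k] insert.hyps J by (auto simp: u'j u'jj lam'_def)
    next
      case 4 then show ?thesis using insert.hyps u(2)[of k m] lamJ by (simp add: u'j)
    qed
  qed
  define w where "w l i = (\<Sum>k\<in>?K. u' l k * h k i)" for l i
  have "onb ?K w" unfolding w_def by (rule onb_compose[OF finK h(1) \<open>onb ?K u'\<close>])
  moreover have "a i m = (\<Sum>l\<in>?K. lam' l * w l i * w l m)" if im: "i \<in> ?K" "m \<in> ?K" for i m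
  proof -
    have r: "(\<Sum>k\<in>?K. h k i * h k m) = (if i = m then 1 else 0)" if "i \<in> ?K" "m \<in> ?K" for i m
      using h(1) that unfolding onb_def by blast
    have "(\<Sum>l\<in>?K. lam' l * w l i * w l m)
       = (\<Sum>l\<in>?K. \<Sum>k\<in>?K. \<Sum>k'\<in>?K. h k i * h k' m * (lam' l * u' l k * u' l k'))"
      unfolding w_def by (intro sum.cong refl)
        (simp add: sum_product sum_distrib_left mult_ac del: sum.insert)
    also have "\<dots> = (\<Sum>k\<in>?K. \<Sum>k'\<in>?K. h k i * h k' m * b k k')"
      by (subst sum.swap, rule sum.cong[OF refl], subst sum.swap)
        (simp add: b_dec sum_distrib_left del: sum.insert)
    also have "\<dots> = (\<Sum>k\<in>?K. \<Sum>k'\<in>?K. \<Sum>p\<in>?K. \<Sum>q\<in>?K. a p q * (h k p * h k i) * (h k' q * h k' m))"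
      unfolding b_def by (simp add: sum_distrib_left mult_ac del: sum.insert)
    also have "\<dots> = (\<Sum>k\<in>?K. \<Sum>p\<in>?K. \<Sum>k'\<in>?K. \<Sum>q\<in>?K. a p q * (h k p * h k i) * (h k' q * h k' m))"
      by (rule sum.cong[OF refl], rule sum.swap)
    also have "\<dots> = (\<Sum>k\<in>?K. \<Sum>p\<in>?K. \<Sum>q\<in>?K. \<Sum>k'\<in>?K. a p q * (h k p * h k i) * (h k' q * h k' m))"
      by (rule sum.cong[OF refl], rule sum.cong[OF refl], rule sum.swap)
    also have "\<dots> = (\<Sum>k\<in>?K. \<Sum>p\<in>?K. \<Sum>q\<in>?K. a p q * (h k p * h k i) * (\<Sum>k'\<in>?K. h k' q * h k' m))"
      by (simp add: sum_distrib_left del: sum.insert)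
    also have "\<dots> = (\<Sum>k\<in>?K. \<Sum>p\<in>?K. \<Sum>q\<in>?K. a p q * (h k p * h k i) * (if q = m then 1 else 0))"
      by (intro sum.cong refl) (simp only: r im)
    also have "\<dots> = (\<Sum>k\<in>?K. \<Sum>p\<in>?K. a p m * (h k p * h k i))"
      by (intro sum.cong refl) (rule sum_delta_real(3)[OF finK im(2)])
    also have "\<dots> = (\<Sum>p\<in>?K. a p m * (\<Sum>k\<in>?K. h k p * h k i))"
      by (subst sum.swap) (simp add: sum_distrib_left del: sum.insert)
    also have "\<dots> = (\<Sum>p\<in>?K. a p m * (if p = i then 1 else 0))"
      by (intro sum.cong refl) (simp only: r im)
    also have "\<dots> = a i m"
      by (rule sum_delta_real(3)[OF finK im(1)])
    finally show ?thesis by simp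
  qed
  ultimately show ?case unfolding spectral_def by blast
qed

lemma spectral_eigenvector:
  assumes "finite J" "spectral J a lam u" "i \<in> J" "l \<in> J"
  shows "(\<Sum>k\<in>J. a i k * u l k) = lam l * u l i"
proof -
  have "(\<Sum>k\<in>J. a i k * u l k) = (\<Sum>k\<in>J. \<Sum>m\<in>J. lam m * u m i * (u m k * u l k))"
    using assms by (simp add: spectral_def sum_distrib_left sum_distrib_right mult_ac)
  also have "\<dots> = (\<Sum>m\<in>J. lam m * u m i * ip J (u m) (u l))"
    by (subst sum.swap) (simp add: ip_def sum_distrib_left)
  also have "\<dots> = (\<Sum>m\<in>J. lam m * u m i * (if m = l then 1 else 0))"
    using assms by (intro sum.cong refl) (simp add: spectral_def onb_ip)
  also have "\<dots> = lam l * u l i"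
    by (rule sum_delta_real(3)[OF assms(1,4)])
  finally show ?thesis .
qed

lemma spectral_bilinear:
  assumes "finite J" "spectral J a lam u"
  shows "(\<Sum>i\<in>J. \<Sum>k\<in>J. a i k * x i * y k) = (\<Sum>l\<in>J. lam l * ip J (u l) x * ip J (u l) y)"
proof -
  have "(\<Sum>i\<in>J. \<Sum>k\<in>J. a i k * x i * y k) = (\<Sum>i\<in>J. \<Sum>k\<in>J. \<Sum>l\<in>J. lam l * (u l i * x i) * (u l k * y k))"
    using assms(2) by (simp add: spectral_def sum_distrib_left sum_distrib_right mult_ac)
  also have "\<dots> = (\<Sum>i\<in>J. \<Sum>l\<in>J. \<Sum>k\<in>J. lam l * (u l i * x i) * (u l k * y k))"
    by (rule sum.cong[OF refl], rule sum.swap)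
  also have "\<dots> = (\<Sum>l\<in>J. \<Sum>i\<in>J. \<Sum>k\<in>J. lam l * (u l i * x i) * (u l k * y k))"
    by (rule sum.swap)
  also have "\<dots> = (\<Sum>l\<in>J. lam l * ip J (u l) x * ip J (u l) y)"
    by (simp add: ip_def sum_product sum_distrib_left mult_ac)
  finally show ?thesis .
qed

subsection \<open>Independent inclusion with probability p\<close>

text \<open>Expectation over a random subset, spelled out as a weighted sum so that induction over
  the coins and exchanges of sums need no measure theory. \<open>prob_Pi_bernoulli\<close> connects
  it to the product distribution.\<close>

definition samp_exp :: "real \<Rightarrow> 'i set \<Rightarrow> ('i set \<Rightarrow> real) \<Rightarrow> real" where
  "samp_exp p I f = (\<Sum>S\<in>Pow I. p ^ card S * (1 - p) ^ card (I - S) * f S)"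

definition samp_prob :: "real \<Rightarrow> 'i set \<Rightarrow> ('i set \<Rightarrow> bool) \<Rightarrow> real" where
  "samp_prob p I P = samp_exp p I (\<lambda>S. of_bool (P S))"

lemma samp_exp_empty [simp]: "samp_exp p {} f = f {}"
  by (simp add: samp_exp_def)

text \<open>Conditioning on the coin of \<open>i\<close>: the recursion behind independence and
  resampling.\<close>

lemma samp_exp_insert:
  assumes "finite I" "i \<notin> I"
  shows "samp_exp p (insert i I) f = p * samp_exp p I (\<lambda>S. f (insert i S)) + (1 - p) * samp_exp p I f"
proof -
  have fin: "finite S" if "S \<in> Pow I" for S using that assms(1) finite_subset by auto
  have inj: "inj_on (insert i) (Pow I)" using assms(2) by (auto simp: inj_on_def)
  have "(\<Sum>S\<in>insert i ` Pow I. p ^ card S * (1 - p) ^ card (insert i I - S) * f S)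
      = (\<Sum>S\<in>Pow I. p ^ card (insert i S) * (1 - p) ^ card (insert i I - insert i S) * f (insert i S))"
    by (subst sum.reindex[OF inj]) (simp add: o_def)
  also have "\<dots> = (\<Sum>S\<in>Pow I. p * (p ^ card S * (1 - p) ^ card (I - S) * f (insert i S)))"
  proof (rule sum.cong[OF refl])
    fix S assume S: "S \<in> Pow I"
    then have "insert i I - insert i S = I - S" "i \<notin> S" using assms(2) by auto
    then show "p ^ card (insert i S) * (1 - p) ^ card (insert i I - insert i S) * f (insert i S)
        = p * (p ^ card S * (1 - p) ^ card (I - S) * f (insert i S))"
      using fin[OF S] by simp
  qed
  finally have 1: "(\<Sum>S\<in>insert i ` Pow I. p ^ card S * (1 - p) ^ card (insert i I - S) * f S)
      = p * samp_exp p I (\<lambda>S. f (insert i S))"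
    by (simp add: samp_exp_def sum_distrib_left)
  have 2: "(\<Sum>S\<in>Pow I. p ^ card S * (1 - p) ^ card (insert i I - S) * f S) = (1 - p) * samp_exp p I f"
    unfolding samp_exp_def sum_distrib_left
  proof (rule sum.cong[OF refl])
    fix S assume S: "S \<in> Pow I"
    then have "insert i I - S = insert i (I - S)" "i \<notin> I - S" using assms(2) by auto
    then show "p ^ card S * (1 - p) ^ card (insert i I - S) * f S
        = (1 - p) * (p ^ card S * (1 - p) ^ card (I - S) * f S)"
      using assms(1) by simp
  qed
  have "Pow I \<inter> insert i ` Pow I = {}" using assms(2) by auto
  then show ?thesis
    unfolding samp_exp_def[of p "insert i I"] Pow_insert
    using assms(1) 1 2 by (subst sum.union_disjoint) auto
qed

lemma samp_exp_cong:
  "\<lbrakk>\<And>S. S \<subseteq> I \<Longrightarrow> f S = g S\<rbrakk> \<Longrightarrow> samp_exp p I f = samp_exp p I g"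
  by (simp add: samp_exp_def)

lemma samp_exp_const: "finite I \<Longrightarrow> samp_exp p I (\<lambda>_. c) = c"
  by (induction I rule: finite_induct) (simp_all add: samp_exp_insert algebra_simps)

lemma samp_exp_scale: "samp_exp p I (\<lambda>S. c * f S) = c * samp_exp p I f"
  by (simp add: samp_exp_def sum_distrib_left mult_ac)

lemma samp_exp_add: "samp_exp p I (\<lambda>S. f S + g S) = samp_exp p I f + samp_exp p I g"
  by (simp add: samp_exp_def sum.distrib algebra_simps)

lemma samp_exp_diff: "samp_exp p I (\<lambda>S. f S - g S) = samp_exp p I f - samp_exp p I g"
  by (simp add: samp_exp_def sum_subtractf algebra_simps)

lemma samp_exp_sum: "samp_exp p I (\<lambda>S. \<Sum>k\<in>K. f k S) = (\<Sum>k\<in>K. samp_exp p I (f k))"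
  unfolding samp_exp_def by (subst sum.swap) (simp add: sum_distrib_left)

lemma samp_exp_mono:
  "\<lbrakk>0 \<le> p; p \<le> 1; \<And>S. S \<subseteq> I \<Longrightarrow> f S \<le> g S\<rbrakk> \<Longrightarrow> samp_exp p I f \<le> samp_exp p I g"
  unfolding samp_exp_def by (intro sum_mono mult_left_mono) auto

lemma samp_exp_nonneg:
  "\<lbrakk>0 \<le> p; p \<le> 1; \<And>S. S \<subseteq> I \<Longrightarrow> 0 \<le> f S\<rbrakk> \<Longrightarrow> 0 \<le> samp_exp p I f"
  unfolding samp_exp_def by (intro sum_nonneg mult_nonneg_nonneg) auto

text \<open>Fubini for disjoint sets of coins. It allows the rows to be revealed before the columns
  in the decoupled estimate.\<close>

lemma samp_exp_Un:
  assumes "finite I" "finite J" "I \<inter> J = {}"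
  shows "samp_exp p (I \<union> J) f = samp_exp p I (\<lambda>S. samp_exp p J (\<lambda>S'. f (S \<union> S')))"
  using assms
proof (induction I arbitrary: f rule: finite_induct)
  case (insert i I)
  then have "samp_exp p (insert i I \<union> J) f
      = p * samp_exp p (I \<union> J) (\<lambda>S. f (insert i S)) + (1 - p) * samp_exp p (I \<union> J) f"
    by (simp add: samp_exp_insert)
  also have "\<dots> = samp_exp p (insert i I) (\<lambda>S. samp_exp p J (\<lambda>S'. f (S \<union> S')))"
    using insert.hyps insert.prems
    by (subst samp_exp_insert) (simp_all add: insert.IH)
  finally show ?case .
qed simp

lemma samp_prob_mono:
  "\<lbrakk>0 \<le> p; p \<le> 1; \<And>S. S \<subseteq> I \<Longrightarrow> P S \<Longrightarrow> Q S\<rbrakk> \<Longrightarrow> samp_prob p I P \<le> samp_prob p I Q"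
  unfolding samp_prob_def by (rule samp_exp_mono) auto

lemma samp_prob_disj:
  assumes "0 \<le> p" "p \<le> 1"
  shows "samp_prob p I (\<lambda>S. P S \<or> Q S) \<le> samp_prob p I P + samp_prob p I Q"
  unfolding samp_prob_def samp_exp_add[symmetric] by (rule samp_exp_mono[OF assms]) auto

lemma samp_prob_Bex:
  assumes "0 \<le> p" "p \<le> 1" "finite K"
  shows "samp_prob p I (\<lambda>S. \<exists>k\<in>K. P k S) \<le> (\<Sum>k\<in>K. samp_prob p I (P k))"
  unfolding samp_prob_def samp_exp_sum[symmetric]
proof (rule samp_exp_mono[OF assms(1,2)])
  fix S
  show "of_bool (\<exists>k\<in>K. P k S) \<le> (\<Sum>k\<in>K. of_bool (P k S) :: real)"
  proof (cases "\<exists>k\<in>K. P k S")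
    case True
    then obtain k where "k \<in> K" "P k S" by blast
    then show ?thesis using member_le_sum[of k K "\<lambda>k. of_bool (P k S) :: real"] assms(3) by auto
  qed (simp add: sum_nonneg)
qed

lemma samp_prob_markov:
  assumes "0 \<le> p" "p \<le> 1" "c > 0" "\<And>S. S \<subseteq> I \<Longrightarrow> 0 \<le> f S"
  shows "samp_prob p I (\<lambda>S. c \<le> f S) \<le> samp_exp p I f / c"
proof -
  have "samp_prob p I (\<lambda>S. c \<le> f S) \<le> samp_exp p I (\<lambda>S. (1 / c) * f S)"
    unfolding samp_prob_def
  proof (rule samp_exp_mono[OF assms(1,2)])
    fix S assume "S \<subseteq> I"
    then show "of_bool (c \<le> f S) \<le> (1 / c) * f S" using assms(3,4) by (auto simp: field_simps)
  qed
  then show ?thesis by (simp only: samp_exp_scale) simp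
qed

subsection \<open>Moments of a random sum of rank-one matrices\<close>

text \<open>The differences \<open>a ^ i - b ^ i\<close> and \<open>a ^ j - b ^ j\<close> have the
  same sign, so their product is nonnegative.\<close>

lemma power_product_le:
  fixes a b :: real
  assumes "0 \<le> a" "0 \<le> b"
  shows "a ^ i * b ^ j + a ^ j * b ^ i \<le> a ^ (i + j) + b ^ (i + j)"
proof -
  have "0 \<le> (a ^ i - b ^ i) * (a ^ j - b ^ j)"
  proof (cases "a \<le> b")
    case True
    then show ?thesis using assms by (intro mult_nonpos_nonpos) (simp_all add: power_mono)
  next
    case False
    then show ?thesis using assms by (intro mult_nonneg_nonneg) (simp_all add: power_mono)
  qed
  then show ?thesis by (simp add: algebra_simps power_add)
qed

text \<open>After a - b is factored out, the terms i and m - 1 - i of the geometric sum are paired.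
  Since m - 1 is even, the bound on a pair does not depend on the signs of a and b.\<close>

lemma odd_power_diff_le:
  fixes a b :: real
  assumes "odd m"
  shows "(a ^ m - b ^ m) * (a - b) \<le> real m / 2 * ((a - b)\<^sup>2 * (a ^ (m - 1) + b ^ (m - 1)))"
proof -
  have n: "even (m - 1)" using assms by simp
  have m: "m > 0" using assms by (cases m) auto
  define T where "T i = b ^ (m - Suc i) * a ^ i" for i
  have T: "a ^ m - b ^ m = (a - b) * (\<Sum>i<m. T i)"
    unfolding T_def by (rule power_diff_sumr2)
  have "2 * (\<Sum>i<m. T i) = (\<Sum>i<m. T i) + (\<Sum>i<m. T (m - Suc i))"
    by (simp add: sum.nat_diff_reindex)
  also have "\<dots> = (\<Sum>i<m. T i + T (m - Suc i))" by (simp add: sum.distrib)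
  also have "\<dots> \<le> (\<Sum>i<m. a ^ (m - 1) + b ^ (m - 1))"
  proof (rule sum_mono)
    fix i assume "i \<in> {..<m}"
    then have i: "i < m" by simp
    define j where "j = m - Suc i"
    have ij: "i + j = m - 1" "m - Suc j = i" using i by (auto simp: j_def)
    have "T i + T j \<le> \<bar>a\<bar> ^ i * \<bar>b\<bar> ^ j + \<bar>a\<bar> ^ j * \<bar>b\<bar> ^ i"
      unfolding T_def ij(2) j_def[symmetric]
      using abs_ge_self[of "b ^ j * a ^ i"] abs_ge_self[of "b ^ i * a ^ j"]
      by (simp add: abs_mult power_abs mult.commute)
    also have "\<dots> \<le> \<bar>a\<bar> ^ (i + j) + \<bar>b\<bar> ^ (i + j)" by (rule power_product_le) auto
    also have "\<dots> = a ^ (m - 1) + b ^ (m - 1)" unfolding ij(1) using n by (simp add: power_even_abs)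
    finally show "T i + T (m - Suc i) \<le> a ^ (m - 1) + b ^ (m - 1)" by (simp add: j_def)
  qed
  finally have "(\<Sum>i<m. T i) \<le> real m / 2 * (a ^ (m - 1) + b ^ (m - 1))" by simp
  then have "(a - b)\<^sup>2 * (\<Sum>i<m. T i) \<le> (a - b)\<^sup>2 * (real m / 2 * (a ^ (m - 1) + b ^ (m - 1)))"
    by (intro mult_left_mono) auto
  then show ?thesis unfolding T by (simp add: power2_eq_square mult_ac)
qed

text \<open>For a rank-one difference, \<open>(\<alpha> l - \<beta> k) \<langle>u l, v k\<rangle> = c \<langle>u l, w\<rangle> \<langle>v k, w\<rangle>\<close>. Both sides
  thereby become double sums over the squares \<open>\<langle>u l, v k\<rangle>\<^sup>2\<close>, and the inequality holds term by
  term by the scalar one.\<close>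
lemma rank_one_power_diff:
  fixes a b :: "'a \<Rightarrow> 'a \<Rightarrow> real"
  assumes fin: "finite J" and a: "spectral J a \<alpha> u" and b: "spectral J b \<beta> v"
    and diff: "\<And>i k. i \<in> J \<Longrightarrow> k \<in> J \<Longrightarrow> a i k = b i k + c * w i * w k"
    and c: "c > 0" and m: "odd m"
  shows "(\<Sum>l\<in>J. \<alpha> l ^ m * (ip J (u l) w)\<^sup>2) - (\<Sum>l\<in>J. \<beta> l ^ m * (ip J (v l) w)\<^sup>2)
    \<le> real m * c / 2 * ip J w w *
       ((\<Sum>l\<in>J. \<alpha> l ^ (m - 1) * (ip J (u l) w)\<^sup>2) + (\<Sum>l\<in>J. \<beta> l ^ (m - 1) * (ip J (v l) w)\<^sup>2))"
proof -
  define g where "g l k = ip J (u l) (v k)" for l k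
  have u: "onb J u" and v: "onb J v" using a b by (auto simp: spectral_def)
  have key: "(\<alpha> l - \<beta> k) * g l k = c * ip J (u l) w * ip J (v k) w" if lk: "l \<in> J" "k \<in> J" for l k
  proof -
    have "(\<Sum>i\<in>J. \<Sum>j\<in>J. a i j * u l i * v k j) = (\<Sum>m\<in>J. (if m = l then 1 else 0) * (\<alpha> m * ip J (u m) (v k)))"
      unfolding spectral_bilinear[OF fin a] by (intro sum.cong refl) (simp add: onb_ip[OF u] lk)
    then have 1: "(\<Sum>i\<in>J. \<Sum>j\<in>J. a i j * u l i * v k j) = \<alpha> l * g l k"
      using sum_delta_real(1)[OF fin lk(1)] by (simp add: g_def)
    have "(\<Sum>i\<in>J. \<Sum>j\<in>J. b i j * u l i * v k j) = (\<Sum>m\<in>J. (if m = k then 1 else 0) * (\<beta> m * ip J (v m) (u l)))"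
      unfolding spectral_bilinear[OF fin b] by (intro sum.cong refl) (simp add: onb_ip[OF v] lk)
    then have 2: "(\<Sum>i\<in>J. \<Sum>j\<in>J. b i j * u l i * v k j) = \<beta> k * g l k"
      using sum_delta_real(1)[OF fin lk(2)] by (simp add: g_def ip_commute)
    have "(\<Sum>i\<in>J. \<Sum>j\<in>J. a i j * u l i * v k j)
        = (\<Sum>i\<in>J. \<Sum>j\<in>J. b i j * u l i * v k j + c * ((u l i * w i) * (v k j * w j)))"
      by (intro sum.cong refl) (simp add: diff algebra_simps)
    also have "\<dots> = (\<Sum>i\<in>J. \<Sum>j\<in>J. b i j * u l i * v k j) + c * (ip J (u l) w * ip J (v k) w)"
      unfolding ip_def sum_product by (simp add: sum.distrib sum_distrib_left)
    finally show ?thesis unfolding 1 2 by (simp add: algebra_simps)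
  qed
  \<comment> \<open>Parseval in the basis \<open>v\<close> inserts a sum over k, and
    \<open>key\<close> turns each mixed product into a multiple of the square of
    \<open>g l k\<close>.\<close>
  have eu: "c * (ip J (u l) w)\<^sup>2 = (\<Sum>k\<in>J. (\<alpha> l - \<beta> k) * (g l k)\<^sup>2)" if l: "l \<in> J" for l
  proof -
    have "c * (ip J (u l) w)\<^sup>2 = c * ip J (u l) w * (\<Sum>k\<in>J. ip J (v k) (u l) * ip J (v k) w)"
      unfolding onb_parseval[OF fin v] by (simp add: power2_eq_square)
    also have "\<dots> = (\<Sum>k\<in>J. (\<alpha> l - \<beta> k) * (g l k)\<^sup>2)"
      unfolding sum_distrib_left
    proof (rule sum.cong[OF refl])
      fix k assume k: "k \<in> J"
      have "c * ip J (u l) w * (ip J (v k) (u l) * ip J (v k) w) = (c * ip J (u l) w * ip J (v k) w) * g l k"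
        by (simp add: g_def ip_commute[of J "v k" "u l"])
      then show "c * ip J (u l) w * (ip J (v k) (u l) * ip J (v k) w) = (\<alpha> l - \<beta> k) * (g l k)\<^sup>2"
        by (simp add: key[OF l k, symmetric] power2_eq_square)
    qed
    finally show ?thesis .
  qed
  have ev: "c * (ip J (v k) w)\<^sup>2 = (\<Sum>l\<in>J. (\<alpha> l - \<beta> k) * (g l k)\<^sup>2)" if k: "k \<in> J" for k
  proof -
    have "c * (ip J (v k) w)\<^sup>2 = c * ip J (v k) w * (\<Sum>l\<in>J. ip J (u l) (v k) * ip J (u l) w)"
      unfolding onb_parseval[OF fin u] by (simp add: power2_eq_square)
    also have "\<dots> = (\<Sum>l\<in>J. (\<alpha> l - \<beta> k) * (g l k)\<^sup>2)"
      unfolding sum_distrib_left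
    proof (rule sum.cong[OF refl])
      fix l assume l: "l \<in> J"
      have "c * ip J (v k) w * (ip J (u l) (v k) * ip J (u l) w) = (c * ip J (u l) w * ip J (v k) w) * g l k"
        by (simp add: g_def)
      then show "c * ip J (v k) w * (ip J (u l) (v k) * ip J (u l) w) = (\<alpha> l - \<beta> k) * (g l k)\<^sup>2"
        by (simp add: key[OF l k, symmetric] power2_eq_square)
    qed
    finally show ?thesis .
  qed
  have sq: "((\<alpha> l - \<beta> k) * g l k)\<^sup>2 = c\<^sup>2 * ((ip J (u l) w)\<^sup>2 * (ip J (v k) w)\<^sup>2)" if "l \<in> J" "k \<in> J" for l k
    unfolding key[OF that] by (simp add: power_mult_distrib)
  have pu: "(\<Sum>l\<in>J. (ip J (u l) w)\<^sup>2) = ip J w w" and pv: "(\<Sum>l\<in>J. (ip J (v l) w)\<^sup>2) = ip J w w"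
    using onb_parseval[OF fin u, of w w] onb_parseval[OF fin v, of w w] by (simp_all add: power2_eq_square)
  have gen: "(\<Sum>l\<in>J. \<Sum>k\<in>J. K * (f l * g k + h l * e k))
      = K * ((\<Sum>l\<in>J. f l) * (\<Sum>k\<in>J. g k) + (\<Sum>l\<in>J. h l) * (\<Sum>k\<in>J. e k))"
    for K and f g h e :: "'a \<Rightarrow> real"
    unfolding sum_product by (simp add: sum.distrib sum_distrib_left distrib_left)
  let ?A = "\<Sum>l\<in>J. \<alpha> l ^ m * (ip J (u l) w)\<^sup>2" and ?B = "\<Sum>l\<in>J. \<beta> l ^ m * (ip J (v l) w)\<^sup>2"
  let ?A' = "\<Sum>l\<in>J. \<alpha> l ^ (m - 1) * (ip J (u l) w)\<^sup>2" and ?B' = "\<Sum>l\<in>J. \<beta> l ^ (m - 1) * (ip J (v l) w)\<^sup>2"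
  have A: "c * ?A = (\<Sum>l\<in>J. \<Sum>k\<in>J. \<alpha> l ^ m * ((\<alpha> l - \<beta> k) * (g l k)\<^sup>2))"
  proof -
    have "c * ?A = (\<Sum>l\<in>J. \<alpha> l ^ m * (c * (ip J (u l) w)\<^sup>2))" by (simp add: sum_distrib_left mult_ac)
    then show ?thesis by (simp add: eu sum_distrib_left)
  qed
  have B: "c * ?B = (\<Sum>l\<in>J. \<Sum>k\<in>J. \<beta> k ^ m * ((\<alpha> l - \<beta> k) * (g l k)\<^sup>2))"
  proof -
    have "c * ?B = (\<Sum>k\<in>J. \<beta> k ^ m * (c * (ip J (v k) w)\<^sup>2))" by (simp add: sum_distrib_left mult_ac)
    also have "\<dots> = (\<Sum>k\<in>J. \<Sum>l\<in>J. \<beta> k ^ m * ((\<alpha> l - \<beta> k) * (g l k)\<^sup>2))" by (simp add: ev sum_distrib_left)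
    finally show ?thesis by (subst sum.swap)
  qed
  have "c * (?A - ?B) = c * ?A - c * ?B" by (rule right_diff_distrib)
  also have "\<dots> = (\<Sum>l\<in>J. \<Sum>k\<in>J. ((\<alpha> l ^ m - \<beta> k ^ m) * (\<alpha> l - \<beta> k)) * (g l k)\<^sup>2)"
    unfolding A B sum_subtractf[symmetric] by (intro sum.cong refl) (simp add: algebra_simps)
  also have "\<dots> \<le> (\<Sum>l\<in>J. \<Sum>k\<in>J. (real m / 2 * ((\<alpha> l - \<beta> k)\<^sup>2 * (\<alpha> l ^ (m - 1) + \<beta> k ^ (m - 1)))) * (g l k)\<^sup>2)"
    by (intro sum_mono mult_right_mono odd_power_diff_le[OF m]) auto
  also have "\<dots> = (\<Sum>l\<in>J. \<Sum>k\<in>J. real m / 2 * c\<^sup>2 *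
      ((\<alpha> l ^ (m - 1) * (ip J (u l) w)\<^sup>2) * (ip J (v k) w)\<^sup>2 + (ip J (u l) w)\<^sup>2 * (\<beta> k ^ (m - 1) * (ip J (v k) w)\<^sup>2)))"
  proof (intro sum.cong refl)
    fix l k assume lk: "l \<in> J" "k \<in> J"
    have "(real m / 2 * ((\<alpha> l - \<beta> k)\<^sup>2 * (\<alpha> l ^ (m - 1) + \<beta> k ^ (m - 1)))) * (g l k)\<^sup>2
        = real m / 2 * (((\<alpha> l - \<beta> k) * g l k)\<^sup>2 * (\<alpha> l ^ (m - 1) + \<beta> k ^ (m - 1)))"
      by (simp add: power_mult_distrib mult_ac)
    also have "\<dots> = real m / 2 * c\<^sup>2 * ((\<alpha> l ^ (m - 1) * (ip J (u l) w)\<^sup>2) * (ip J (v k) w)\<^sup>2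
        + (ip J (u l) w)\<^sup>2 * (\<beta> k ^ (m - 1) * (ip J (v k) w)\<^sup>2))"
      unfolding sq[OF lk] by (simp add: algebra_simps)
    finally show "(real m / 2 * ((\<alpha> l - \<beta> k)\<^sup>2 * (\<alpha> l ^ (m - 1) + \<beta> k ^ (m - 1)))) * (g l k)\<^sup>2 = \<dots>" .
  qed
  also have "\<dots> = real m / 2 * c\<^sup>2 * (?A' * ip J w w + ip J w w * ?B')"
    unfolding gen pu pv ..
  also have "\<dots> = c * (real m * c / 2 * ip J w w * (?A' + ?B'))" by (simp add: power2_eq_square algebra_simps)
  finally show ?thesis using c by (simp only: mult_le_cancel_left_pos)
qed

section \<open>Sums of rank-one matrices as functions of the coins\<close>

definition eigval :: "'a set \<Rightarrow> ('a \<Rightarrow> 'a \<Rightarrow> real) \<Rightarrow> 'a \<Rightarrow> real" where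
  "eigval J a = fst (SOME z. spectral J a (fst z) (snd z))"

text \<open>Both components are taken from the same chosen pair, so eigenvalues and eigenvectors
  match, and moments become functions of the sample alone.\<close>

definition eigvec :: "'a set \<Rightarrow> ('a \<Rightarrow> 'a \<Rightarrow> real) \<Rightarrow> 'a \<Rightarrow> 'a \<Rightarrow> real" where
  "eigvec J a = snd (SOME z. spectral J a (fst z) (snd z))"

lemma spectral_eigval:
  assumes "finite J" "\<And>i k. i \<in> J \<Longrightarrow> k \<in> J \<Longrightarrow> a i k = a k i"
  shows "spectral J a (eigval J a) (eigvec J a)"
proof -
  have "\<exists>z. spectral J a (fst z) (snd z)"
    using spectral_exists[of J a, OF assms] by auto
  then show ?thesis unfolding eigval_def eigvec_def by (rule someI_ex)
qed

lemma spectral_bilinear_le: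
  assumes fin: "finite J" and sp: "spectral J a lam u" and le: "\<And>l. l \<in> J \<Longrightarrow> \<bar>lam l\<bar> \<le> \<tau>" and \<tau>: "0 \<le> \<tau>"
  shows "\<bar>\<Sum>i\<in>J. \<Sum>k\<in>J. a i k * x i * y k\<bar> \<le> \<tau> * (sqrt (ip J x x) * sqrt (ip J y y))"
proof -
  have onb: "onb J u" using sp by (simp add: spectral_def)
  let ?f = "\<lambda>l. \<bar>ip J (u l) x\<bar>" and ?g = "\<lambda>l. \<bar>ip J (u l) y\<bar>"
  have "\<bar>\<Sum>i\<in>J. \<Sum>k\<in>J. a i k * x i * y k\<bar> \<le> (\<Sum>l\<in>J. \<bar>lam l * ip J (u l) x * ip J (u l) y\<bar>)"
    unfolding spectral_bilinear[OF fin sp] by (rule sum_abs)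
  also have "\<dots> \<le> (\<Sum>l\<in>J. \<tau> * (?f l * ?g l))"
    by (intro sum_mono) (simp add: abs_mult mult.assoc le mult_right_mono)
  also have "\<dots> = \<tau> * ip J ?f ?g" by (simp add: ip_def sum_distrib_left)
  also have "\<dots> \<le> \<tau> * (sqrt (ip J ?f ?f) * sqrt (ip J ?g ?g))"
    using ip_cauchy_schwarz_sqrt[of J ?f ?g] \<tau> by (intro mult_left_mono) auto
  also have "ip J ?f ?f = ip J x x"
    using onb_parseval[OF fin onb, of x x] by (simp add: ip_def)
  also have "ip J ?g ?g = ip J y y"
    using onb_parseval[OF fin onb, of y y] by (simp add: ip_def)
  finally show ?thesis .
qed

text \<open>Centred and scaled: the value is 1 / p - 1 with probability p and -1 otherwise, so the
  mean is zero and \<open>1 + coin p S i\<close> is the scaled indicator.\<close>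

definition coin :: "real \<Rightarrow> 'i set \<Rightarrow> 'i \<Rightarrow> real" where
  "coin p S i = of_bool (i \<in> S) / p - 1"

definition samp_mat :: "real \<Rightarrow> 'i set \<Rightarrow> ('i \<Rightarrow> 'a \<Rightarrow> real) \<Rightarrow> 'i set \<Rightarrow> 'a \<Rightarrow> 'a \<Rightarrow> real" where
  "samp_mat p I w S j k = (\<Sum>i\<in>I. coin p S i * w i j * w i k)"

text \<open>This bounds the spectral norm of \<open>samp_mat p I w S\<close> on \<open>J\<close> by
  \<tau>. Two vectors are allowed because cross terms between blocks of eigenvectors are read off
  from it as well.\<close>

definition coin_bounded :: "real \<Rightarrow> 'i set \<Rightarrow> 'a set \<Rightarrow> ('i \<Rightarrow> 'a \<Rightarrow> real) \<Rightarrow> 'i set \<Rightarrow> real \<Rightarrow> bool" where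
  "coin_bounded p I J w S \<tau> \<longleftrightarrow> (\<forall>x y. \<bar>\<Sum>i\<in>I. coin p S i * ip J (w i) x * ip J (w i) y\<bar>
      \<le> \<tau> * (sqrt (ip J x x) * sqrt (ip J y y)))"

lemma coin_boundedD:
  "coin_bounded p I J w S \<tau> \<Longrightarrow> \<bar>\<Sum>i\<in>I. coin p S i * ip J (w i) x * ip J (w i) y\<bar>
      \<le> \<tau> * (sqrt (ip J x x) * sqrt (ip J y y))"
  by (simp add: coin_bounded_def)

text \<open>Integration by parts for a single coin: the two outcomes carry the weights 1 - p and -(1
  - p), so only the discrete derivative of \<open>f\<close> in the coin \<open>i\<close>
  survives.\<close>

lemma samp_exp_coin:
  assumes "finite I" "i \<in> I" "0 < p"
  shows "samp_exp p I (\<lambda>S. coin p S i * f S)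
    = (1 - p) * samp_exp p (I - {i}) (\<lambda>S. f (insert i S) - f S)"
proof -
  have I: "I = insert i (I - {i})" using assms by auto
  have "samp_exp p I (\<lambda>S. coin p S i * f S)
      = p * samp_exp p (I - {i}) (\<lambda>S. coin p (insert i S) i * f (insert i S))
        + (1 - p) * samp_exp p (I - {i}) (\<lambda>S. coin p S i * f S)"
    by (subst I, subst samp_exp_insert) (use assms in auto)
  also have "samp_exp p (I - {i}) (\<lambda>S. coin p (insert i S) i * f (insert i S))
      = samp_exp p (I - {i}) (\<lambda>S. (1 / p - 1) * f (insert i S))"
    by (simp add: coin_def)
  also have "samp_exp p (I - {i}) (\<lambda>S. coin p S i * f S) = samp_exp p (I - {i}) (\<lambda>S. (-1) * f S)"
    by (rule samp_exp_cong) (auto simp: coin_def)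
  finally have "samp_exp p I (\<lambda>S. coin p S i * f S)
      = p * (1 / p - 1) * samp_exp p (I - {i}) (\<lambda>S. f (insert i S)) - (1 - p) * samp_exp p (I - {i}) f"
    unfolding samp_exp_scale by (simp add: mult.assoc)
  moreover have "p * (1 / p - 1) = 1 - p" using assms(3) by (simp add: field_simps)
  ultimately show ?thesis unfolding samp_exp_diff by (simp add: right_diff_distrib)
qed

text \<open>\<gamma> bounds the norm of the sum of all w w^T, t the trace of that sum, and \<rho>
  the squared length of each vector. The coins have variance (1 - p) / p, so \<rho> \<gamma> / p
  bounds the matrix variance.\<close>

locale bernoulli_sum =
  fixes p :: real and I :: "'i set" and J :: "'a set" and w :: "'i \<Rightarrow> 'a \<Rightarrow> real"
    and \<gamma> \<rho> t :: real
  assumes finI: "finite I" and finJ: "finite J" and p0: "0 < p" and p1: "p < 1"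
    and gram: "\<And>x. (\<Sum>i\<in>I. (ip J (w i) x)\<^sup>2) \<le> \<gamma> * ip J x x"
    and row: "\<And>i. i \<in> I \<Longrightarrow> ip J (w i) (w i) \<le> \<rho>"
    and tr: "(\<Sum>i\<in>I. ip J (w i) (w i)) \<le> t"
    and \<gamma>0: "0 < \<gamma>" and \<rho>0: "0 \<le> \<rho>"
begin

abbreviation "X \<equiv> samp_mat p I w"
abbreviation "ev S \<equiv> eigval J (X S)"
abbreviation "evec S \<equiv> eigvec J (X S)"

lemma X_sym: "X S j k = X S k j"
  by (simp add: samp_mat_def mult_ac)

lemma spec: "spectral J (X S) (ev S) (evec S)"
  by (rule spectral_eigval[OF finJ X_sym])

lemma onb: "onb J (evec S)"
  using spec by (simp add: spectral_def)

lemma X_bilinear: "(\<Sum>j\<in>J. \<Sum>k\<in>J. X S j k * x j * y k) = (\<Sum>i\<in>I. coin p S i * ip J (w i) x * ip J (w i) y)"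
proof -
  have "(\<Sum>j\<in>J. \<Sum>k\<in>J. X S j k * x j * y k)
      = (\<Sum>j\<in>J. \<Sum>k\<in>J. \<Sum>i\<in>I. coin p S i * ((w i j * x j) * (w i k * y k)))"
    unfolding samp_mat_def sum_distrib_right by (simp add: mult_ac)
  also have "\<dots> = (\<Sum>j\<in>J. \<Sum>i\<in>I. \<Sum>k\<in>J. coin p S i * ((w i j * x j) * (w i k * y k)))"
    by (rule sum.cong[OF refl], rule sum.swap)
  also have "\<dots> = (\<Sum>i\<in>I. \<Sum>j\<in>J. \<Sum>k\<in>J. coin p S i * ((w i j * x j) * (w i k * y k)))"
    by (rule sum.swap)
  also have "\<dots> = (\<Sum>i\<in>I. coin p S i * ip J (w i) x * ip J (w i) y)"
    unfolding ip_def mult.assoc[of "coin p S _"] sum_product by (simp only: sum_distrib_left)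
  finally show ?thesis .
qed

lemma ev_eq:
  assumes l: "l \<in> J"
  shows "ev S l = (\<Sum>i\<in>I. coin p S i * (ip J (evec S l) (w i))\<^sup>2)"
proof -
  have "(\<Sum>m\<in>J. ev S m * ip J (evec S m) (evec S l) * ip J (evec S m) (evec S l))
      = (\<Sum>m\<in>J. ev S m * (if m = l then 1 else 0))"
    using l by (intro sum.cong refl) (simp add: onb_ip[OF onb])
  also have "\<dots> = ev S l" by (rule sum_delta_real(3)[OF finJ l])
  finally have "ev S l = (\<Sum>j\<in>J. \<Sum>k\<in>J. X S j k * evec S l j * evec S l k)"
    unfolding spectral_bilinear[OF finJ spec] by simp
  then show ?thesis unfolding X_bilinear by (simp add: power2_eq_square ip_commute mult.assoc)
qed

text \<open>In an eigenbasis of X = \<open>X S\<close> this is w_i^T X^m w_i, just as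
  \<open>trp\<close> is tr X^m.\<close>

definition pform :: "nat \<Rightarrow> 'i \<Rightarrow> 'i set \<Rightarrow> real" where
  "pform m i S = (\<Sum>l\<in>J. ev S l ^ m * (ip J (evec S l) (w i))\<^sup>2)"

definition trp :: "nat \<Rightarrow> 'i set \<Rightarrow> real" where
  "trp m S = (\<Sum>l\<in>J. ev S l ^ m)"

text \<open>Unfolding one factor of X^(m+1) exposes the coins linearly, as
  \<open>samp_exp_coin\<close> requires.\<close>

lemma trp_Suc: "trp (Suc m) S = (\<Sum>i\<in>I. coin p S i * pform m i S)"
proof -
  have "trp (Suc m) S = (\<Sum>l\<in>J. \<Sum>i\<in>I. coin p S i * (ev S l ^ m * (ip J (evec S l) (w i))\<^sup>2))"
    unfolding trp_def
  proof (rule sum.cong[OF refl])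
    fix l assume "l \<in> J"
    then have "ev S l ^ Suc m = ev S l ^ m * (\<Sum>i\<in>I. coin p S i * (ip J (evec S l) (w i))\<^sup>2)"
      using ev_eq by simp
    then show "ev S l ^ Suc m = (\<Sum>i\<in>I. coin p S i * (ev S l ^ m * (ip J (evec S l) (w i))\<^sup>2))"
      by (simp add: sum_distrib_left mult_ac)
  qed
  also have "\<dots> = (\<Sum>i\<in>I. coin p S i * pform m i S)"
    unfolding pform_def by (subst sum.swap) (simp add: sum_distrib_left)
  finally show ?thesis .
qed

lemma pform_nonneg: "even m \<Longrightarrow> 0 \<le> pform m i S"
  unfolding pform_def by (intro sum_nonneg mult_nonneg_nonneg) (auto simp: zero_le_even_power)

text \<open>Adding \<open>i\<close> to the sample perturbs X by the rank-one matrix w_i w_i^T / p,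
  to which \<open>rank_one_power_diff\<close> applies.\<close>

lemma pform_insert_diff:
  assumes i: "i \<in> I" "i \<notin> S" and m: "odd m"
  shows "pform m i (insert i S) - pform m i S
    \<le> real m * \<rho> / (2 * p) * (pform (m - 1) i (insert i S) + pform (m - 1) i S)"
proof -
  have X: "X (insert i S) j k = X S j k + (1 / p) * w i j * w i k" for j k
  proof -
    have "X (insert i S) j k - X S j k = (\<Sum>i'\<in>I. (coin p (insert i S) i' - coin p S i') * (w i' j * w i' k))"
      unfolding samp_mat_def sum_subtractf[symmetric] by (intro sum.cong refl) (simp add: algebra_simps)
    also have "\<dots> = (\<Sum>i'\<in>I. (if i' = i then 1 else 0) * (w i' j * w i' k / p))"
      using i by (intro sum.cong refl) (auto simp: coin_def)
    also have "\<dots> = w i j * w i k / p"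
      by (rule sum_delta_real(1)[OF finI i(1)])
    finally show ?thesis by simp
  qed
  have "pform m i (insert i S) - pform m i S
    \<le> real m * (1 / p) / 2 * ip J (w i) (w i) * (pform (m - 1) i (insert i S) + pform (m - 1) i S)"
    unfolding pform_def
    by (rule rank_one_power_diff[OF finJ spec spec X _ m]) (use p0 in auto)
  also have "\<dots> \<le> real m * (1 / p) / 2 * \<rho> * (pform (m - 1) i (insert i S) + pform (m - 1) i S)"
    using row[OF i(1)] p0 m
    by (intro mult_right_mono mult_left_mono add_nonneg_nonneg pform_nonneg) auto
  finally show ?thesis by (simp add: mult_ac)
qed

lemma coin_pform_le:
  assumes i: "i \<in> I" and m: "odd m"
  shows "samp_exp p I (\<lambda>S. coin p S i * pform m i S)
    \<le> real m * \<rho> / (2 * p) * samp_exp p I (\<lambda>S. (coin p S i + 2) * pform (m - 1) i S)"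
proof -
  define c where "c = real m * \<rho> / (2 * p)"
  have c: "0 \<le> c" using p0 \<rho>0 by (simp add: c_def)
  let ?E = "samp_exp p (I - {i})"
  have I: "I = insert i (I - {i})" using i by auto
  let ?g = "pform (m - 1) i"
  have g: "0 \<le> ?g S" for S by (rule pform_nonneg) (use m in auto)
  have "samp_exp p I (\<lambda>S. coin p S i * pform m i S) = (1 - p) * ?E (\<lambda>S. pform m i (insert i S) - pform m i S)"
    by (rule samp_exp_coin[OF finI i p0])
  also have "\<dots> \<le> (1 - p) * ?E (\<lambda>S. c * (?g (insert i S) + ?g S))"
    using p0 p1 i m unfolding c_def
    by (intro mult_left_mono samp_exp_mono pform_insert_diff) auto
  also have "\<dots> = c * ((1 - p) * ?E (\<lambda>S. ?g (insert i S)) + (1 - p) * ?E ?g)"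
    unfolding samp_exp_scale samp_exp_add by (simp add: algebra_simps)
  \<comment> \<open>1 - p is enlarged to 1 + p so that the two outcomes recombine into one
    expectation: the weight \<open>coin p S i + 2\<close> is 1 / p + 1 for sampled \<open>i\<close>
    and 1 otherwise.\<close>
  also have "\<dots> \<le> c * ((1 + p) * ?E (\<lambda>S. ?g (insert i S)) + (1 - p) * ?E ?g)"
    using p0 p1 c g by (intro mult_left_mono add_mono mult_right_mono samp_exp_nonneg) auto
  also have "(1 + p) * ?E (\<lambda>S. ?g (insert i S)) + (1 - p) * ?E ?g = samp_exp p I (\<lambda>S. (coin p S i + 2) * ?g S)"
  proof -
    have "samp_exp p I (\<lambda>S. (coin p S i + 2) * ?g S)
        = p * ?E (\<lambda>S. (coin p (insert i S) i + 2) * ?g (insert i S)) + (1 - p) * ?E (\<lambda>S. (coin p S i + 2) * ?g S)"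
      by (subst I, subst samp_exp_insert) (use finI in auto)
    also have "?E (\<lambda>S. (coin p (insert i S) i + 2) * ?g (insert i S)) = ?E (\<lambda>S. (1 / p + 1) * ?g (insert i S))"
      by (simp add: coin_def add.commute)
    also have "?E (\<lambda>S. (coin p S i + 2) * ?g S) = ?E ?g"
      by (rule samp_exp_cong) (auto simp: coin_def)
    finally have "samp_exp p I (\<lambda>S. (coin p S i + 2) * ?g S)
        = p * (1 / p + 1) * ?E (\<lambda>S. ?g (insert i S)) + (1 - p) * ?E ?g"
      unfolding samp_exp_scale by (simp add: mult.assoc)
    moreover have "p * (1 / p + 1) = 1 + p" using p0 by (simp add: field_simps)
    ultimately show ?thesis by simp
  qed
  finally show ?thesis unfolding c_def .
qed

text \<open>Summed over \<open>i\<close>, the weight \<open>coin\<close> reassembles X, which acts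
  on an eigenvector as \<open>ev S l\<close>; the weight 2 leaves the Gram form, bounded by
  \<gamma>.\<close>

lemma pform_sum_le:
  assumes "even n"
  shows "(\<Sum>i\<in>I. (coin p S i + 2) * pform n i S) \<le> (\<Sum>l\<in>J. ev S l ^ n * (ev S l + 2 * \<gamma>))"
proof -
  have "(\<Sum>i\<in>I. (coin p S i + 2) * pform n i S)
      = (\<Sum>l\<in>J. \<Sum>i\<in>I. (coin p S i + 2) * (ev S l ^ n * (ip J (evec S l) (w i))\<^sup>2))"
    unfolding pform_def sum_distrib_left by (rule sum.swap)
  also have "\<dots> = (\<Sum>l\<in>J. ev S l ^ n * (ev S l + 2 * (\<Sum>i\<in>I. (ip J (w i) (evec S l))\<^sup>2)))"
  proof (rule sum.cong[OF refl])
    fix l assume l: "l \<in> J"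
    show "(\<Sum>i\<in>I. (coin p S i + 2) * (ev S l ^ n * (ip J (evec S l) (w i))\<^sup>2))
        = ev S l ^ n * (ev S l + 2 * (\<Sum>i\<in>I. (ip J (w i) (evec S l))\<^sup>2))"
    proof -
      let ?c = "\<lambda>i. (ip J (evec S l) (w i))\<^sup>2"
      have "(\<Sum>i\<in>I. (coin p S i + 2) * (ev S l ^ n * ?c i))
          = (\<Sum>i\<in>I. ev S l ^ n * (coin p S i * ?c i) + ev S l ^ n * (2 * ?c i))"
        by (intro sum.cong refl) (simp add: algebra_simps)
      also have "\<dots> = ev S l ^ n * ((\<Sum>i\<in>I. coin p S i * ?c i) + 2 * (\<Sum>i\<in>I. ?c i))"
        by (simp add: sum.distrib sum_distrib_left distrib_left)
      also have "(\<Sum>i\<in>I. coin p S i * ?c i) = ev S l" by (rule ev_eq[OF l, symmetric])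
      finally show ?thesis by (simp only: ip_commute[of J "evec S l"])
    qed
  qed
  also have "\<dots> \<le> (\<Sum>l\<in>J. ev S l ^ n * (ev S l + 2 * \<gamma>))"
  proof (intro sum_mono mult_left_mono add_left_mono)
    fix l assume l: "l \<in> J"
    show "(\<Sum>i\<in>I. (ip J (w i) (evec S l))\<^sup>2) \<le> \<gamma>"
      using gram[of "evec S l"] onb_ip[OF onb l l] by simp
  qed (use assms in \<open>auto simp: zero_le_even_power\<close>)
  finally show ?thesis .
qed

text \<open>This closes the recursion for even moments up to one odd moment, the contribution of
  \<open>ev S l\<close> next to 2 * \<gamma>.\<close>

lemma trp_step:
  assumes m: "odd m"
  shows "samp_exp p I (trp (Suc m))
    \<le> real m * \<rho> / (2 * p) * samp_exp p I (\<lambda>S. \<Sum>l\<in>J. ev S l ^ (m - 1) * (ev S l + 2 * \<gamma>))"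
proof -
  let ?c = "real m * \<rho> / (2 * p)"
  have "samp_exp p I (trp (Suc m)) = (\<Sum>i\<in>I. samp_exp p I (\<lambda>S. coin p S i * pform m i S))"
    unfolding samp_exp_sum[symmetric] by (intro samp_exp_cong trp_Suc)
  also have "\<dots> \<le> (\<Sum>i\<in>I. ?c * samp_exp p I (\<lambda>S. (coin p S i + 2) * pform (m - 1) i S))"
    by (intro sum_mono coin_pform_le m)
  also have "\<dots> = ?c * samp_exp p I (\<lambda>S. \<Sum>i\<in>I. (coin p S i + 2) * pform (m - 1) i S)"
    unfolding samp_exp_sum sum_distrib_left ..
  also have "\<dots> \<le> ?c * samp_exp p I (\<lambda>S. \<Sum>l\<in>J. ev S l ^ (m - 1) * (ev S l + 2 * \<gamma>))"
    using m p0 p1 \<rho>0 by (intro mult_left_mono samp_exp_mono pform_sum_le) auto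
  finally show ?thesis .
qed

text \<open>For m = 1 the quadratic forms that remain are squared lengths, which do not depend on
  the sample; the coins average out and the trace bound t enters.\<close>

lemma trp_2: "samp_exp p I (trp 2) \<le> \<rho> * t / p"
proof -
  have pf: "pform 0 i S = ip J (w i) (w i)" for i S
    unfolding pform_def using onb_parseval[OF finJ onb] by (simp add: power2_eq_square)
  have z: "samp_exp p I (\<lambda>S. coin p S i * d) = 0" if "i \<in> I" for i d
    by (subst samp_exp_coin[OF finI that p0]) (simp add: samp_exp_const finI)
  have "samp_exp p I (trp 2) = (\<Sum>i\<in>I. samp_exp p I (\<lambda>S. coin p S i * pform 1 i S))"
    unfolding samp_exp_sum[symmetric] using trp_Suc[of 1] by (intro samp_exp_cong) (simp add: numeral_2_eq_2)
  also have "\<dots> \<le> (\<Sum>i\<in>I. real 1 * \<rho> / (2 * p) * samp_exp p I (\<lambda>S. (coin p S i + 2) * pform (1 - 1) i S))"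
    by (intro sum_mono coin_pform_le) auto
  also have "\<dots> = \<rho> / (2 * p) * samp_exp p I (\<lambda>S. \<Sum>i\<in>I. (coin p S i + 2) * ip J (w i) (w i))"
    unfolding samp_exp_sum sum_distrib_left by (simp add: pf)
  also have "samp_exp p I (\<lambda>S. \<Sum>i\<in>I. (coin p S i + 2) * ip J (w i) (w i)) = 2 * (\<Sum>i\<in>I. ip J (w i) (w i))"
    unfolding samp_exp_sum sum_distrib_left
    by (intro sum.cong refl) (simp add: distrib_right samp_exp_add z samp_exp_const finI)
  also have "\<rho> / (2 * p) * (2 * (\<Sum>i\<in>I. ip J (w i) (w i))) \<le> \<rho> / (2 * p) * (2 * t)"
    using tr p0 \<rho>0 by (intro mult_left_mono) auto
  finally show ?thesis by simp
qed

text \<open>Young's inequality \<open>\<kappa> \<bar>x\<bar> \<le> x\<^sup>2 / 2 + \<kappa>\<^sup>2 / 2\<close> absorbs the odd moment into the left-hand side. The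
  recursion starts at the second moment, not at the zeroth, and this is what replaces the dimension
  by the trace \<open>t\<close>.\<close>
lemma trp_even_bound:
  assumes Q: "real Q * \<rho> \<le> p * \<gamma>" and q: "1 \<le> q" "q \<le> Q"
  shows "samp_exp p I (trp (2 * q)) \<le> (5 * (real Q * \<rho> / p) * \<gamma>) ^ (q - 1) * (\<rho> * t / p)"
  using q
proof (induction q rule: nat_induct_at_least)
  case base
  then show ?case using trp_2 by simp
next
  case (Suc q)
  define \<kappa> where "\<kappa> = real Q * \<rho> / p"
  have \<kappa>: "0 \<le> \<kappa>" "\<kappa> \<le> \<gamma>" using p0 \<rho>0 Q by (auto simp: \<kappa>_def field_simps)
  let ?T = "\<lambda>q. samp_exp p I (trp (2 * q))"
  have "?T (Suc q) \<le> real (2 * q + 1) * \<rho> / (2 * p) * samp_exp p I (\<lambda>S. \<Sum>l\<in>J. ev S l ^ (2 * q) * (ev S l + 2 * \<gamma>))"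
    using trp_step[of "2 * q + 1"] by simp
  also have "\<dots> \<le> real (2 * q + 1) * \<rho> / (2 * p) * samp_exp p I (\<lambda>S. \<Sum>l\<in>J. ev S l ^ (2 * q) * (\<bar>ev S l\<bar> + 2 * \<gamma>))"
    using p0 p1 \<rho>0 by (intro mult_left_mono samp_exp_mono sum_mono) (auto simp: zero_le_even_power)
  also have "\<dots> \<le> \<kappa> * samp_exp p I (\<lambda>S. \<Sum>l\<in>J. ev S l ^ (2 * q) * (\<bar>ev S l\<bar> + 2 * \<gamma>))"
  proof (rule mult_right_mono)
    have "real (2 * q + 1) * \<rho> \<le> real (2 * Q) * \<rho>"
      using Suc.prems \<rho>0 by (intro mult_right_mono) auto
    then show "real (2 * q + 1) * \<rho> / (2 * p) \<le> \<kappa>"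
      using p0 divide_right_mono[of "real (2 * q + 1) * \<rho>" "real (2 * Q) * \<rho>" "2 * p"] by (simp add: \<kappa>_def)
    show "0 \<le> samp_exp p I (\<lambda>S. \<Sum>l\<in>J. ev S l ^ (2 * q) * (\<bar>ev S l\<bar> + 2 * \<gamma>))"
      using p0 p1 \<gamma>0 by (intro samp_exp_nonneg sum_nonneg mult_nonneg_nonneg) (auto simp: zero_le_even_power)
  qed
  also have "\<dots> = samp_exp p I (\<lambda>S. \<Sum>l\<in>J. \<kappa> * (ev S l ^ (2 * q) * (\<bar>ev S l\<bar> + 2 * \<gamma>)))"
    unfolding samp_exp_scale[symmetric] sum_distrib_left ..
  also have "\<dots> \<le> samp_exp p I (\<lambda>S. (1 / 2) * trp (2 * Suc q) S + (\<kappa>\<^sup>2 / 2 + 2 * \<kappa> * \<gamma>) * trp (2 * q) S)"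
  proof (rule samp_exp_mono)
    fix S
    have "\<kappa> * (x ^ (2 * q) * (\<bar>x\<bar> + 2 * \<gamma>)) \<le> (1 / 2) * x ^ (2 * Suc q) + (\<kappa>\<^sup>2 / 2 + 2 * \<kappa> * \<gamma>) * x ^ (2 * q)" for x
    proof -
      have "0 \<le> (\<bar>x\<bar> - \<kappa>)\<^sup>2" by simp
      then have "\<kappa> * \<bar>x\<bar> \<le> (1 / 2) * x\<^sup>2 + \<kappa>\<^sup>2 / 2" by (simp add: power2_diff algebra_simps)
      then have "x ^ (2 * q) * (\<kappa> * \<bar>x\<bar> + 2 * \<kappa> * \<gamma>) \<le> x ^ (2 * q) * ((1 / 2) * x\<^sup>2 + \<kappa>\<^sup>2 / 2 + 2 * \<kappa> * \<gamma>)"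
        by (intro mult_left_mono) (auto simp: zero_le_even_power)
      then show ?thesis by (simp add: algebra_simps power2_eq_square)
    qed
    then have "(\<Sum>l\<in>J. \<kappa> * (ev S l ^ (2 * q) * (\<bar>ev S l\<bar> + 2 * \<gamma>)))
       \<le> (\<Sum>l\<in>J. (1 / 2) * ev S l ^ (2 * Suc q) + (\<kappa>\<^sup>2 / 2 + 2 * \<kappa> * \<gamma>) * ev S l ^ (2 * q))"
      by (intro sum_mono)
    then show "(\<Sum>l\<in>J. \<kappa> * (ev S l ^ (2 * q) * (\<bar>ev S l\<bar> + 2 * \<gamma>)))
       \<le> (1 / 2) * trp (2 * Suc q) S + (\<kappa>\<^sup>2 / 2 + 2 * \<kappa> * \<gamma>) * trp (2 * q) S"
      unfolding trp_def sum_distrib_left sum.distrib[symmetric] .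
  qed (use p0 p1 in auto)
  also have "\<dots> = (1 / 2) * ?T (Suc q) + (\<kappa>\<^sup>2 / 2 + 2 * \<kappa> * \<gamma>) * ?T q"
    unfolding samp_exp_add samp_exp_scale ..
  \<comment> \<open>Half of the higher moment has moved to the left-hand side, which doubles the
    remaining coefficient; \<kappa> \<le> \<gamma> then turns it into 5 \<kappa> \<gamma>.\<close>
  finally have "?T (Suc q) \<le> (\<kappa>\<^sup>2 + 4 * \<kappa> * \<gamma>) * ?T q"
    by (simp add: algebra_simps)
  also have "\<dots> \<le> (5 * \<kappa> * \<gamma>) * ?T q"
  proof (rule mult_right_mono)
    show "\<kappa>\<^sup>2 + 4 * \<kappa> * \<gamma> \<le> 5 * \<kappa> * \<gamma>"
      using mult_left_mono[OF \<kappa>(2,1)] by (simp add: power2_eq_square mult.commute)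
    show "0 \<le> ?T q" using p0 p1 unfolding trp_def
      by (intro samp_exp_nonneg sum_nonneg) (auto simp: zero_le_even_power)
  qed
  also have "\<dots> \<le> (5 * \<kappa> * \<gamma>) * ((5 * \<kappa> * \<gamma>) ^ (q - 1) * (\<rho> * t / p))"
  proof (rule mult_left_mono)
    show "?T q \<le> (5 * \<kappa> * \<gamma>) ^ (q - 1) * (\<rho> * t / p)"
      unfolding \<kappa>_def by (rule Suc.IH) (use Suc.prems in simp)
    show "0 \<le> 5 * \<kappa> * \<gamma>" using \<kappa>(1) \<gamma>0 by simp
  qed
  also have "\<dots> = (5 * \<kappa> * \<gamma>) ^ (Suc q - 1) * (\<rho> * t / p)"
    using Suc.hyps by (cases q) auto
  finally show ?case unfolding \<kappa>_def .
qed

text \<open>A matrix Bernstein inequality; the dimension enters only through the intrinsic dimension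
  \<open>t / \<gamma>\<close>.\<close>
theorem bernstein:
  assumes Q: "1 \<le> Q" "real Q * \<rho> \<le> p * \<gamma>" and r: "r > 0" and \<tau>: "\<tau> > 0"
    and small: "5 * r * \<gamma> * (real Q * \<rho>) \<le> p * \<tau>\<^sup>2"
  shows "samp_prob p I (\<lambda>S. \<not> coin_bounded p I J w S \<tau>) \<le> (1 / r) ^ Q * (t / \<gamma>)"
proof -
  define \<kappa> where "\<kappa> = real Q * \<rho> / p"
  have \<kappa>: "0 \<le> \<kappa>" using p0 \<rho>0 by (auto simp: \<kappa>_def)
  have t0: "0 \<le> t" using tr by (rule order.trans[rotated]) (simp add: sum_nonneg)
  \<comment> \<open>A violated bound forces an eigenvalue of modulus above \<tau>, hence \<tau>^(2Q)
    \<le> tr X^(2Q), and Markov's inequality applies to this even moment.\<close>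
  have "samp_prob p I (\<lambda>S. \<not> coin_bounded p I J w S \<tau>) \<le> samp_prob p I (\<lambda>S. \<tau> ^ (2 * Q) \<le> trp (2 * Q) S)"
  proof (rule samp_prob_mono)
    fix S
    assume bad: "\<not> coin_bounded p I J w S \<tau>"
    show "\<tau> ^ (2 * Q) \<le> trp (2 * Q) S"
    proof (rule ccontr)
      assume "\<not> \<tau> ^ (2 * Q) \<le> trp (2 * Q) S"
      then have lt: "trp (2 * Q) S < \<tau> ^ (2 * Q)" by simp
      have ev: "\<bar>ev S l\<bar> \<le> \<tau>" if l: "l \<in> J" for l
      proof (rule ccontr)
        assume "\<not> \<bar>ev S l\<bar> \<le> \<tau>"
        then have "\<tau> ^ (2 * Q) \<le> \<bar>ev S l\<bar> ^ (2 * Q)" using \<tau> by (intro power_mono) auto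
        also have "\<dots> = ev S l ^ (2 * Q)" by (simp add: power_even_abs)
        also have "\<dots> \<le> trp (2 * Q) S" unfolding trp_def
          by (rule member_le_sum[OF l _ finJ]) (auto simp: zero_le_even_power)
        finally show False using lt by simp
      qed
      have "\<bar>\<Sum>i\<in>I. coin p S i * ip J (w i) x * ip J (w i) y\<bar> \<le> \<tau> * (sqrt (ip J x x) * sqrt (ip J y y))" for x y
        using spectral_bilinear_le[OF finJ spec ev] \<tau> unfolding X_bilinear by simp
      then show False using bad by (simp add: coin_bounded_def)
    qed
  qed (use p0 p1 in auto)
  also have "\<dots> \<le> samp_exp p I (trp (2 * Q)) / \<tau> ^ (2 * Q)"
    using p0 p1 \<tau> unfolding trp_def
    by (intro samp_prob_markov) (auto intro!: sum_nonneg simp: zero_le_even_power)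
  also have "\<dots> \<le> (5 * \<kappa> * \<gamma>) ^ (Q - 1) * (\<rho> * t / p) / \<tau> ^ (2 * Q)"
    using trp_even_bound[OF Q(2) Q(1)] \<tau> by (intro divide_right_mono) (auto simp: \<kappa>_def)
  \<comment> \<open>The second moment stands in for the missing factor 5 \<kappa> \<gamma>, since
    \<rho> \<le> Q \<rho>; what is left over is the intrinsic dimension t / \<gamma>.\<close>
  also have "\<dots> \<le> (5 * \<kappa> * \<gamma>) ^ (Q - 1) * ((5 * \<kappa> * \<gamma>) * (t / \<gamma>)) / \<tau> ^ (2 * Q)"
  proof (intro divide_right_mono mult_left_mono)
    have "\<rho> \<le> real Q * \<rho>" using mult_right_mono[of 1 "real Q" \<rho>] Q(1) \<rho>0 by simp
    then have "\<rho> * t \<le> 5 * (real Q * \<rho>) * t"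
      using t0 \<rho>0 by (intro mult_right_mono) auto
    then show "\<rho> * t / p \<le> 5 * \<kappa> * \<gamma> * (t / \<gamma>)"
      using p0 \<gamma>0 by (simp add: \<kappa>_def field_simps)
  qed (use \<kappa> \<gamma>0 \<tau> in auto)
  also have "\<dots> = (5 * \<kappa> * \<gamma>) ^ Q * (t / \<gamma>) / \<tau> ^ (2 * Q)"
    using Q(1) by (cases Q) auto
  also have "\<dots> \<le> (\<tau>\<^sup>2 / r) ^ Q * (t / \<gamma>) / \<tau> ^ (2 * Q)"
  proof (intro divide_right_mono mult_right_mono power_mono)
    show "5 * \<kappa> * \<gamma> \<le> \<tau>\<^sup>2 / r" using small p0 r by (simp add: \<kappa>_def field_simps)
  qed (use \<kappa> \<gamma>0 \<tau> t0 in auto)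
  also have "\<dots> = (1 / r) ^ Q * (t / \<gamma>)"
    using \<tau> by (simp add: power_divide power_mult)
  finally show ?thesis .
qed

end

subsection \<open>Eigenvalue counts of a sampled submatrix\<close>

text \<open>Gaussian elimination: an equation with a nonzero coefficient expresses one unknown
  through the others. This supplies the dimension counts of both eigenvalue comparisons.\<close>

lemma homogeneous_solution:
  fixes c :: "'e \<Rightarrow> 'x \<Rightarrow> real"
  assumes "finite E" "finite X" "card E < card X"
  shows "\<exists>z. (\<exists>x\<in>X. z x \<noteq> 0) \<and> (\<forall>e\<in>E. (\<Sum>x\<in>X. c e x * z x) = 0)"
  using assms
proof (induction E arbitrary: X c rule: finite_induct)
  case empty
  then have "X \<noteq> {}" by auto
  then show ?case by (intro exI[of _ "\<lambda>_. 1"]) auto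
next
  case (insert e E)
  show ?case
  proof (cases "\<exists>y\<in>X. c e y \<noteq> 0")
    case False
    have "\<exists>z. (\<exists>x\<in>X. z x \<noteq> 0) \<and> (\<forall>e\<in>E. (\<Sum>x\<in>X. c e x * z x) = 0)"
      using insert by (intro insert.IH) auto
    then show ?thesis using False by force
  next
    case True
    then obtain y where y: "y \<in> X" "c e y \<noteq> 0" by blast
    let ?X = "X - {y}"
    define d where "d f x = c f x - c f y * c e x / c e y" for f x
    have "\<exists>z. (\<exists>x\<in>?X. z x \<noteq> 0) \<and> (\<forall>f\<in>E. (\<Sum>x\<in>?X. d f x * z x) = 0)"
      using insert y by (intro insert.IH) auto
    then obtain z where z: "\<exists>x\<in>?X. z x \<noteq> 0" "\<And>f. f \<in> E \<Longrightarrow> (\<Sum>x\<in>?X. d f x * z x) = 0" by blast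
    define s where "s = (\<Sum>x\<in>?X. c e x * z x) / c e y"
    define z' where "z' x = (if x = y then - s else z x)" for x
    have sum: "(\<Sum>x\<in>X. c f x * z' x) = (\<Sum>x\<in>?X. c f x * z x) - c f y * s" for f
    proof -
      have "(\<Sum>x\<in>X. c f x * z' x) = c f y * z' y + (\<Sum>x\<in>?X. c f x * z' x)"
        using insert.prems(1) y(1) by (rule sum.remove)
      also have "(\<Sum>x\<in>?X. c f x * z' x) = (\<Sum>x\<in>?X. c f x * z x)"
        by (intro sum.cong refl) (auto simp: z'_def)
      finally show ?thesis by (simp add: z'_def)
    qed
    have "(\<Sum>x\<in>X. c e x * z' x) = 0" unfolding sum s_def using y(2) by simp
    moreover have "(\<Sum>x\<in>X. c f x * z' x) = 0" if f: "f \<in> E" for f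
    proof -
      have "0 = (\<Sum>x\<in>?X. c f x * z x - c f y / c e y * (c e x * z x))"
        unfolding z(2)[OF f, symmetric] d_def by (intro sum.cong refl) (simp add: algebra_simps)
      also have "\<dots> = (\<Sum>x\<in>?X. c f x * z x) - c f y * s"
        unfolding sum_subtractf s_def sum_distrib_left[symmetric] by simp
      finally show ?thesis unfolding sum by simp
    qed
    moreover have "\<exists>x\<in>X. z' x \<noteq> 0" using z(1) by (auto simp: z'_def)
    ultimately show ?thesis by (intro exI[of _ z']) auto
  qed
qed

lemma sum_indicator_subset:
  fixes f :: "'a \<Rightarrow> real"
  assumes "finite I" "S \<subseteq> I"
  shows "(\<Sum>i\<in>I. of_bool (i \<in> S) * f i) = (\<Sum>i\<in>S. f i)"
proof -
  have "(\<Sum>i\<in>I. of_bool (i \<in> S) * f i) = (\<Sum>i\<in>I. if i \<in> S then f i else 0)"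
    by (intro sum.cong refl) auto
  also have "\<dots> = (\<Sum>i\<in>I \<inter> S. f i)" using assms(1) by (simp add: sum.inter_restrict)
  also have "I \<inter> S = S" using assms(2) by auto
  finally show ?thesis .
qed

text \<open>The indicator of \<open>S\<close> equals p * (1 + coin), which splits a sampled inner
  product into its mean and a fluctuation.\<close>

lemma ip_sample:
  assumes "finite I" "S \<subseteq> I" "p > 0"
  shows "ip S x y = p * (ip I x y + (\<Sum>i\<in>I. coin p S i * x i * y i))"
proof -
  have "ip I x y + (\<Sum>i\<in>I. coin p S i * x i * y i) = (\<Sum>i\<in>I. of_bool (i \<in> S) * (x i * y i / p))"
    unfolding ip_def sum.distrib[symmetric]
    by (intro sum.cong refl) (simp add: coin_def algebra_simps)
  also have "\<dots> = (\<Sum>i\<in>S. x i * y i / p)" by (rule sum_indicator_subset[OF assms(1,2)])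
  finally show ?thesis using assms(3) by (simp add: ip_def sum_divide_distrib[symmetric])
qed

text \<open>Padding with zeros lets a combination over \<open>B\<close> be tested against
  \<open>coin_bounded\<close> on the larger index set \<open>J\<close>.\<close>

lemma ip_subset_indicator:
  assumes "finite J" "B \<subseteq> J"
  shows "ip J x (\<lambda>l. if l \<in> B then y l else 0) = (\<Sum>l\<in>B. x l * y l)"
proof -
  have "ip J x (\<lambda>l. if l \<in> B then y l else 0) = (\<Sum>l\<in>J. of_bool (l \<in> B) * (x l * y l))"
    unfolding ip_def by (intro sum.cong refl) auto
  then show ?thesis by (simp add: sum_indicator_subset[OF assms])
qed

lemma ip_self_subset_indicator:
  assumes "finite J" "B \<subseteq> J"
  shows "ip J (\<lambda>l. if l \<in> B then y l else 0) (\<lambda>l. if l \<in> B then y l else 0) = (\<Sum>l\<in>B. (y l)\<^sup>2)"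
  unfolding ip_subset_indicator[OF assms] by (intro sum.cong refl) (simp add: power2_eq_square)

lemma onb_combination:
  assumes finI: "finite I" and onb: "onb I u" and BI: "B \<subseteq> I"
  shows "ip I (\<lambda>i. \<Sum>l\<in>B. c l * u l i) (\<lambda>i. \<Sum>l\<in>B. c l * u l i) = (\<Sum>l\<in>B. (c l)\<^sup>2)"
    and "k \<in> I - B \<Longrightarrow> ip I (u k) (\<lambda>i. \<Sum>l\<in>B. c l * u l i) = 0"
proof -
  have finB: "finite B" using BI finI finite_subset by blast
  have ipu: "ip I (u k) (\<lambda>i. \<Sum>l\<in>B. c l * u l i) = (\<Sum>l\<in>B. c l * (if k = l then 1 else 0))" if "k \<in> I" for k
    unfolding ip_sum_right ip_scale_right
    by (intro sum.cong refl) (use onb_ip[OF onb that] BI in auto)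
  show "k \<in> I - B \<Longrightarrow> ip I (u k) (\<lambda>i. \<Sum>l\<in>B. c l * u l i) = 0"
    by (subst ipu) (auto intro: sum.neutral)
  have "ip I (\<lambda>i. \<Sum>l\<in>B. c l * u l i) (\<lambda>i. \<Sum>l\<in>B. c l * u l i)
      = (\<Sum>k\<in>B. c k * (\<Sum>l\<in>B. c l * (if k = l then 1 else 0)))"
    unfolding ip_sum_left ip_scale_left
    by (intro sum.cong refl) (use ipu BI in auto)
  also have "\<dots> = (\<Sum>k\<in>B. c k * c k)"
    by (intro sum.cong refl) (simp only: sum_delta_real(4)[OF finB])
  finally show "ip I (\<lambda>i. \<Sum>l\<in>B. c l * u l i) (\<lambda>i. \<Sum>l\<in>B. c l * u l i) = (\<Sum>l\<in>B. (c l)\<^sup>2)"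
    by (simp add: power2_eq_square)
qed

text \<open>The deterministic conditions on a sample. They are invariant under negating all
  eigenvalues, so only the positive part of the spectrum has to be treated.\<close>
locale good_sample =
  fixes I S :: "'a set" and lam :: "'a \<Rightarrow> real" and u :: "'a \<Rightarrow> 'a \<Rightarrow> real" and p \<theta> :: real
  assumes finI: "finite I" and SI: "S \<subseteq> I" and p0: "p > 0" and \<theta>0: "\<theta> > 0" and onb: "onb I u"
    and gram: "\<And>j. j \<in> I \<Longrightarrow> \<theta> \<le> \<bar>lam j\<bar> \<Longrightarrow>
      coin_bounded p I {l\<in>I. \<bar>lam j\<bar> / 2 \<le> \<bar>lam l\<bar>} (\<lambda>i l. u l i) S (2 * \<theta> / \<bar>lam j\<bar>)"
    and wgram: "\<And>j. j \<in> I \<Longrightarrow> \<theta> \<le> \<bar>lam j\<bar> \<Longrightarrow>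
      coin_bounded p I {l\<in>I. \<theta> \<le> \<bar>lam l\<bar>} (\<lambda>i l. sqrt (min \<bar>lam l\<bar> \<bar>lam j\<bar>) * u l i) S (sqrt (\<theta> * \<bar>lam j\<bar>))"
    and tail: "\<And>x. \<bar>\<Sum>i\<in>S. \<Sum>k\<in>S. (\<Sum>l\<in>{l\<in>I. \<bar>lam l\<bar> < \<theta>}. lam l * u l i * u l k) * x i * x k\<bar>
      \<le> 9 * p * \<theta> * ip S x x"
begin

lemma negated: "good_sample I S (\<lambda>l. - lam l) u p \<theta>"
proof
  fix x
  have "(\<Sum>i\<in>S. \<Sum>k\<in>S. (\<Sum>l\<in>{l\<in>I. \<bar>- lam l\<bar> < \<theta>}. - lam l * u l i * u l k) * x i * x k)
     = - (\<Sum>i\<in>S. \<Sum>k\<in>S. (\<Sum>l\<in>{l\<in>I. \<bar>lam l\<bar> < \<theta>}. lam l * u l i * u l k) * x i * x k)"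
    by (simp add: sum_negf)
  then show "\<bar>\<Sum>i\<in>S. \<Sum>k\<in>S. (\<Sum>l\<in>{l\<in>I. \<bar>- lam l\<bar> < \<theta>}. - lam l * u l i * u l k) * x i * x k\<bar>
      \<le> 9 * p * \<theta> * ip S x x"
    using tail[of x] by simp
qed (use finI SI p0 \<theta>0 onb gram wgram in \<open>simp_all only: abs_minus_cancel\<close>)

abbreviation "Out \<equiv> {l\<in>I. \<theta> \<le> \<bar>lam l\<bar>}"

lemma finS: "finite S" using finI SI finite_subset by blast

text \<open>Splitting the spectrum at \<theta> leaves a combination of squares over
  \<open>Out\<close>; the rest is the form controlled by \<open>tail\<close>.\<close>

lemma quadratic_form:
  assumes A: "\<And>i k. i \<in> S \<Longrightarrow> k \<in> S \<Longrightarrow> a i k = (\<Sum>l\<in>I. lam l * u l i * u l k)"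
  shows "\<bar>(\<Sum>i\<in>S. \<Sum>k\<in>S. a i k * x i * x k) - (\<Sum>l\<in>Out. lam l * (ip S (u l) x)\<^sup>2)\<bar> \<le> 9 * p * \<theta> * ip S x x"
proof -
  let ?In = "{l\<in>I. \<bar>lam l\<bar> < \<theta>}"
  have I: "I = Out \<union> ?In" by auto
  have split: "(\<Sum>l\<in>I. f l) = (\<Sum>l\<in>Out. f l) + (\<Sum>l\<in>?In. f l)" for f :: "'a \<Rightarrow> real"
    by (subst I, rule sum.union_disjoint) (use finI in auto)
  have "(\<Sum>i\<in>S. \<Sum>k\<in>S. a i k * x i * x k)
      = (\<Sum>i\<in>S. \<Sum>k\<in>S. (\<Sum>l\<in>Out. lam l * u l i * u l k) * x i * x k)
       + (\<Sum>i\<in>S. \<Sum>k\<in>S. (\<Sum>l\<in>?In. lam l * u l i * u l k) * x i * x k)"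
    unfolding sum.distrib[symmetric]
    by (intro sum.cong refl) (simp add: A split distrib_right)
  also have "(\<Sum>i\<in>S. \<Sum>k\<in>S. (\<Sum>l\<in>Out. lam l * u l i * u l k) * x i * x k)
      = (\<Sum>i\<in>S. \<Sum>k\<in>S. \<Sum>l\<in>Out. lam l * ((u l i * x i) * (u l k * x k)))"
    unfolding sum_distrib_right by (intro sum.cong refl) (simp add: mult_ac)
  also have "\<dots> = (\<Sum>i\<in>S. \<Sum>l\<in>Out. \<Sum>k\<in>S. lam l * ((u l i * x i) * (u l k * x k)))"
    by (rule sum.cong[OF refl], rule sum.swap)
  also have "\<dots> = (\<Sum>l\<in>Out. \<Sum>i\<in>S. \<Sum>k\<in>S. lam l * ((u l i * x i) * (u l k * x k)))"
    by (rule sum.swap)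
  also have "\<dots> = (\<Sum>l\<in>Out. lam l * (ip S (u l) x)\<^sup>2)"
    unfolding ip_def power2_eq_square sum_product by (simp only: sum_distrib_left)
  finally show ?thesis using tail[of x] by simp
qed

text \<open>By duality it suffices to bound a Gram form. It is split at \<open>t0 / 2\<close>, with \<open>t0\<close> the largest
  eigenvalue involved: the top block is accurate to \<open>O(\<theta>)\<close>, and the cross term of size
  \<open>sqrt (\<theta> t0)\<close> is absorbed in the gap of order \<open>t0\<close> between the two blocks.\<close>
lemma positive_part_bound:
  fixes t :: real
  assumes t: "t > 0"
  defines "B \<equiv> {l\<in>I. \<theta> \<le> lam l \<and> lam l \<le> t}"
  shows "(\<Sum>l\<in>B. lam l * (ip S (u l) x)\<^sup>2) \<le> p * (t + 10 * \<theta>) * ip S x x"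
proof (cases "B = {}")
  case True
  then show ?thesis using p0 \<theta>0 t by (simp add: mult_nonneg_nonneg)
next
  case False
  have finB: "finite B" using finI by (simp add: B_def)
  have BI: "B \<subseteq> I" and BO: "B \<subseteq> Out" by (auto simp: B_def)
  define t0 where "t0 = Max (lam ` B)"
  have "t0 \<in> lam ` B" unfolding t0_def using finB False by (intro Max_in) auto
  then obtain j where j: "j \<in> B" "lam j = t0" by auto
  have le_t0: "lam l \<le> t0" if "l \<in> B" for l unfolding t0_def using that finB by auto
  have t0: "\<theta> \<le> t0" "t0 \<le> t" "0 < t0" using j \<theta>0 by (auto simp: B_def)
  \<comment> \<open>In matrix terms c = \<Lambda>^(1/2) U^T x and g B = U \<Lambda>^(1/2) c, so H =
    |c|^2 is the inner product of g B and x on S. By Cauchy-Schwarz it suffices to bound the squared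
    norm of g B on S by p (t + 10 \<theta>) H.\<close>
  define c where "c l = sqrt (lam l) * ip S (u l) x" for l
  define H where "H = (\<Sum>l\<in>B. (c l)\<^sup>2)"
  have lampos: "0 \<le> lam l" if "l \<in> B" for l using that \<theta>0 by (auto simp: B_def)
  have H_eq: "H = (\<Sum>l\<in>B. lam l * (ip S (u l) x)\<^sup>2)"
    unfolding H_def c_def by (intro sum.cong refl) (simp add: power_mult_distrib lampos)
  define g where "g D i = (\<Sum>l\<in>D. (sqrt (lam l) * c l) * u l i)" for D i
  have Hx: "ip S (g B) x = H"
    unfolding g_def ip_sum_left ip_scale_left H_def c_def
    by (intro sum.cong refl) (simp add: power2_eq_square)
  define B1 where "B1 = {l\<in>B. t0 / 2 \<le> lam l}"
  define B2 where "B2 = {l\<in>B. lam l < t0 / 2}"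
  have B12: "B = B1 \<union> B2" "B1 \<inter> B2 = {}" "B1 \<subseteq> B" "B2 \<subseteq> B" by (auto simp: B1_def B2_def)
  have fin12: "finite B1" "finite B2" using finB B12 finite_subset by blast+
  define C1 where "C1 = (\<Sum>l\<in>B1. (c l)\<^sup>2)"
  define C2 where "C2 = (\<Sum>l\<in>B2. (c l)\<^sup>2)"
  have C: "0 \<le> C1" "0 \<le> C2" "H = C1 + C2"
    using B12(2) fin12 by (auto simp: C1_def C2_def H_def B12(1) sum_nonneg sum.union_disjoint)
  have jO: "j \<in> I" "\<theta> \<le> \<bar>lam j\<bar>" "\<bar>lam j\<bar> = t0" using j BI t0 by auto
  let ?K = "{l\<in>I. \<bar>lam j\<bar> / 2 \<le> \<bar>lam l\<bar>}"
  let ?G = "\<lambda>D E. \<Sum>i\<in>I. coin p S i * g D i * g E i"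
  have g_split: "g B i = g B1 i + g B2 i" for i
    unfolding g_def B12(1) by (rule sum.union_disjoint) (use fin12 B12(2) in auto)
  have "g B1 i = ip ?K (\<lambda>l. u l i) (\<lambda>l. if l \<in> B1 then sqrt (lam l) * c l else 0)" for i
  proof -
    have "B1 \<subseteq> ?K" using BI jO by (auto simp: B1_def)
    then show ?thesis using finI by (subst ip_subset_indicator) (auto simp: g_def mult_ac)
  qed
  then have G11': "\<bar>?G B1 B1\<bar> \<le> 2 * \<theta> / t0 * (\<Sum>l\<in>B1. (sqrt (lam l) * c l)\<^sup>2)"
  proof -
    assume eq: "\<And>i. g B1 i = ip ?K (\<lambda>l. u l i) (\<lambda>l. if l \<in> B1 then sqrt (lam l) * c l else 0)"
    have B1K: "B1 \<subseteq> ?K" using BI jO by (auto simp: B1_def)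
    have finK: "finite ?K" using finI by simp
    let ?x = "\<lambda>l. if l \<in> B1 then sqrt (lam l) * c l else 0"
    have "\<bar>?G B1 B1\<bar> \<le> 2 * \<theta> / \<bar>lam j\<bar> * (sqrt (ip ?K ?x ?x) * sqrt (ip ?K ?x ?x))"
      unfolding eq by (rule coin_boundedD[OF gram[OF jO(1,2)]])
    also have "sqrt (ip ?K ?x ?x) * sqrt (ip ?K ?x ?x) = (\<Sum>l\<in>B1. (sqrt (lam l) * c l)\<^sup>2)"
      unfolding ip_self_subset_indicator[OF finK B1K] by (simp add: sum_nonneg)
    finally show ?thesis unfolding jO(3) .
  qed
  have "(\<Sum>l\<in>B1. (sqrt (lam l) * c l)\<^sup>2) \<le> (\<Sum>l\<in>B1. t0 * (c l)\<^sup>2)"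
    using B12(3) by (intro sum_mono) (auto simp: power_mult_distrib lampos subset_iff le_t0 intro!: mult_right_mono)
  also have "\<dots> = t0 * C1" by (simp add: C1_def sum_distrib_left)
  finally have "2 * \<theta> / t0 * (\<Sum>l\<in>B1. (sqrt (lam l) * c l)\<^sup>2) \<le> 2 * \<theta> / t0 * (t0 * C1)"
    using t0 \<theta>0 by (intro mult_left_mono) auto
  also have "\<dots> = 2 * \<theta> * C1" using t0 by simp
  finally have G11: "?G B1 B1 \<le> 2 * \<theta> * C1" using G11' by linarith
  have wg: "\<bar>?G D E\<bar> \<le> sqrt (\<theta> * t0) * (sqrt (\<Sum>l\<in>D. (c l)\<^sup>2) * sqrt (\<Sum>l\<in>E. (c l)\<^sup>2))"
    if DE: "D \<subseteq> B" "E \<subseteq> B" for D E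
  proof -
    have DO: "D \<subseteq> Out" "E \<subseteq> Out" using DE BO by auto
    have finO: "finite Out" using finI by simp
    have eq: "g D i = ip Out (\<lambda>l. sqrt (min \<bar>lam l\<bar> \<bar>lam j\<bar>) * u l i) (\<lambda>l. if l \<in> D then c l else 0)"
      if D: "D \<subseteq> B" for D i
    proof -
      have "D \<subseteq> Out" using D BO by auto
      then show ?thesis unfolding g_def jO(3)
        by (subst ip_subset_indicator[OF finO])
          (use D le_t0 lampos in \<open>auto intro!: sum.cong simp: subset_iff min_absorb1\<close>)
    qed
    show ?thesis
      unfolding eq[OF DE(1)] eq[OF DE(2)]
      using coin_boundedD[OF wgram[OF jO(1,2)], of "\<lambda>l. if l \<in> D then c l else 0" "\<lambda>l. if l \<in> E then c l else 0"]
      unfolding ip_self_subset_indicator[OF finO DO(1)] ip_self_subset_indicator[OF finO DO(2)] jO(3) .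
  qed
  define r where "r = sqrt (\<theta> * t0)"
  have r: "0 \<le> r" "r\<^sup>2 = \<theta> * t0" using \<theta>0 t0 by (auto simp: r_def)
  \<comment> \<open>AM-GM with the weights 8 \<theta> and t0 / 8, whose product is r^2 = \<theta>
    t0: the top block pays O(\<theta>), the lower block a fraction of its gap t0 / 2.\<close>
  have G12: "2 * ?G B1 B2 \<le> 8 * \<theta> * C1 + t0 / 8 * C2"
  proof -
    have "?G B1 B2 \<le> r * (sqrt C1 * sqrt C2)"
      using wg[OF B12(3,4)] unfolding r_def C1_def C2_def by linarith
    moreover have "2 * (r * (sqrt C1 * sqrt C2)) \<le> 8 * \<theta> * C1 + t0 / 8 * C2"
    proof -
      have "0 \<le> (sqrt (8 * \<theta> * C1) - sqrt (t0 / 8 * C2))\<^sup>2" by simp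
      also have "\<dots> = 8 * \<theta> * C1 + t0 / 8 * C2 - 2 * (sqrt (8 * \<theta> * C1) * sqrt (t0 / 8 * C2))"
        using \<theta>0 t0 C by (simp add: power2_diff)
      also have "sqrt (8 * \<theta> * C1) * sqrt (t0 / 8 * C2) = r * (sqrt C1 * sqrt C2)"
        unfolding r_def real_sqrt_mult[symmetric] by (simp add: mult_ac)
      finally show ?thesis by simp
    qed
    ultimately show ?thesis by linarith
  qed
  \<comment> \<open>In the lower block r itself is absorbed: (2 \<theta> + b)^2 \<ge> 8 \<theta> b,
    and b = t0 / 8 makes the right-hand side r^2.\<close>
  have G22: "?G B2 B2 \<le> (2 * \<theta> + t0 / 8) * C2"
  proof -
    have "?G B2 B2 \<le> r * (sqrt C2 * sqrt C2)"
      using wg[OF B12(4,4)] unfolding r_def C2_def by linarith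
    also have "\<dots> = r * C2" using C by simp
    also have "\<dots> \<le> (2 * \<theta> + t0 / 8) * C2"
    proof (rule mult_right_mono)
      have "r\<^sup>2 \<le> (2 * \<theta> + t0 / 8)\<^sup>2"
      proof -
        have "(2 * \<theta> + b)\<^sup>2 = (2 * \<theta> - b)\<^sup>2 + 8 * \<theta> * b" for b
          by (simp add: power2_eq_square algebra_simps)
        from this[of "t0 / 8"] show ?thesis
          using zero_le_power2[of "2 * \<theta> - t0 / 8"] unfolding r(2) by simp
      qed
      then show "r \<le> 2 * \<theta> + t0 / 8" by (rule power2_le_imp_le) (use \<theta>0 t0 in simp)
    qed (use C in auto)
    finally show ?thesis .
  qed
  have "ip I (g B) (g B) = (\<Sum>l\<in>B. (sqrt (lam l) * c l)\<^sup>2)"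
    unfolding g_def by (rule onb_combination(1)[OF finI onb BI])
  also have "\<dots> = (\<Sum>l\<in>B1. lam l * (c l)\<^sup>2) + (\<Sum>l\<in>B2. lam l * (c l)\<^sup>2)"
    unfolding B12(1) using lampos B12(1)
    by (subst sum.union_disjoint[OF fin12 B12(2)]) (auto simp: power_mult_distrib intro!: arg_cong2[where f = "(+)"] sum.cong)
  also have "\<dots> \<le> (\<Sum>l\<in>B1. t0 * (c l)\<^sup>2) + (\<Sum>l\<in>B2. t0 / 2 * (c l)\<^sup>2)"
    using le_t0 by (intro add_mono sum_mono mult_right_mono) (auto simp: B1_def B2_def)
  also have "\<dots> = t0 * C1 + t0 / 2 * C2" by (simp add: C1_def C2_def sum_distrib_left)
  finally have gg: "ip I (g B) (g B) \<le> t0 * C1 + t0 / 2 * C2" .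
  have "?G B B = ?G B1 B1 + 2 * ?G B1 B2 + ?G B2 B2"
  proof -
    have "?G B B = (\<Sum>i\<in>I. coin p S i * g B1 i * g B1 i + 2 * (coin p S i * g B1 i * g B2 i)
        + coin p S i * g B2 i * g B2 i)"
      by (intro sum.cong refl, simp only: g_split) (simp add: algebra_simps)
    then show ?thesis by (simp only: sum.distrib sum_distrib_left)
  qed
  then have "ip I (g B) (g B) + ?G B B
      \<le> (t0 * C1 + t0 / 2 * C2) + 2 * \<theta> * C1 + (8 * \<theta> * C1 + t0 / 8 * C2) + (2 * \<theta> + t0 / 8) * C2"
    using gg G11 G12 G22 by linarith
  \<comment> \<open>10 = 2 + 8 collects the error of the top block and its share of the cross term.
    In the lower block t0 / 2 + t0 / 8 + t0 / 8 stays below t0.\<close>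
  also have "\<dots> = (t0 + 10 * \<theta>) * C1 + (3 / 4 * t0 + 2 * \<theta>) * C2" by (simp add: algebra_simps)
  also have "\<dots> \<le> (t0 + 10 * \<theta>) * C1 + (t0 + 10 * \<theta>) * C2"
    using C t0 \<theta>0 by (intro add_left_mono mult_right_mono) auto
  also have "\<dots> = (t0 + 10 * \<theta>) * H" by (simp add: C(3) algebra_simps)
  also have "\<dots> \<le> (t + 10 * \<theta>) * H" using t0 C by (intro mult_right_mono) auto
  finally have gS: "ip S (g B) (g B) \<le> p * ((t + 10 * \<theta>) * H)"
    unfolding ip_sample[OF finI SI p0] using p0 by (intro mult_left_mono) auto
  have "H * H \<le> ip S (g B) (g B) * ip S x x"
    using ip_cauchy_schwarz[of S "g B" x] unfolding Hx by (simp add: power2_eq_square)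
  also have "\<dots> \<le> (p * ((t + 10 * \<theta>) * H)) * ip S x x" using gS by (intro mult_right_mono) auto
  finally have HH: "H * H \<le> H * (p * (t + 10 * \<theta>) * ip S x x)" by (simp add: mult_ac)
  have "H \<le> p * (t + 10 * \<theta>) * ip S x x"
  proof (cases "H = 0")
    case True then show ?thesis using p0 t \<theta>0 by simp
  next
    case False
    then have "H > 0" using C by simp
    then show ?thesis using HH by (simp only: mult_le_cancel_left_pos)
  qed
  then show ?thesis unfolding H_eq .
qed


text \<open>If too many sampled eigenvalues were large, some nonzero \<open>x\<close> in the span of
  their eigenvectors would be orthogonal on \<open>S\<close> to every \<open>u l\<close> with lam l
  > t. Its form is then at most p (t + 10 \<theta> + 9 \<theta>) |x|^2, from the positive part up to
  t and the tail; negative eigenvalues only help. The 20 leaves room for a strict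
  contradiction.\<close>

lemma upper_count:
  assumes A: "\<And>i k. i \<in> S \<Longrightarrow> k \<in> S \<Longrightarrow> a i k = (\<Sum>l\<in>I. lam l * u l i * u l k)"
    and sp: "spectral S (\<lambda>i k. a i k / p) \<kappa> v" and t: "t > 0"
  shows "card {l\<in>S. \<kappa> l > t + 20 * \<theta>} \<le> card {l\<in>I. lam l > t}"
proof (rule ccontr)
  let ?K = "{l\<in>S. \<kappa> l > t + 20 * \<theta>}" and ?E = "{l\<in>I. lam l > t}"
  assume "\<not> card ?K \<le> card ?E"
  then have "\<exists>z. (\<exists>k\<in>?K. z k \<noteq> 0) \<and> (\<forall>l\<in>?E. (\<Sum>k\<in>?K. ip S (u l) (v k) * z k) = 0)"
    using finI finS by (intro homogeneous_solution) auto
  then obtain z where z: "\<exists>k\<in>?K. z k \<noteq> 0" "\<And>l. l \<in> ?E \<Longrightarrow> (\<Sum>k\<in>?K. ip S (u l) (v k) * z k) = 0" by blast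
  have onbv: "onb S v" using sp by (simp add: spectral_def)
  define x where "x i = (\<Sum>k\<in>?K. z k * v k i)" for i
  have ux: "ip S (u l) x = 0" if "l \<in> ?E" for l
    using z(2)[OF that] unfolding x_def ip_sum_right ip_scale_right by (simp add: mult.commute)
  have vx: "ip S (v m) x = (if m \<in> ?K then z m else 0)" if m: "m \<in> S" for m
  proof -
    have "ip S (v m) x = (\<Sum>k\<in>?K. z k * (if m = k then 1 else 0))"
      unfolding x_def ip_sum_right ip_scale_right
      by (intro sum.cong refl) (use onb_ip[OF onbv m] in auto)
    also have "\<dots> = (if m \<in> ?K then z m else 0)"
      using sum_delta_real(4)[of ?K m z] finS by (auto intro!: sum.neutral)
    finally show ?thesis .
  qed
  define N where "N = (\<Sum>k\<in>?K. (z k)\<^sup>2)"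
  have N: "N > 0"
    using z(1) finS unfolding N_def by (auto intro!: sum_pos2)
  have KS: "?K \<subseteq> S" by auto
  have xx: "ip S x x = N"
  proof -
    have "ip S x x = (\<Sum>m\<in>S. ip S (v m) x * ip S (v m) x)" using onb_parseval[OF finS onbv] by simp
    also have "\<dots> = ip S (\<lambda>l. if l \<in> ?K then z l else 0) (\<lambda>l. if l \<in> ?K then z l else 0)"
      unfolding ip_def[of S "\<lambda>l. if l \<in> ?K then z l else 0"] by (intro sum.cong refl) (simp only: vx)
    also have "\<dots> = N" unfolding N_def by (rule ip_self_subset_indicator[OF finS KS])
    finally show ?thesis .
  qed
  let ?q = "\<Sum>i\<in>S. \<Sum>k\<in>S. a i k * x i * x k"
  have "?q / p = (\<Sum>i\<in>S. \<Sum>k\<in>S. a i k / p * x i * x k)"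
    by (simp add: sum_divide_distrib)
  also have "\<dots> = (\<Sum>m\<in>S. \<kappa> m * ip S (v m) x * ip S (v m) x)"
    by (rule spectral_bilinear[OF finS sp])
  also have "\<dots> = (\<Sum>m\<in>S. of_bool (m \<in> ?K) * (\<kappa> m * (z m)\<^sup>2))"
    by (intro sum.cong refl) (simp add: vx power2_eq_square)
  also have "\<dots> = (\<Sum>m\<in>?K. \<kappa> m * (z m)\<^sup>2)" by (rule sum_indicator_subset[OF finS KS])
  also have "\<dots> \<ge> (\<Sum>m\<in>?K. (t + 20 * \<theta>) * (z m)\<^sup>2)" by (intro sum_mono mult_right_mono) auto
  finally have lower: "(t + 20 * \<theta>) * N \<le> ?q / p" by (simp add: N_def sum_distrib_left)
  have "(\<Sum>l\<in>Out. lam l * (ip S (u l) x)\<^sup>2)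
      \<le> (\<Sum>l\<in>Out. of_bool (l \<in> {l\<in>I. \<theta> \<le> lam l \<and> lam l \<le> t}) * (lam l * (ip S (u l) x)\<^sup>2))"
  proof (rule sum_mono)
    fix l assume l: "l \<in> Out"
    consider "lam l > t" | "lam l \<le> t" "lam l \<ge> 0" | "lam l < 0" by linarith
    then show "lam l * (ip S (u l) x)\<^sup>2
       \<le> of_bool (l \<in> {l\<in>I. \<theta> \<le> lam l \<and> lam l \<le> t}) * (lam l * (ip S (u l) x)\<^sup>2)"
      using l ux[of l] \<theta>0 by cases (auto simp: mult_nonpos_nonneg)
  qed
  also have "\<dots> = (\<Sum>l\<in>{l\<in>I. \<theta> \<le> lam l \<and> lam l \<le> t}. lam l * (ip S (u l) x)\<^sup>2)"
    using finI \<theta>0 by (intro sum_indicator_subset) auto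
  also have "\<dots> \<le> p * (t + 10 * \<theta>) * N" unfolding xx[symmetric] by (rule positive_part_bound[OF t])
  finally have "?q \<le> p * (t + 10 * \<theta>) * N + 9 * p * \<theta> * N"
    using quadratic_form[of a x, OF A] unfolding xx by linarith
  then have "?q / p \<le> (t + 19 * \<theta>) * N" using p0 by (simp add: field_simps)
  then have "(t + 20 * \<theta>) * N \<le> (t + 19 * \<theta>) * N" using lower by linarith
  then show False using N \<theta>0 by simp
qed

text \<open>The test vector is the sample of a combination \<open>h\<close> of eigenvectors with \<open>\<bar>lam\<bar> \<ge> \<mu>\<close>, of both
  signs. The negative ones serve to make it orthogonal to the sampled negative eigenvectors, so that
  large negative eigenvalues do not enter its quadratic form.\<close>
lemma lower_count:
  assumes A: "\<And>i k. i \<in> S \<Longrightarrow> k \<in> S \<Longrightarrow> a i k = (\<Sum>l\<in>I. lam l * u l i * u l k)"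
    and sp: "spectral S (\<lambda>i k. a i k / p) \<kappa> v" and t: "t > 0"
  shows "card {l\<in>I. lam l > t + 20 * \<theta>} \<le> card {l\<in>S. \<kappa> l > t}"
proof (rule ccontr)
  let ?P = "{l\<in>I. lam l > t + 20 * \<theta>}" and ?E = "{l\<in>S. \<kappa> l > t}"
  assume less: "\<not> card ?P \<le> card ?E"
  then have ne: "?P \<noteq> {}" by (metis card.empty le0)
  have onbv: "onb S v" using sp by (simp add: spectral_def)
  \<comment> \<open>The comparison runs at the scale of an actual eigenvalue \<mu> = lam j, since
    \<open>gram\<close> and \<open>wgram\<close> are available only at such scales.\<close>
  define \<mu> where "\<mu> = Min (lam ` ?P)"
  have "\<mu> \<in> lam ` ?P" unfolding \<mu>_def using finI ne by (intro Min_in) auto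
  then obtain j where j: "j \<in> I" "lam j = \<mu>" "\<mu> > t + 20 * \<theta>" by auto
  have \<mu>: "\<mu> > 0" "\<theta> \<le> \<mu>" "4 * \<theta> \<le> \<mu>" using j t \<theta>0 by auto
  have \<mu>_le: "\<mu> \<le> lam l" if "l \<in> ?P" for l unfolding \<mu>_def using that finI by auto
  have jO: "j \<in> I" "\<theta> \<le> \<bar>lam j\<bar>" "\<bar>lam j\<bar> = \<mu>" using j \<mu> by auto
  define V where "V = {l\<in>I. \<mu> \<le> \<bar>lam l\<bar>}"
  define Neg where "Neg = {l\<in>V. lam l < 0}"
  have V: "V = ?P \<union> Neg" "?P \<inter> Neg = {}"
    unfolding V_def Neg_def using \<mu>_le j \<mu> \<theta>0 t by (auto; force)+
  have fin: "finite V" "finite Neg" "finite ?P" "finite ?E" "finite Out"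
    using finI finS by (auto simp: V_def Neg_def)
  have VI: "V \<subseteq> I" by (auto simp: V_def)
  have VO: "V \<subseteq> Out" using \<mu> by (auto simp: V_def)
  \<comment> \<open>One equation for each negative eigenvector in \<open>V\<close> and one for each
    sampled eigenvalue above t. By assumption they are fewer than the unknowns, one for each element
    of \<open>V\<close>.\<close>
  define eqn where "eqn e l = (case e of Inl m \<Rightarrow> ip S (u m) (u l) | Inr k \<Rightarrow> ip S (v k) (u l))" for e l
  have "\<exists>c. (\<exists>l\<in>V. c l \<noteq> 0) \<and> (\<forall>e\<in>Neg <+> ?E. (\<Sum>l\<in>V. eqn e l * c l) = 0)"
  proof (rule homogeneous_solution)
    show "card (Neg <+> ?E) < card V"
      using less fin by (simp add: V card_Un_disjoint card_Plus)
  qed (use fin in auto)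
  then obtain c where c: "\<exists>l\<in>V. c l \<noteq> 0" "\<And>e. e \<in> Neg <+> ?E \<Longrightarrow> (\<Sum>l\<in>V. eqn e l * c l) = 0" by blast
  define h where "h i = (\<Sum>l\<in>V. c l * u l i)" for i
  have ip_h: "ip S x h = (\<Sum>l\<in>V. c l * ip S x (u l))" for x
    unfolding h_def ip_sum_right ip_scale_right ..
  have uh: "ip S (u m) h = 0" if "m \<in> Neg" for m
    using c(2)[OF InlI[OF that]] unfolding ip_h eqn_def by (simp add: mult.commute)
  have vh: "ip S (v k) h = 0" if "k \<in> ?E" for k
    using c(2)[OF InrI[OF that]] unfolding ip_h eqn_def by (simp add: mult.commute)
  define C where "C = (\<Sum>l\<in>V. (c l)\<^sup>2)"
  have C: "C > 0" using c(1) fin unfolding C_def by (auto intro!: sum_pos2)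
  have hI: "ip I h h = C" unfolding h_def C_def by (rule onb_combination(1)[OF finI onb VI])
  let ?K = "{l\<in>I. \<bar>lam j\<bar> / 2 \<le> \<bar>lam l\<bar>}"
  let ?c = "\<lambda>l. if l \<in> V then c l else 0"
  have VK: "V \<subseteq> ?K" using jO \<mu> by (auto simp: V_def)
  have finK: "finite ?K" using finI by simp
  have "h i = ip ?K (\<lambda>l. u l i) ?c" for i
    unfolding ip_subset_indicator[OF finK VK] by (simp add: h_def mult.commute)
  then have "\<bar>\<Sum>i\<in>I. coin p S i * h i * h i\<bar> \<le> 2 * \<theta> / \<bar>lam j\<bar> * (sqrt (ip ?K ?c ?c) * sqrt (ip ?K ?c ?c))"
    by (simp only:) (rule coin_boundedD[OF gram[OF jO(1,2)]])
  also have "sqrt (ip ?K ?c ?c) * sqrt (ip ?K ?c ?c) = C"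
    unfolding ip_self_subset_indicator[OF finK VK] C_def by (simp add: sum_nonneg)
  finally have hc: "\<bar>\<Sum>i\<in>I. coin p S i * h i * h i\<bar> \<le> 2 * \<theta> / \<mu> * C" unfolding jO(3) .
  define X where "X = ip S h h"
  have X_eq: "X = p * (C + (\<Sum>i\<in>I. coin p S i * h i * h i))"
    unfolding X_def ip_sample[OF finI SI p0] hI ..
  define \<eta> where "\<eta> = 2 * \<theta> / \<mu>"
  have \<eta>: "0 \<le> \<eta>" "\<eta> \<le> 1 / 2" "\<mu> * \<eta> = 2 * \<theta>" using \<mu> \<theta>0 by (auto simp: \<eta>_def field_simps)
  have X_ge: "p * ((1 - \<eta>) * C) \<le> X"
    unfolding X_eq using hc p0 by (intro mult_left_mono) (auto simp: \<eta>_def algebra_simps)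
  have C_le: "p * C \<le> 2 * X"
  proof -
    have "p * ((1 / 2) * C) \<le> p * ((1 - \<eta>) * C)"
      using p0 C \<eta> by (intro mult_left_mono mult_right_mono) auto
    then show ?thesis using X_ge by linarith
  qed
  have X0: "X > 0" using C_le C p0 by (metis less_le_trans mult_pos_pos zero_less_mult_pos zero_less_numeral)
  \<comment> \<open>The energy of \<open>h\<close> in the positive directions, which is at least
    almost p X: X pairs \<open>c\<close> with the inner products of \<open>h\<close> against
    \<open>V\<close>, those against \<open>Neg\<close> vanish, and C = |c|^2 is at most X / (p (1 -
    \<eta>)).\<close>
  define Y where "Y = (\<Sum>l\<in>?P. (ip S (u l) h)\<^sup>2)"
  have "X = (\<Sum>l\<in>V. c l * ip S (u l) h)"
    unfolding X_def by (subst ip_h) (simp add: ip_commute)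
  also have "\<dots> = ip V c (\<lambda>l. ip S (u l) h)" by (simp add: ip_def)
  finally have "X\<^sup>2 \<le> ip V c c * ip V (\<lambda>l. ip S (u l) h) (\<lambda>l. ip S (u l) h)"
    using ip_cauchy_schwarz[of V c "\<lambda>l. ip S (u l) h"] by simp
  also have "ip V c c = C" by (simp add: ip_def C_def power2_eq_square)
  also have "ip V (\<lambda>l. ip S (u l) h) (\<lambda>l. ip S (u l) h) = Y"
    unfolding ip_def[of V] Y_def unfolding V(1) using fin V(2) uh
    by (subst sum.union_disjoint) (auto simp: power2_eq_square)
  finally have XY: "X\<^sup>2 \<le> C * Y" .
  have Y_ge: "p * (1 - \<eta>) * X \<le> Y"
  proof -
    have "(p * (1 - \<eta>) * X) * C \<le> X * X"
      using mult_right_mono[OF X_ge, of X] X0 by (simp add: mult_ac)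
    also have "\<dots> \<le> Y * C" using XY by (simp add: power2_eq_square mult.commute)
    finally show ?thesis using C by simp
  qed
  define Z where "Z = {l\<in>I. \<theta> \<le> \<bar>lam l\<bar> \<and> \<bar>lam l\<bar> < \<mu>}"
  have finZ: "finite Z" using finI by (simp add: Z_def)
  have ZO: "Z \<subseteq> Out" by (auto simp: Z_def)
  have OVZ: "Out = V \<union> Z" "V \<inter> Z = {}" using \<mu> by (auto simp: V_def Z_def)
  \<comment> \<open>\<open>D\<close> measures how much of the sampled \<open>h\<close> leaks into
    the intermediate eigenvalues. The unsampled \<open>h\<close> is orthogonal to them, so only the
    fluctuation contributes; cancelling sqrt D then makes the effect quadratic in the
    coupling.\<close>
  define d where "d l = sqrt \<bar>lam l\<bar> * ip S (u l) h" for l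
  define D where "D = (\<Sum>l\<in>Z. (d l)\<^sup>2)"
  have D0: "0 \<le> D" by (simp add: D_def sum_nonneg)
  have D_eq: "D = (\<Sum>l\<in>Z. \<bar>lam l\<bar> * (ip S (u l) h)\<^sup>2)"
    unfolding D_def d_def by (intro sum.cong refl) (simp add: power_mult_distrib)
  have D_le: "D \<le> 2 * p * \<theta> * X"
  proof -
    define e where "e i = (\<Sum>l\<in>Z. (sqrt \<bar>lam l\<bar> * d l) * u l i)" for i
    have De: "D = ip S e h"
      unfolding e_def ip_sum_left ip_scale_left D_def
      by (intro sum.cong refl) (simp add: d_def power2_eq_square)
    have eh: "ip I e h = 0"
      unfolding e_def ip_sum_left ip_scale_left
    proof (rule sum.neutral, rule ballI)
      fix l assume "l \<in> Z"
      then have "l \<in> I - V" by (auto simp: Z_def V_def)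
      then show "sqrt \<bar>lam l\<bar> * d l * ip I (u l) h = 0"
        unfolding h_def by (simp add: onb_combination(2)[OF finI onb VI])
    qed
    let ?w = "\<lambda>i l. sqrt (min \<bar>lam l\<bar> \<bar>lam j\<bar>) * u l i"
    let ?d = "\<lambda>l. if l \<in> Z then d l else 0"
    \<comment> \<open>The capped weight is |lam l| on \<open>Z\<close> and \<mu> on
      \<open>V\<close>, so a single use of \<open>wgram\<close> covers the mixed form, and sqrt
      \<mu> cancels afterwards.\<close>
    have ew: "e i = ip Out (?w i) ?d" for i
      unfolding e_def ip_subset_indicator[OF fin(5) ZO] unfolding jO(3)
      by (intro sum.cong refl) (auto simp: Z_def min_absorb1)
    have hw: "sqrt \<mu> * h i = ip Out (?w i) ?c" for i
      unfolding h_def ip_subset_indicator[OF fin(5) VO] sum_distrib_left unfolding jO(3)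
      by (intro sum.cong refl) (auto simp: V_def min_absorb2)
    have dd: "ip Out ?d ?d = D" "ip Out ?c ?c = C"
      unfolding ip_self_subset_indicator[OF fin(5) ZO] ip_self_subset_indicator[OF fin(5) VO]
      by (simp_all add: D_def C_def)
    define W where "W = (\<Sum>i\<in>I. coin p S i * e i * (sqrt \<mu> * h i))"
    have "W = (\<Sum>i\<in>I. coin p S i * ip Out (?w i) ?d * ip Out (?w i) ?c)"
      unfolding W_def by (intro sum.cong refl) (simp only: ew hw)
    then have "\<bar>W\<bar> \<le> sqrt (\<theta> * \<bar>lam j\<bar>) * (sqrt (ip Out ?d ?d) * sqrt (ip Out ?c ?c))"
      by (simp only:) (rule coin_boundedD[OF wgram[OF jO(1,2)]])
    then have W_le: "W \<le> sqrt (\<theta> * \<mu>) * (sqrt D * sqrt C)"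
      unfolding dd unfolding jO(3) by (rule abs_le_D1)
    have "sqrt \<mu> * D = p * W"
      unfolding De ip_sample[OF finI SI p0] eh W_def by (simp add: sum_distrib_left mult_ac)
    also have "p * W \<le> p * (sqrt (\<theta> * \<mu>) * (sqrt D * sqrt C))"
      using W_le p0 by (intro mult_left_mono) auto
    also have "p * (sqrt (\<theta> * \<mu>) * (sqrt D * sqrt C)) = sqrt \<mu> * (p * (sqrt \<theta> * (sqrt D * sqrt C)))"
      unfolding real_sqrt_mult by (simp only: mult_ac)
    finally have "D \<le> p * (sqrt \<theta> * (sqrt D * sqrt C))" using \<mu> by simp
    then have DD: "sqrt D * sqrt D \<le> sqrt D * (p * sqrt \<theta> * sqrt C)" using D0 by (simp add: mult_ac)
    have "sqrt D \<le> p * sqrt \<theta> * sqrt C"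
    proof (cases "D = 0")
      case True then show ?thesis using C p0 \<theta>0 by simp
    next
      case False
      then have "sqrt D > 0" using D0 by simp
      then show ?thesis using DD by (simp only: mult_le_cancel_left_pos)
    qed
    then have "D \<le> (p * sqrt \<theta> * sqrt C)\<^sup>2" by (rule sqrt_le_D)
    also have "\<dots> = p * \<theta> * (p * C)" using \<theta>0 C by (simp add: power_mult_distrib) (simp add: power2_eq_square)
    also have "\<dots> \<le> p * \<theta> * (2 * X)" using C_le p0 \<theta>0 by (intro mult_left_mono) auto
    finally show ?thesis by simp
  qed
  let ?q = "\<Sum>i\<in>S. \<Sum>k\<in>S. a i k * h i * h k"
  have "(\<Sum>l\<in>Out. lam l * (ip S (u l) h)\<^sup>2)
      = (\<Sum>l\<in>?P. lam l * (ip S (u l) h)\<^sup>2) + (\<Sum>l\<in>Z. lam l * (ip S (u l) h)\<^sup>2)"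
  proof -
    have "(\<Sum>l\<in>Out. lam l * (ip S (u l) h)\<^sup>2)
        = (\<Sum>l\<in>V. lam l * (ip S (u l) h)\<^sup>2) + (\<Sum>l\<in>Z. lam l * (ip S (u l) h)\<^sup>2)"
      unfolding OVZ(1) by (rule sum.union_disjoint[OF fin(1) finZ OVZ(2)])
    also have "(\<Sum>l\<in>V. lam l * (ip S (u l) h)\<^sup>2)
        = (\<Sum>l\<in>?P. lam l * (ip S (u l) h)\<^sup>2) + (\<Sum>l\<in>Neg. lam l * (ip S (u l) h)\<^sup>2)"
      unfolding V(1) by (rule sum.union_disjoint[OF fin(3,2) V(2)])
    also have "(\<Sum>l\<in>Neg. lam l * (ip S (u l) h)\<^sup>2) = 0" by (simp add: uh)
    finally show ?thesis by simp
  qed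
  moreover have "(\<Sum>l\<in>?P. \<mu> * (ip S (u l) h)\<^sup>2) \<le> (\<Sum>l\<in>?P. lam l * (ip S (u l) h)\<^sup>2)"
    by (intro sum_mono mult_right_mono \<mu>_le) auto
  moreover have "(\<Sum>l\<in>?P. \<mu> * (ip S (u l) h)\<^sup>2) = \<mu> * Y" by (simp add: Y_def sum_distrib_left)
  moreover have "(\<Sum>l\<in>Z. - (\<bar>lam l\<bar> * (ip S (u l) h)\<^sup>2)) \<le> (\<Sum>l\<in>Z. lam l * (ip S (u l) h)\<^sup>2)"
  proof (rule sum_mono)
    fix l
    show "- (\<bar>lam l\<bar> * (ip S (u l) h)\<^sup>2) \<le> lam l * (ip S (u l) h)\<^sup>2"
      using mult_right_mono[of "- \<bar>lam l\<bar>" "lam l" "(ip S (u l) h)\<^sup>2"] by simp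
  qed
  moreover have "\<mu> * (p * (1 - \<eta>) * X) \<le> \<mu> * Y" using Y_ge \<mu> by (intro mult_left_mono) auto
  moreover have "\<mu> * (p * (1 - \<eta>) * X) = p * (\<mu> - 2 * \<theta>) * X"
    unfolding \<eta>(3)[symmetric] by (simp add: algebra_simps)
  moreover have "\<bar>?q - (\<Sum>l\<in>Out. lam l * (ip S (u l) h)\<^sup>2)\<bar> \<le> 9 * p * \<theta> * X"
    unfolding X_def by (rule quadratic_form[OF A])
  \<comment> \<open>The losses are 2 \<theta> from the Gram error, 2 \<theta> from the intermediate
    eigenvalues and 9 \<theta> from the tail. Their sum 13 \<theta> is less than the margin 20
    \<theta>.\<close>
  ultimately have "p * (\<mu> - 2 * \<theta>) * X - 2 * p * \<theta> * X - 9 * p * \<theta> * X \<le> ?q"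
    using D_le unfolding D_eq sum_negf by linarith
  then have lower: "(\<mu> - 13 * \<theta>) * X \<le> ?q / p" using p0 by (simp add: field_simps)
  have "?q / p = (\<Sum>i\<in>S. \<Sum>k\<in>S. a i k / p * h i * h k)"
    by (simp add: sum_divide_distrib)
  also have "\<dots> = (\<Sum>m\<in>S. \<kappa> m * ip S (v m) h * ip S (v m) h)"
    by (rule spectral_bilinear[OF finS sp])
  also have "\<dots> \<le> (\<Sum>m\<in>S. t * (ip S (v m) h * ip S (v m) h))"
  proof (rule sum_mono)
    fix m assume "m \<in> S"
    then show "\<kappa> m * ip S (v m) h * ip S (v m) h \<le> t * (ip S (v m) h * ip S (v m) h)"
      using vh[of m] by (cases "\<kappa> m > t") (auto simp: mult.assoc intro!: mult_right_mono)
  qed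
  also have "\<dots> = t * X" unfolding sum_distrib_left[symmetric] onb_parseval[OF finS onbv] X_def ..
  finally have "(\<mu> - 13 * \<theta>) * X \<le> t * X" using lower by linarith
  then have "\<mu> - 13 * \<theta> \<le> t" using X0 by simp
  then show False using j(3) \<theta>0 by linarith
qed

end

subsection \<open>The sampled spectrum is good with high probability\<close>

lemma samp_prob_mem:
  assumes "finite J" "j \<in> J"
  shows "samp_prob p J (\<lambda>S. j \<in> S) = p"
proof -
  have J: "J = insert j (J - {j})" using assms by auto
  have 0: "samp_exp p (J - {j}) (\<lambda>S. of_bool (j \<in> S)) = samp_exp p (J - {j}) (\<lambda>_. 0)"
    by (rule samp_exp_cong) auto
  show ?thesis unfolding samp_prob_def
    by (subst J, subst samp_exp_insert) (use assms 0 in \<open>auto simp: samp_exp_const\<close>)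
qed

text \<open>A matrix and its transpose have the same operator norm: Cauchy-Schwarz bounds N^2 by a
  multiple of N, and N is cancelled.\<close>

lemma ip_dual_bound:
  assumes fin: "finite A" and c: "0 \<le> c"
    and bound: "\<And>x. (\<Sum>i\<in>A. (ip J (w i) x)\<^sup>2) \<le> c * ip J x x"
  shows "ip J (\<lambda>j. \<Sum>i\<in>A. z i * w i j) (\<lambda>j. \<Sum>i\<in>A. z i * w i j) \<le> c * (\<Sum>i\<in>A. (z i)\<^sup>2)"
proof -
  define y where "y j = (\<Sum>i\<in>A. z i * w i j)" for j
  have y: "y = (\<lambda>j. \<Sum>i\<in>A. z i * w i j)" by (simp add: y_def fun_eq_iff)
  define N where "N = ip J y y"
  have "N = (\<Sum>i\<in>A. z i * ip J (w i) y)"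
    unfolding N_def by (subst (1) y) (simp only: ip_sum_left ip_scale_left)
  also have "\<dots> = ip A z (\<lambda>i. ip J (w i) y)" by (simp add: ip_def)
  finally have "N\<^sup>2 \<le> ip A z z * ip A (\<lambda>i. ip J (w i) y) (\<lambda>i. ip J (w i) y)"
    using ip_cauchy_schwarz[of A z "\<lambda>i. ip J (w i) y"] by simp
  also have "ip A (\<lambda>i. ip J (w i) y) (\<lambda>i. ip J (w i) y) = (\<Sum>i\<in>A. (ip J (w i) y)\<^sup>2)"
    by (simp add: ip_def[of A] power2_eq_square)
  also have "ip A z z * \<dots> \<le> ip A z z * (c * N)"
    unfolding N_def by (intro mult_left_mono bound) auto
  finally have NN: "N * N \<le> N * (c * ip A z z)" by (simp add: power2_eq_square mult_ac)
  have "N \<le> c * ip A z z"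
  proof (cases "N = 0")
    case True then show ?thesis using c by simp
  next
    case False
    then have "N > 0" using ip_nonneg[of J y] by (simp add: N_def less_le)
    then show ?thesis using NN by (simp only: mult_le_cancel_left_pos)
  qed
  then show ?thesis unfolding N_def y_def by (simp add: ip_def[of A] power2_eq_square)
qed

text \<open>The factor \<open>80 = 5 \<cdot> 16\<close> comes from \<open>r = 16\<close> in the Bernstein inequality: each failure
  probability is then of order \<open>16\<^sup>-\<^sup>Q\<close>, which is at most \<open>s\<^sup>-\<^sup>4\<close> once \<open>s \<le> 2\<^sup>Q\<close>.\<close>
locale sampling_setup =
  fixes I :: "'a set" and a :: "'a \<Rightarrow> 'a \<Rightarrow> real" and lam :: "'a \<Rightarrow> real" and u :: "'a \<Rightarrow> 'a \<Rightarrow> real"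
    and n s e :: real and Q :: nat
  assumes finI: "finite I" and sp: "spectral I a lam u"
    and bounded: "\<And>i k. i \<in> I \<Longrightarrow> k \<in> I \<Longrightarrow> \<bar>a i k\<bar> \<le> 1"
    and n: "n = real (card I)" and s1: "1 \<le> s" and sn: "s < n" and e0: "0 < e" and e1: "e \<le> 1"
    and es: "e\<^sup>2 * s = 80 * real Q" and Q1: "1 \<le> Q"
begin

definition "p = s / n"
definition "\<theta> = e * n"

lemma n0: "0 < n" using s1 sn by simp
lemma p01: "0 < p" "p < 1" using s1 sn by (auto simp: p_def)
lemma pn: "p * n = s" using n0 by (simp add: p_def)
lemma \<theta>0: "0 < \<theta>" using e0 n0 by (simp add: \<theta>_def)
lemma onb: "onb I u" using sp by (simp add: spectral_def)
lemma a_eq: "i \<in> I \<Longrightarrow> k \<in> I \<Longrightarrow> a i k = (\<Sum>l\<in>I. lam l * u l i * u l k)"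
  using sp by (simp add: spectral_def)

lemma e_inv: "1 / e\<^sup>2 \<le> s / 80"
proof -
  have "80 \<le> e\<^sup>2 * s" using es Q1 by simp
  then show ?thesis using e0 by (simp add: field_simps)
qed

text \<open>The sum is the diagonal entry of the squared matrix at \<open>i\<close>, that is the
  squared norm of row \<open>i\<close>, whose entries are at most 1 in modulus.\<close>

lemma row_energy: "i \<in> I \<Longrightarrow> (\<Sum>l\<in>I. (lam l)\<^sup>2 * (u l i)\<^sup>2) \<le> n"
proof -
  assume i: "i \<in> I"
  have "(\<Sum>l\<in>I. (lam l)\<^sup>2 * (u l i)\<^sup>2) = (\<Sum>l\<in>I. ip I (u l) (a i) * ip I (u l) (a i))"
  proof (rule sum.cong[OF refl])
    fix l assume l: "l \<in> I"
    have "ip I (u l) (a i) = lam l * u l i"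
      using spectral_eigenvector[OF finI sp i l] by (simp add: ip_def mult.commute)
    then show "(lam l)\<^sup>2 * (u l i)\<^sup>2 = ip I (u l) (a i) * ip I (u l) (a i)"
      by (simp add: power2_eq_square)
  qed
  also have "\<dots> = ip I (a i) (a i)" by (rule onb_parseval[OF finI onb])
  also have "\<dots> \<le> (\<Sum>k\<in>I. 1)" unfolding ip_def
    using bounded[OF i] by (intro sum_mono) (metis abs_ge_zero abs_mult_self_eq mult_le_one)
  finally show ?thesis by (simp add: n)
qed

lemma leverage:
  assumes i: "i \<in> I" and \<nu>: "\<nu> > 0"
  shows "(\<Sum>l\<in>{l\<in>I. \<nu> \<le> \<bar>lam l\<bar>}. (u l i)\<^sup>2) \<le> n / \<nu>\<^sup>2"
proof -
  have "(\<Sum>l\<in>{l\<in>I. \<nu> \<le> \<bar>lam l\<bar>}. \<nu>\<^sup>2 * (u l i)\<^sup>2) \<le> (\<Sum>l\<in>{l\<in>I. \<nu> \<le> \<bar>lam l\<bar>}. (lam l)\<^sup>2 * (u l i)\<^sup>2)"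
    using \<nu> by (intro sum_mono mult_right_mono) (auto simp: abs_le_square_iff[symmetric])
  also have "\<dots> \<le> (\<Sum>l\<in>I. (lam l)\<^sup>2 * (u l i)\<^sup>2)" using finI by (intro sum_mono2) auto
  also have "\<dots> \<le> n" by (rule row_energy[OF i])
  finally show ?thesis using \<nu> by (simp add: sum_distrib_left[symmetric] field_simps)
qed

abbreviation "Out \<equiv> {l\<in>I. \<theta> \<le> \<bar>lam l\<bar>}"

text \<open>On \<open>Out\<close> one has \<theta> |lam l| \<le> (lam l)^2, so
  \<open>row_energy\<close> gives the bound n / \<theta> = 1 / e.\<close>

lemma weighted_leverage:
  assumes i: "i \<in> I"
  shows "(\<Sum>l\<in>Out. \<bar>lam l\<bar> * (u l i)\<^sup>2) \<le> 1 / e"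
proof -
  have "\<theta> * (\<Sum>l\<in>Out. \<bar>lam l\<bar> * (u l i)\<^sup>2)
      = (\<Sum>l\<in>Out. (\<theta> * \<bar>lam l\<bar>) * (u l i)\<^sup>2)"
    by (simp add: sum_distrib_left mult_ac)
  also have "\<dots> \<le> (\<Sum>l\<in>Out. (lam l)\<^sup>2 * (u l i)\<^sup>2)"
  proof (intro sum_mono mult_right_mono)
    fix l assume "l \<in> Out"
    then have "\<theta> * \<bar>lam l\<bar> \<le> \<bar>lam l\<bar> * \<bar>lam l\<bar>" by (intro mult_right_mono) auto
    then show "\<theta> * \<bar>lam l\<bar> \<le> (lam l)\<^sup>2" by (simp add: power2_eq_square)
  qed auto
  also have "\<dots> \<le> (\<Sum>l\<in>I. (lam l)\<^sup>2 * (u l i)\<^sup>2)" using finI by (intro sum_mono2) auto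
  also have "\<dots> \<le> n" by (rule row_energy[OF i])
  also have "n = \<theta> * (1 / e)" using e0 by (simp add: \<theta>_def)
  finally show ?thesis using \<theta>0 by (simp only: mult_le_cancel_left_pos)
qed

lemma u_normalized: "l \<in> I \<Longrightarrow> (\<Sum>i\<in>I. (u l i)\<^sup>2) = 1"
  using onb_ip[OF onb, of l l] by (simp add: ip_def power2_eq_square)

text \<open>Summing the leverage bound over all rows counts each normalized eigenvector
  once.\<close>

lemma large_count:
  assumes \<nu>: "\<nu> > 0"
  shows "real (card {l\<in>I. \<nu> \<le> \<bar>lam l\<bar>}) \<le> n\<^sup>2 / \<nu>\<^sup>2"
proof -
  have "real (card {l\<in>I. \<nu> \<le> \<bar>lam l\<bar>}) = (\<Sum>l\<in>{l\<in>I. \<nu> \<le> \<bar>lam l\<bar>}. \<Sum>i\<in>I. (u l i)\<^sup>2)"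
    by (simp add: u_normalized)
  also have "\<dots> = (\<Sum>i\<in>I. \<Sum>l\<in>{l\<in>I. \<nu> \<le> \<bar>lam l\<bar>}. (u l i)\<^sup>2)" by (rule sum.swap)
  also have "\<dots> \<le> (\<Sum>i\<in>I. n / \<nu>\<^sup>2)" by (intro sum_mono leverage \<nu>)
  finally show ?thesis by (simp add: n power2_eq_square)
qed

text \<open>Bernstein with \<gamma> = 1. The block reaches down to |lam j| / 2, the split needed in
  \<open>positive_part_bound\<close>; this quadruples the row bound and accounts for the 2 in the
  deviation.\<close>

lemma gram_event:
  assumes j: "j \<in> I" "\<theta> \<le> \<bar>lam j\<bar>"
  defines "K \<equiv> {l\<in>I. \<bar>lam j\<bar> / 2 \<le> \<bar>lam l\<bar>}"
  shows "samp_prob p I (\<lambda>S. \<not> coin_bounded p I K (\<lambda>i l. u l i) S (2 * \<theta> / \<bar>lam j\<bar>)) \<le> (1 / 16) ^ Q * (4 / e\<^sup>2)"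
proof -
  define \<nu> where "\<nu> = \<bar>lam j\<bar>"
  have \<nu>: "\<nu> > 0" "\<theta> \<le> \<nu>" using j \<theta>0 by (auto simp: \<nu>_def)
  have K: "K \<subseteq> I" "finite K" using finI by (auto simp: K_def)
  have sq: "\<theta>\<^sup>2 \<le> \<nu>\<^sup>2" using \<nu> \<theta>0 by (intro power_mono) auto
  interpret B: bernoulli_sum p I K "\<lambda>i l. u l i" 1 "4 * n / \<nu>\<^sup>2" "4 / e\<^sup>2"
  proof
    fix x
    have "(\<Sum>i\<in>I. (ip K (\<lambda>l. u l i) x)\<^sup>2) = ip I (\<lambda>i. \<Sum>l\<in>K. x l * u l i) (\<lambda>i. \<Sum>l\<in>K. x l * u l i)"
      unfolding ip_def by (simp add: power2_eq_square mult.commute)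
    also have "\<dots> = ip K x x"
      unfolding onb_combination(1)[OF finI onb K(1)] by (simp add: ip_def power2_eq_square)
    finally show "(\<Sum>i\<in>I. (ip K (\<lambda>l. u l i) x)\<^sup>2) \<le> 1 * ip K x x" by simp
  next
    fix i assume i: "i \<in> I"
    show "ip K (\<lambda>l. u l i) (\<lambda>l. u l i) \<le> 4 * n / \<nu>\<^sup>2"
      using leverage[OF i, of "\<nu> / 2"] \<nu> by (simp add: ip_def K_def \<nu>_def power2_eq_square mult.commute[of n])
  next
    have "(\<Sum>i\<in>I. ip K (\<lambda>l. u l i) (\<lambda>l. u l i)) = (\<Sum>l\<in>K. \<Sum>i\<in>I. (u l i)\<^sup>2)"
      unfolding ip_def by (subst sum.swap) (simp add: power2_eq_square)
    also have "\<dots> = real (card K)" using K by (simp add: u_normalized subset_iff)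
    also have "\<dots> \<le> n\<^sup>2 / (\<nu> / 2)\<^sup>2" using large_count[of "\<nu> / 2"] \<nu> by (simp add: K_def \<nu>_def)
    also have "\<dots> = 4 * n\<^sup>2 / \<nu>\<^sup>2" by (simp add: power_divide)
    also have "\<dots> \<le> 4 * n\<^sup>2 / \<theta>\<^sup>2" using sq \<theta>0 by (intro divide_left_mono mult_pos_pos) auto
    also have "\<dots> = 4 / e\<^sup>2" using n0 by (simp add: \<theta>_def power_mult_distrib)
    finally show "(\<Sum>i\<in>I. ip K (\<lambda>l. u l i) (\<lambda>l. u l i)) \<le> 4 / e\<^sup>2" .
  qed (use finI K p01 n0 in auto)
  \<comment> \<open>A restatement of e^2 s = 80 Q; it makes the smallness condition of
    \<open>bernstein\<close> an equality for r = 16.\<close>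
  have key: "80 * (real Q * n) = p * \<theta>\<^sup>2"
    using es n0 unfolding p_def \<theta>_def by (simp add: power2_eq_square field_simps)
  have "(1 / 16) ^ Q * (4 / e\<^sup>2 / 1) = (1 / 16) ^ Q * (4 / e\<^sup>2)" by simp
  moreover have "samp_prob p I (\<lambda>S. \<not> coin_bounded p I K (\<lambda>i l. u l i) S (2 * \<theta> / \<nu>)) \<le> (1 / 16) ^ Q * (4 / e\<^sup>2 / 1)"
  proof (rule B.bernstein)
    have "80 * (real Q * n) \<le> p * \<nu>\<^sup>2" unfolding key using sq p01 by (intro mult_left_mono) auto
    then have "4 * (real Q * n) \<le> p * \<nu>\<^sup>2" using n0 Q1
      by (smt (verit) mult_nonneg_nonneg of_nat_0_le_iff)
    then show "real Q * (4 * n / \<nu>\<^sup>2) \<le> p * 1" using \<nu> by (simp add: field_simps)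
    have "5 * 16 * 1 * (real Q * (4 * n / \<nu>\<^sup>2)) = 4 * (80 * (real Q * n)) / \<nu>\<^sup>2" by simp
    also have "\<dots> = p * (2 * \<theta> / \<nu>)\<^sup>2" unfolding key by (simp add: power_divide power_mult_distrib)
    finally show "5 * 16 * 1 * (real Q * (4 * n / \<nu>\<^sup>2)) \<le> p * (2 * \<theta> / \<nu>)\<^sup>2" by simp
  qed (use Q1 \<nu> \<theta>0 in auto)
  ultimately show ?thesis by (simp add: \<nu>_def)
qed

text \<open>Capping the weights at \<nu> = |lam j| keeps the Gram norm at \<nu>, while the rows have
  squared length at most 1 / e by \<open>weighted_leverage\<close>. Since 80 Q / e = p \<theta>,
  Bernstein resolves exactly sqrt (\<theta> \<nu>).\<close>

lemma weighted_gram_event: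
  assumes j: "j \<in> I" "\<theta> \<le> \<bar>lam j\<bar>"
  defines "K \<equiv> Out"
  defines "w \<equiv> (\<lambda>i l. sqrt (min \<bar>lam l\<bar> \<bar>lam j\<bar>) * u l i)"
  shows "samp_prob p I (\<lambda>S. \<not> coin_bounded p I K w S (sqrt (\<theta> * \<bar>lam j\<bar>))) \<le> (1 / 16) ^ Q * (1 / e\<^sup>2)"
proof -
  define \<nu> where "\<nu> = \<bar>lam j\<bar>"
  have \<nu>: "\<nu> > 0" "\<theta> \<le> \<nu>" using j \<theta>0 by (auto simp: \<nu>_def)
  have K: "K \<subseteq> I" "finite K" using finI by (auto simp: K_def)
  have wsq: "w i l * w i l = min \<bar>lam l\<bar> \<nu> * (u l i)\<^sup>2" for i l
    using \<nu> by (simp add: w_def \<nu>_def power2_eq_square mult.left_commute mult.assoc)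
  have cardK: "real (card K) \<le> 1 / e\<^sup>2"
    using large_count[OF \<theta>0] n0 by (simp add: K_def \<theta>_def power_mult_distrib)
  interpret B: bernoulli_sum p I K w \<nu> "1 / e" "\<nu> / e\<^sup>2"
  proof
    fix x
    have "(\<Sum>i\<in>I. (ip K (w i) x)\<^sup>2) = ip I (\<lambda>i. \<Sum>l\<in>K. (sqrt (min \<bar>lam l\<bar> \<nu>) * x l) * u l i) (\<lambda>i. \<Sum>l\<in>K. (sqrt (min \<bar>lam l\<bar> \<nu>) * x l) * u l i)"
      unfolding ip_def by (simp add: power2_eq_square w_def \<nu>_def mult_ac)
    also have "\<dots> = (\<Sum>l\<in>K. min \<bar>lam l\<bar> \<nu> * (x l)\<^sup>2)"
      unfolding onb_combination(1)[OF finI onb K(1)] using \<nu> by (simp add: power_mult_distrib)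
    also have "\<dots> \<le> (\<Sum>l\<in>K. \<nu> * (x l)\<^sup>2)" by (intro sum_mono mult_right_mono) auto
    also have "\<dots> = \<nu> * ip K x x" by (simp add: ip_def sum_distrib_left power2_eq_square)
    finally show "(\<Sum>i\<in>I. (ip K (w i) x)\<^sup>2) \<le> \<nu> * ip K x x" .
  next
    fix i assume i: "i \<in> I"
    have "ip K (w i) (w i) \<le> (\<Sum>l\<in>K. \<bar>lam l\<bar> * (u l i)\<^sup>2)"
      unfolding ip_def wsq by (intro sum_mono mult_right_mono) auto
    also have "\<dots> \<le> 1 / e" unfolding K_def by (rule weighted_leverage[OF i])
    finally show "ip K (w i) (w i) \<le> 1 / e" .
  next
    have "(\<Sum>i\<in>I. ip K (w i) (w i)) = (\<Sum>l\<in>K. min \<bar>lam l\<bar> \<nu> * (\<Sum>i\<in>I. (u l i)\<^sup>2))"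
      unfolding ip_def wsq by (subst sum.swap) (simp add: sum_distrib_left)
    also have "\<dots> \<le> (\<Sum>l\<in>K. \<nu>)" using K by (intro sum_mono) (auto simp: u_normalized subset_iff)
    also have "\<dots> = \<nu> * real (card K)" by simp
    also have "\<dots> \<le> \<nu> * (1 / e\<^sup>2)" using \<nu> by (intro mult_left_mono cardK) auto
    finally show "(\<Sum>i\<in>I. ip K (w i) (w i)) \<le> \<nu> / e\<^sup>2" by simp
  qed (use finI K p01 e0 \<nu> in auto)
  have key: "80 * (real Q / e) = p * \<theta>"
    using es n0 e0 unfolding p_def \<theta>_def by (simp add: power2_eq_square field_simps)
  have Qe: "0 \<le> real Q / e" using e0 by simp
  have "samp_prob p I (\<lambda>S. \<not> coin_bounded p I K w S (sqrt (\<theta> * \<nu>))) \<le> (1 / 16) ^ Q * (\<nu> / e\<^sup>2 / \<nu>)"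
  proof (rule B.bernstein)
    have "p * \<theta> \<le> p * \<nu>" using \<nu> p01 by (intro mult_left_mono) auto
    then show "real Q * (1 / e) \<le> p * \<nu>" using key Qe by simp
    have "5 * 16 * \<nu> * (real Q * (1 / e)) = \<nu> * (80 * (real Q / e))" by simp
    also have "\<dots> = p * (sqrt (\<theta> * \<nu>))\<^sup>2" unfolding key using \<nu> \<theta>0 by simp
    finally show "5 * 16 * \<nu> * (real Q * (1 / e)) \<le> p * (sqrt (\<theta> * \<nu>))\<^sup>2" by simp
  qed (use Q1 \<nu> \<theta>0 in auto)
  then show ?thesis using \<nu> by (simp add: \<nu>_def)
qed

section \<open>The part of the matrix below the threshold\<close>

abbreviation "In \<equiv> {l\<in>I. \<bar>lam l\<bar> < \<theta>}"

definition low :: "'a \<Rightarrow> 'a \<Rightarrow> real" where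
  "low i k = (\<Sum>l\<in>In. lam l * u l i * u l k)"

lemma low_sym: "low i k = low k i"
  by (simp add: low_def mult_ac)

lemma low_row: "ip I (low i) x = (\<Sum>l\<in>In. (lam l * ip I (u l) x) * u l i)"
proof -
  have "ip I (low i) x = ip I (\<lambda>k. \<Sum>l\<in>In. (lam l * u l i) * u l k) x"
    by (simp add: low_def[abs_def])
  then show ?thesis unfolding ip_sum_left ip_scale_left by (simp add: mult_ac)
qed

lemma low_norm: "(\<Sum>i\<in>I. (ip I (low i) x)\<^sup>2) \<le> \<theta>\<^sup>2 * ip I x x"
proof -
  have II: "In \<subseteq> I" by auto
  have "(\<Sum>i\<in>I. (ip I (low i) x)\<^sup>2) = (\<Sum>l\<in>In. (lam l * ip I (u l) x)\<^sup>2)"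
    unfolding low_row onb_combination(1)[OF finI onb II, symmetric] by (simp add: ip_def power2_eq_square)
  also have "\<dots> \<le> (\<Sum>l\<in>In. \<theta>\<^sup>2 * (ip I (u l) x)\<^sup>2)"
    unfolding power_mult_distrib using \<theta>0
    by (intro sum_mono mult_right_mono) (auto simp: abs_le_square_iff[symmetric])
  also have "\<dots> \<le> (\<Sum>l\<in>I. \<theta>\<^sup>2 * (ip I (u l) x)\<^sup>2)" using finI by (intro sum_mono2) auto
  also have "\<dots> = \<theta>\<^sup>2 * ip I x x"
    using onb_parseval[OF finI onb, of x x] by (simp add: sum_distrib_left[symmetric] power2_eq_square)
  finally show ?thesis .
qed

lemma low_energy: "i \<in> I \<Longrightarrow> ip I (low i) (low i) \<le> n"
proof -
  assume i: "i \<in> I"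
  have II: "In \<subseteq> I" by auto
  have low: "low i = (\<lambda>k. \<Sum>l\<in>In. (lam l * u l i) * u l k)" by (simp add: low_def fun_eq_iff)
  have "ip I (low i) (low i) = (\<Sum>l\<in>In. (lam l)\<^sup>2 * (u l i)\<^sup>2)"
    unfolding low onb_combination(1)[OF finI onb II] by (simp add: power_mult_distrib)
  also have "\<dots> \<le> (\<Sum>l\<in>I. (lam l)\<^sup>2 * (u l i)\<^sup>2)" using finI by (intro sum_mono2) auto
  also have "\<dots> \<le> n" by (rule row_energy[OF i])
  finally show ?thesis .
qed

text \<open>The entries of \<open>a\<close> are at most 1, and those of the complementary part over
  \<open>Out\<close> are at most 1 / e by AM-GM and \<open>weighted_leverage\<close>; finally 1 + 1
  / e \<le> 2 / e.\<close>

lemma low_bounded: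
  assumes ik: "i \<in> I" "k \<in> I"
  shows "\<bar>low i k\<bar> \<le> 2 / e"
proof -
  have I: "I = Out \<union> In" by auto
  have "a i k = (\<Sum>l\<in>Out. lam l * u l i * u l k) + low i k"
    unfolding a_eq[OF ik] low_def
    by (subst (1) I, rule sum.union_disjoint) (use finI in auto)
  moreover have "\<bar>\<Sum>l\<in>Out. lam l * u l i * u l k\<bar> \<le> 1 / e"
  proof -
    have "\<bar>\<Sum>l\<in>Out. lam l * u l i * u l k\<bar> \<le> (\<Sum>l\<in>Out. \<bar>lam l * u l i * u l k\<bar>)" by (rule sum_abs)
    also have "\<dots> \<le> (\<Sum>l\<in>Out. (1 / 2) * (\<bar>lam l\<bar> * (u l i)\<^sup>2) + (1 / 2) * (\<bar>lam l\<bar> * (u l k)\<^sup>2))"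
    proof (rule sum_mono)
      fix l
      have "0 \<le> (\<bar>u l i\<bar> - \<bar>u l k\<bar>)\<^sup>2" by simp
      then have "\<bar>u l i\<bar> * \<bar>u l k\<bar> \<le> (1 / 2) * (u l i)\<^sup>2 + (1 / 2) * (u l k)\<^sup>2"
        by (simp add: power2_diff)
      then have "\<bar>lam l\<bar> * (\<bar>u l i\<bar> * \<bar>u l k\<bar>) \<le> \<bar>lam l\<bar> * ((1 / 2) * (u l i)\<^sup>2 + (1 / 2) * (u l k)\<^sup>2)"
        by (intro mult_left_mono) auto
      then show "\<bar>lam l * u l i * u l k\<bar> \<le> (1 / 2) * (\<bar>lam l\<bar> * (u l i)\<^sup>2) + (1 / 2) * (\<bar>lam l\<bar> * (u l k)\<^sup>2)"
        by (simp add: abs_mult algebra_simps)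
    qed
    also have "\<dots> \<le> (1 / 2) * (1 / e) + (1 / 2) * (1 / e)"
      unfolding sum.distrib sum_distrib_left[symmetric]
      by (intro add_mono mult_left_mono weighted_leverage ik) auto
    finally show ?thesis by simp
  qed
  moreover have "1 \<le> 1 / e" using e0 e1 by simp
  ultimately show ?thesis using bounded[OF ik] by (simp add: add_divide_distrib[symmetric] abs_le_iff)
qed

end

section \<open>Sampling the low part: rows first, then columns\<close>

context sampling_setup
begin

lemma sum_sample:
  assumes "finite J" "S \<subseteq> J"
  shows "(\<Sum>i\<in>S. f i) = p * ((\<Sum>i\<in>J. f i) + (\<Sum>i\<in>J. coin p S i * f i))"
  using ip_sample[OF assms p01(1), of "\<lambda>_. 1" f] by (simp add: ip_def)

text \<open>The rows are sampled from \<open>T\<close> first, then the columns from \<open>I - T\<close>. Columns that become too long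
  cannot be excluded uniformly over all \<open>n\<close> of them without losing a factor \<open>log n\<close>, but it suffices
  that no such column is sampled.\<close>
definition rows_ok :: "'a set \<Rightarrow> bool" where
  "rows_ok S \<longleftrightarrow> (\<forall>x. (\<Sum>i\<in>S. (ip I (low i) x)\<^sup>2) \<le> 2 * p * \<theta>\<^sup>2 * ip I x x)"

definition col_ok :: "'a set \<Rightarrow> 'a \<Rightarrow> bool" where
  "col_ok S j \<longleftrightarrow> (\<Sum>i\<in>S. (low i j)\<^sup>2) \<le> 3 * s"

definition cross_ok :: "'a set \<Rightarrow> 'a set \<Rightarrow> bool" where
  "cross_ok S S' \<longleftrightarrow> (\<forall>x y. \<bar>\<Sum>i\<in>S. \<Sum>j\<in>S'. low i j * x i * y j\<bar>
      \<le> 3 * p * \<theta> * (sqrt (ip S x x) * sqrt (ip S' y y)))"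

lemma Qn: "80 * (real Q * n) = p * \<theta>\<^sup>2"
  using es n0 unfolding p_def \<theta>_def by (simp add: power2_eq_square field_simps)

lemma rows_event:
  assumes T: "T \<subseteq> I"
  shows "samp_prob p T (\<lambda>S. \<not> rows_ok S) \<le> (1 / 16) ^ Q * (1 / e\<^sup>2)"
proof -
  have finT: "finite T" using T finI finite_subset by blast
  interpret B: bernoulli_sum p T I low "\<theta>\<^sup>2" n "n\<^sup>2"
  proof
    fix x
    have "(\<Sum>i\<in>T. (ip I (low i) x)\<^sup>2) \<le> (\<Sum>i\<in>I. (ip I (low i) x)\<^sup>2)"
      using T finI by (intro sum_mono2) auto
    then show "(\<Sum>i\<in>T. (ip I (low i) x)\<^sup>2) \<le> \<theta>\<^sup>2 * ip I x x" using low_norm[of x] by linarith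
  next
    have "(\<Sum>i\<in>T. ip I (low i) (low i)) \<le> (\<Sum>i\<in>I. ip I (low i) (low i))"
      using T finI by (intro sum_mono2) auto
    also have "\<dots> \<le> (\<Sum>i\<in>I. n)" by (intro sum_mono low_energy)
    finally show "(\<Sum>i\<in>T. ip I (low i) (low i)) \<le> n\<^sup>2" by (simp add: n power2_eq_square)
  qed (use finT finI p01 \<theta>0 n0 T low_energy in auto)
  have "samp_prob p T (\<lambda>S. \<not> rows_ok S) \<le> samp_prob p T (\<lambda>S. \<not> coin_bounded p T I low S (\<theta>\<^sup>2))"
  proof (rule samp_prob_mono)
    fix S assume S: "S \<subseteq> T" and bad: "\<not> rows_ok S"
    show "\<not> coin_bounded p T I low S (\<theta>\<^sup>2)"
    proof
      assume good: "coin_bounded p T I low S (\<theta>\<^sup>2)"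
      have "(\<Sum>i\<in>S. (ip I (low i) x)\<^sup>2) \<le> 2 * p * \<theta>\<^sup>2 * ip I x x" for x
      proof -
        have "(\<Sum>i\<in>T. coin p S i * (ip I (low i) x)\<^sup>2) \<le> \<theta>\<^sup>2 * ip I x x"
          using coin_boundedD[OF good, of x x] by (simp add: power2_eq_square mult.assoc)
        then have "(\<Sum>i\<in>T. (ip I (low i) x)\<^sup>2) + (\<Sum>i\<in>T. coin p S i * (ip I (low i) x)\<^sup>2) \<le> 2 * (\<theta>\<^sup>2 * ip I x x)"
          using B.gram[of x] by linarith
        then show ?thesis unfolding sum_sample[OF finT S] using p01 by (simp add: mult_left_mono mult.assoc mult.left_commute)
      qed
      then show False using bad by (simp add: rows_ok_def)
    qed
  qed (use p01 in auto)
  also have "\<dots> \<le> (1 / 16) ^ Q * (n\<^sup>2 / \<theta>\<^sup>2)"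
  proof (rule B.bernstein)
    have "0 \<le> real Q * n" using n0 by simp
    then show "real Q * n \<le> p * \<theta>\<^sup>2" using Qn by linarith
    have "5 * 16 * \<theta>\<^sup>2 * (real Q * n) = \<theta>\<^sup>2 * (80 * (real Q * n))" by simp
    also have "\<dots> = p * (\<theta>\<^sup>2)\<^sup>2" unfolding Qn by (simp add: power2_eq_square)
    finally show "5 * 16 * \<theta>\<^sup>2 * (real Q * n) \<le> p * (\<theta>\<^sup>2)\<^sup>2" by simp
  qed (use Q1 \<theta>0 in auto)
  also have "n\<^sup>2 / \<theta>\<^sup>2 = 1 / e\<^sup>2" using n0 by (simp add: \<theta>_def power_mult_distrib)
  finally show ?thesis .
qed

text \<open>A scalar Bernstein bound, obtained from the matrix version with the one-element index
  set {j}. Its intrinsic dimension is 1, so no factor beyond 16^(-Q) appears. The 3 s in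
  \<open>col_ok\<close> consists of a mean of at most p n = s and a deviation of 2 p n.\<close>

lemma col_event:
  assumes T: "T \<subseteq> I" and j: "j \<in> I"
  shows "samp_prob p T (\<lambda>S. \<not> col_ok S j) \<le> (1 / 16) ^ Q"
proof -
  have finT: "finite T" using T finI finite_subset by blast
  have col: "(\<Sum>i\<in>T. (low i j)\<^sup>2) \<le> n"
  proof -
    have "(\<Sum>i\<in>T. (low i j)\<^sup>2) \<le> (\<Sum>i\<in>I. (low i j)\<^sup>2)" using T finI by (intro sum_mono2) auto
    also have "\<dots> = ip I (low j) (low j)" by (simp add: ip_def power2_eq_square low_sym[of _ j])
    finally show ?thesis using low_energy[OF j] by linarith
  qed
  have Qe: "80 * (real Q / e\<^sup>2) = s" using es e0 by (simp add: field_simps)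
  have Qe0: "0 \<le> real Q / e\<^sup>2" by simp
  interpret B: bernoulli_sum p T "{j}" low n "4 / e\<^sup>2" n
  proof
    fix x
    show "(\<Sum>i\<in>T. (ip {j} (low i) x)\<^sup>2) \<le> n * ip {j} x x"
      using mult_right_mono[OF col, of "(x j)\<^sup>2"]
      by (simp add: ip_def power_mult_distrib sum_distrib_right[symmetric] power2_eq_square[symmetric])
  next
    fix i assume "i \<in> T"
    then have "\<bar>low i j\<bar> \<le> 2 / e" using low_bounded T j by auto
    then have "(low i j)\<^sup>2 \<le> (2 / e)\<^sup>2" using e0 by (intro iffD1[OF abs_le_square_iff]) simp
    then show "ip {j} (low i) (low i) \<le> 4 / e\<^sup>2" by (simp add: ip_def power2_eq_square)
  qed (use finT p01 n0 col in \<open>auto simp: ip_def power2_eq_square\<close>)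
  have "samp_prob p T (\<lambda>S. \<not> col_ok S j) \<le> samp_prob p T (\<lambda>S. \<not> coin_bounded p T {j} low S (2 * n))"
  proof (rule samp_prob_mono)
    fix S assume S: "S \<subseteq> T" and bad: "\<not> col_ok S j"
    show "\<not> coin_bounded p T {j} low S (2 * n)"
    proof
      assume good: "coin_bounded p T {j} low S (2 * n)"
      have "(\<Sum>i\<in>T. coin p S i * (low i j)\<^sup>2) \<le> 2 * n"
        using coin_boundedD[OF good, of "\<lambda>_. 1" "\<lambda>_. 1"] by (simp add: ip_def power2_eq_square mult.assoc)
      then have "(\<Sum>i\<in>T. (low i j)\<^sup>2) + (\<Sum>i\<in>T. coin p S i * (low i j)\<^sup>2) \<le> 3 * n" using col by linarith
      then have "(\<Sum>i\<in>S. (low i j)\<^sup>2) \<le> p * (3 * n)"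
        unfolding sum_sample[OF finT S] using p01 by (intro mult_left_mono) auto
      then show False using bad pn by (simp add: col_ok_def mult.left_commute)
    qed
  qed (use p01 in auto)
  also have "\<dots> \<le> (1 / 16) ^ Q * (n / n)"
  proof (rule B.bernstein)
    have "real Q * (4 / e\<^sup>2) = 4 * (real Q / e\<^sup>2)" by simp
    then show "real Q * (4 / e\<^sup>2) \<le> p * n" using Qe Qe0 unfolding pn by linarith
    have "5 * 16 * n * (real Q * (4 / e\<^sup>2)) = 4 * n * (80 * (real Q / e\<^sup>2))" by simp
    also have "\<dots> = 4 * n * (p * n)" unfolding Qe pn ..
    also have "\<dots> = p * (2 * n)\<^sup>2" by (simp add: power2_eq_square)
    finally show "5 * 16 * n * (real Q * (4 / e\<^sup>2)) \<le> p * (2 * n)\<^sup>2" by simp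
  qed (use Q1 n0 in auto)
  finally show ?thesis using n0 by simp
qed

text \<open>With the row sample \<open>S\<close> fixed, the columns restricted to \<open>S\<close>
  are again vectors attached to independent coins. \<open>rows_ok\<close> bounds their Gram norm by
  duality, and \<open>col_ok\<close> their lengths.\<close>

lemma cross_event:
  assumes T: "T \<subseteq> I" and S: "S \<subseteq> T" and ok: "rows_ok S"
  shows "samp_prob p (I - T) (\<lambda>S'. \<not> cross_ok S S' \<and> (\<forall>j\<in>S'. col_ok S j)) \<le> (1 / 16) ^ Q * (3 / 2 / e\<^sup>2)"
proof -
  have finS: "finite S" and finT: "finite (I - T)"
    by (rule finite_subset[OF _ finI], use T S in auto)+
  have SI: "S \<subseteq> I" using T S by blast
  define w where "w j i = of_bool (col_ok S j) * low i j" for j i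
  have w_ip: "ip S (w j) x = of_bool (col_ok S j) * (\<Sum>i\<in>S. x i * low i j)" for j x
    by (cases "col_ok S j") (simp_all add: ip_def w_def mult.commute)
  have gram: "(\<Sum>j\<in>I - T. (ip S (w j) x)\<^sup>2) \<le> 2 * p * \<theta>\<^sup>2 * ip S x x" for x
  proof -
    have "(\<Sum>j\<in>I - T. (ip S (w j) x)\<^sup>2) \<le> (\<Sum>j\<in>I - T. (\<Sum>i\<in>S. x i * low i j)\<^sup>2)"
      unfolding w_ip by (intro sum_mono) auto
    also have "\<dots> \<le> (\<Sum>j\<in>I. (\<Sum>i\<in>S. x i * low i j)\<^sup>2)" using finI by (intro sum_mono2) auto
    also have "\<dots> = ip I (\<lambda>j. \<Sum>i\<in>S. x i * low i j) (\<lambda>j. \<Sum>i\<in>S. x i * low i j)"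
      by (simp add: ip_def power2_eq_square)
    also have "\<dots> \<le> 2 * p * \<theta>\<^sup>2 * (\<Sum>i\<in>S. (x i)\<^sup>2)"
      using ok p01 by (intro ip_dual_bound[OF finS]) (auto simp: rows_ok_def)
    finally show ?thesis by (simp add: ip_def power2_eq_square)
  qed
  have row: "ip S (w j) (w j) \<le> 3 * s" for j
  proof (cases "col_ok S j")
    case True
    then show ?thesis by (simp add: ip_def w_def col_ok_def power2_eq_square)
  next
    case False
    then show ?thesis using s1 by (simp add: ip_def w_def)
  qed
  interpret B: bernoulli_sum p "I - T" S w "2 * p * \<theta>\<^sup>2" "3 * s" "3 * s * n"
  proof
    have "(\<Sum>j\<in>I - T. ip S (w j) (w j)) \<le> (\<Sum>j\<in>I. ip S (w j) (w j))"
      using finI by (intro sum_mono2) auto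
    also have "\<dots> \<le> (\<Sum>j\<in>I. 3 * s)" by (intro sum_mono row)
    finally show "(\<Sum>j\<in>I - T. ip S (w j) (w j)) \<le> 3 * s * n" by (simp add: n mult.commute)
  qed (use gram row finS finT p01 \<theta>0 s1 in auto)
  have "samp_prob p (I - T) (\<lambda>S'. \<not> cross_ok S S' \<and> (\<forall>j\<in>S'. col_ok S j)) \<le> samp_prob p (I - T) (\<lambda>S'. \<not> coin_bounded p (I - T) S w S' (3 * p * \<theta>\<^sup>2))"
  proof (rule samp_prob_mono)
    fix S' assume S': "S' \<subseteq> I - T" and bad: "\<not> cross_ok S S' \<and> (\<forall>j\<in>S'. col_ok S j)"
    show "\<not> coin_bounded p (I - T) S w S' (3 * p * \<theta>\<^sup>2)"
    proof
      assume good: "coin_bounded p (I - T) S w S' (3 * p * \<theta>\<^sup>2)"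
      have "\<bar>\<Sum>i\<in>S. \<Sum>j\<in>S'. low i j * x i * y j\<bar> \<le> 3 * p * \<theta> * (sqrt (ip S x x) * sqrt (ip S' y y))" for x y
      proof -
        have "(\<Sum>j\<in>I - T. coin p S' j * (ip S (w j) x)\<^sup>2) \<le> 3 * p * \<theta>\<^sup>2 * ip S x x"
          using coin_boundedD[OF good, of x x] by (simp add: power2_eq_square mult.assoc)
        then have "(\<Sum>j\<in>I - T. (ip S (w j) x)\<^sup>2) + (\<Sum>j\<in>I - T. coin p S' j * (ip S (w j) x)\<^sup>2) \<le> 5 * p * \<theta>\<^sup>2 * ip S x x"
          using gram[of x] by linarith
        then have "(\<Sum>j\<in>S'. (ip S (w j) x)\<^sup>2) \<le> p * (5 * p * \<theta>\<^sup>2 * ip S x x)"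
          unfolding sum_sample[OF finT S'] using p01 by (intro mult_left_mono) auto
        also have "\<dots> \<le> (3 * p * \<theta>)\<^sup>2 * ip S x x"
        proof -
          have "0 \<le> p * p * \<theta>\<^sup>2 * ip S x x" using p01 by simp
          moreover have "p * (5 * p * \<theta>\<^sup>2 * ip S x x) = 5 * (p * p * \<theta>\<^sup>2 * ip S x x)" by simp
          moreover have "(3 * p * \<theta>)\<^sup>2 * ip S x x = 9 * (p * p * \<theta>\<^sup>2 * ip S x x)"
            by (simp add: power2_eq_square)
          ultimately show ?thesis by linarith
        qed
        finally have le: "ip S' (\<lambda>j. ip S (w j) x) (\<lambda>j. ip S (w j) x) \<le> (3 * p * \<theta>)\<^sup>2 * ip S x x"
          by (simp add: ip_def[of S'] power2_eq_square)
        have "(\<Sum>i\<in>S. \<Sum>j\<in>S'. low i j * x i * y j) = (\<Sum>j\<in>S'. (\<Sum>i\<in>S. x i * low i j) * y j)"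
          by (subst sum.swap) (simp add: sum_distrib_left mult_ac)
        also have "\<dots> = ip S' (\<lambda>j. ip S (w j) x) y"
          unfolding ip_def[of S'] w_ip using bad by simp
        finally have "\<bar>\<Sum>i\<in>S. \<Sum>j\<in>S'. low i j * x i * y j\<bar>
            \<le> sqrt (ip S' (\<lambda>j. ip S (w j) x) (\<lambda>j. ip S (w j) x)) * sqrt (ip S' y y)"
          using ip_cauchy_schwarz_sqrt by simp
        also have "\<dots> \<le> sqrt ((3 * p * \<theta>)\<^sup>2 * ip S x x) * sqrt (ip S' y y)"
          using le by (intro mult_right_mono) auto
        also have "\<dots> = 3 * p * \<theta> * (sqrt (ip S x x) * sqrt (ip S' y y))"
          using p01 \<theta>0 by (simp add: real_sqrt_mult)
        finally show ?thesis .
      qed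
      then show False using bad by (simp add: cross_ok_def)
    qed
  qed (use p01 in auto)
  also have "\<dots> \<le> (1 / 16) ^ Q * (3 * s * n / (2 * p * \<theta>\<^sup>2))"
  proof (rule B.bernstein)
    have "80 * (real Q * (p * n)) = p * (80 * (real Q * n))" by simp
    then have s80: "80 * (real Q * s) = p * (p * \<theta>\<^sup>2)" unfolding Qn pn .
    have Qs: "0 \<le> real Q * s" using s1 by simp
    show "real Q * (3 * s) \<le> p * (2 * p * \<theta>\<^sup>2)" using s80 Qs by (simp add: mult.assoc mult.left_commute)
    have "5 * 16 * (2 * p * \<theta>\<^sup>2) * (real Q * (3 * s)) = 6 * (p * \<theta>\<^sup>2) * (80 * (real Q * s))" by simp
    also have "\<dots> = 6 * (p * (p * \<theta>\<^sup>2)\<^sup>2)" unfolding s80 by (simp add: power2_eq_square)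
    also have "\<dots> \<le> 9 * (p * (p * \<theta>\<^sup>2)\<^sup>2)" using p01 by simp
    also have "\<dots> = p * (3 * p * \<theta>\<^sup>2)\<^sup>2" by (simp add: power2_eq_square)
    finally show "5 * 16 * (2 * p * \<theta>\<^sup>2) * (real Q * (3 * s)) \<le> p * (3 * p * \<theta>\<^sup>2)\<^sup>2" .
  qed (use Q1 \<theta>0 p01 in auto)
  also have "3 * s * n / (2 * p * \<theta>\<^sup>2) = 3 * (p * n) * n / (2 * p * \<theta>\<^sup>2)" unfolding pn ..
  also have "\<dots> = 3 / 2 / e\<^sup>2"
    unfolding \<theta>_def using n0 p01 e0 by (simp add: power2_eq_square field_simps)
  finally show ?thesis .
qed

text \<open>For a column outside \<open>T\<close>, being long is decided by the row sample and
  independent of the column's own coin. The expected number of long columns that are sampled is thus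
  at most n p 16^(-Q) = s 16^(-Q), where a union bound over all columns would give n
  16^(-Q).\<close>

lemma decoupled_event:
  assumes T: "T \<subseteq> I"
  shows "samp_prob p I (\<lambda>S. \<not> cross_ok (S \<inter> T) (S - T)) \<le> (1 / 16) ^ Q * (2 * s)"
proof -
  have fin: "finite T" "finite (I - T)" using T finI finite_subset by blast+
  let ?r = "(1 / 16 :: real) ^ Q"
  have I: "I = T \<union> (I - T)" using T by auto
  have "samp_prob p I (\<lambda>S. \<not> cross_ok (S \<inter> T) (S - T))
      = samp_exp p T (\<lambda>S. samp_exp p (I - T) (\<lambda>S'. of_bool (\<not> cross_ok ((S \<union> S') \<inter> T) ((S \<union> S') - T))))"
    unfolding samp_prob_def by (subst I, rule samp_exp_Un) (use fin in auto)
  also have "\<dots> = samp_exp p T (\<lambda>S. samp_prob p (I - T) (\<lambda>S'. \<not> cross_ok S S'))"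
    unfolding samp_prob_def
  proof (intro samp_exp_cong)
    fix S S' assume "S \<subseteq> T" "S' \<subseteq> I - T"
    then have "(S \<union> S') \<inter> T = S" "(S \<union> S') - T = S'" by auto
    then show "of_bool (\<not> cross_ok ((S \<union> S') \<inter> T) ((S \<union> S') - T)) = (of_bool (\<not> cross_ok S S') :: real)" by simp
  qed
  also have "\<dots> \<le> samp_exp p T (\<lambda>S. of_bool (\<not> rows_ok S) + ((\<Sum>j\<in>I - T. p * of_bool (\<not> col_ok S j)) + ?r * (3 / 2 / e\<^sup>2)))"
  proof (rule samp_exp_mono)
    fix S assume S: "S \<subseteq> T"
    show "samp_prob p (I - T) (\<lambda>S'. \<not> cross_ok S S')
       \<le> of_bool (\<not> rows_ok S) + ((\<Sum>j\<in>I - T. p * of_bool (\<not> col_ok S j)) + ?r * (3 / 2 / e\<^sup>2))"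
    proof (cases "rows_ok S")
      case False
      have "samp_prob p (I - T) (\<lambda>S'. \<not> cross_ok S S') \<le> samp_exp p (I - T) (\<lambda>_. 1)"
        unfolding samp_prob_def using p01 by (intro samp_exp_mono) auto
      also have "\<dots> = 1" by (rule samp_exp_const[OF fin(2)])
      also have "1 \<le> of_bool (\<not> rows_ok S) + ((\<Sum>j\<in>I - T. p * of_bool (\<not> col_ok S j)) + ?r * (3 / 2 / e\<^sup>2))"
        using False p01 by (simp add: sum_nonneg)
      finally show ?thesis .
    next
      case True
      have "samp_prob p (I - T) (\<lambda>S'. \<not> cross_ok S S')
         \<le> samp_prob p (I - T) (\<lambda>S'. (\<exists>j\<in>I - T. j \<in> S' \<and> \<not> col_ok S j) \<or> (\<not> cross_ok S S' \<and> (\<forall>j\<in>S'. col_ok S j)))"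
        using p01 by (intro samp_prob_mono) auto
      also have "\<dots> \<le> samp_prob p (I - T) (\<lambda>S'. \<exists>j\<in>I - T. j \<in> S' \<and> \<not> col_ok S j)
          + samp_prob p (I - T) (\<lambda>S'. \<not> cross_ok S S' \<and> (\<forall>j\<in>S'. col_ok S j))"
        using p01 by (intro samp_prob_disj) auto
      also have "samp_prob p (I - T) (\<lambda>S'. \<exists>j\<in>I - T. j \<in> S' \<and> \<not> col_ok S j)
          \<le> (\<Sum>j\<in>I - T. samp_prob p (I - T) (\<lambda>S'. j \<in> S' \<and> \<not> col_ok S j))"
        using p01 fin by (intro samp_prob_Bex) auto
      also have "\<dots> = (\<Sum>j\<in>I - T. p * of_bool (\<not> col_ok S j))"
      proof (rule sum.cong[OF refl])
        fix j assume j: "j \<in> I - T"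
        show "samp_prob p (I - T) (\<lambda>S'. j \<in> S' \<and> \<not> col_ok S j) = p * of_bool (\<not> col_ok S j)"
          using samp_prob_mem[OF fin(2) j, of p]
          by (cases "col_ok S j") (simp_all add: samp_prob_def samp_exp_const fin)
      qed
      also have "samp_prob p (I - T) (\<lambda>S'. \<not> cross_ok S S' \<and> (\<forall>j\<in>S'. col_ok S j)) \<le> ?r * (3 / 2 / e\<^sup>2)"
        by (rule cross_event[OF T S True])
      finally show ?thesis using True by simp
    qed
  qed (use p01 in auto)
  also have "\<dots> = samp_prob p T (\<lambda>S. \<not> rows_ok S) + ((\<Sum>j\<in>I - T. p * samp_prob p T (\<lambda>S. \<not> col_ok S j)) + ?r * (3 / 2 / e\<^sup>2))"
    unfolding samp_exp_add samp_exp_sum samp_exp_scale samp_prob_def samp_exp_const[OF fin(1)] ..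
  also have "\<dots> \<le> ?r * (1 / e\<^sup>2) + ((\<Sum>j\<in>I - T. p * ?r) + ?r * (3 / 2 / e\<^sup>2))"
    using p01 T by (intro add_mono sum_mono mult_left_mono rows_event col_event order.refl) auto
  also have "\<dots> \<le> ?r * (1 / e\<^sup>2) + ((\<Sum>j\<in>I. p * ?r) + ?r * (3 / 2 / e\<^sup>2))"
    using p01 finI by (intro add_mono sum_mono2 order.refl) auto
  also have "\<dots> = ?r * (5 / 2 * (1 / e\<^sup>2) + s)"
    using pn by (simp add: n algebra_simps)
  also have "\<dots> \<le> ?r * (2 * s)"
    using e_inv s1 by (intro mult_left_mono) auto
  finally show ?thesis .
qed

end

section \<open>Decoupling by averaging over splittings\<close>

lemma card_separating:
  assumes "finite I" "i \<in> I" "j \<in> I"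
  shows "4 * real (card {T\<in>Pow I. i \<in> T \<and> j \<notin> T}) = (if i = j then 0 else 2 ^ card I)"
proof (cases "i = j")
  case False
  have "{T\<in>Pow I. i \<in> T \<and> j \<notin> T} = insert i ` Pow (I - {i, j})"
  proof (intro equalityI subsetI)
    fix T assume T: "T \<in> {T\<in>Pow I. i \<in> T \<and> j \<notin> T}"
    then have "T = insert i (T - {i})" "T - {i} \<in> Pow (I - {i, j})" by auto
    then show "T \<in> insert i ` Pow (I - {i, j})" by blast
  qed (use assms False in auto)
  moreover have "inj_on (insert i) (Pow (I - {i, j}))" by (auto simp: inj_on_def)
  ultimately have "card {T\<in>Pow I. i \<in> T \<and> j \<notin> T} = 2 ^ card (I - {i, j})"
    using assms(1) by (simp add: card_image card_Pow)
  moreover have "card I = card (I - {i, j}) + 2"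
    using assms False card_Diff_subset[of "{i, j}" I] card_mono[of I "{i, j}"] by simp
  ultimately show ?thesis using False by (simp add: power_add)
qed auto

text \<open>An ordered pair of distinct indices is separated, i inside and j outside, by exactly a
  quarter of all subsets \<open>T\<close>, and a diagonal pair by none. Hence the factor 4 and the
  vanishing diagonal.\<close>

lemma decoupled_sum:
  fixes f :: "'a \<Rightarrow> 'a \<Rightarrow> real"
  assumes "finite I" "S \<subseteq> I"
  shows "4 * (\<Sum>T\<in>Pow I. \<Sum>i\<in>S \<inter> T. \<Sum>j\<in>S - T. f i j)
    = 2 ^ card I * (\<Sum>i\<in>S. \<Sum>j\<in>S. if i = j then 0 else f i j)"
proof -
  have finS: "finite S" using assms finite_subset by blast
  have "(\<Sum>T\<in>Pow I. \<Sum>i\<in>S \<inter> T. \<Sum>j\<in>S - T. f i j)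
      = (\<Sum>T\<in>Pow I. \<Sum>i\<in>S. \<Sum>j\<in>S. of_bool (i \<in> T \<and> j \<notin> T) * f i j)"
  proof (rule sum.cong[OF refl])
    fix T
    have "(\<Sum>i\<in>S \<inter> T. \<Sum>j\<in>S - T. f i j) = (\<Sum>i\<in>S. of_bool (i \<in> S \<inter> T) * (\<Sum>j\<in>S. of_bool (j \<in> S - T) * f i j))"
      using finS by (simp only: sum_indicator_subset Int_lower1 Diff_subset)
    also have "\<dots> = (\<Sum>i\<in>S. \<Sum>j\<in>S. of_bool (i \<in> T \<and> j \<notin> T) * f i j)"
      unfolding sum_distrib_left by (intro sum.cong refl) auto
    finally show "(\<Sum>i\<in>S \<inter> T. \<Sum>j\<in>S - T. f i j) = (\<Sum>i\<in>S. \<Sum>j\<in>S. of_bool (i \<in> T \<and> j \<notin> T) * f i j)" .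
  qed
  also have "\<dots> = (\<Sum>i\<in>S. \<Sum>T\<in>Pow I. \<Sum>j\<in>S. of_bool (i \<in> T \<and> j \<notin> T) * f i j)" by (rule sum.swap)
  also have "\<dots> = (\<Sum>i\<in>S. \<Sum>j\<in>S. \<Sum>T\<in>Pow I. of_bool (i \<in> T \<and> j \<notin> T) * f i j)"
    by (rule sum.cong[OF refl], rule sum.swap)
  also have "\<dots> = (\<Sum>i\<in>S. \<Sum>j\<in>S. real (card {T\<in>Pow I. i \<in> T \<and> j \<notin> T}) * f i j)"
  proof (intro sum.cong refl)
    fix i j
    have "(\<Sum>T\<in>Pow I. of_bool (i \<in> T \<and> j \<notin> T)) = real (card {T\<in>Pow I. i \<in> T \<and> j \<notin> T})"
      using assms(1) by (subst sum_of_bool_eq) (auto simp: Int_def)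
    then show "(\<Sum>T\<in>Pow I. of_bool (i \<in> T \<and> j \<notin> T) * f i j) = real (card {T\<in>Pow I. i \<in> T \<and> j \<notin> T}) * f i j"
      by (simp only: sum_distrib_right[symmetric])
  qed
  finally have "4 * (\<Sum>T\<in>Pow I. \<Sum>i\<in>S \<inter> T. \<Sum>j\<in>S - T. f i j)
      = (\<Sum>i\<in>S. \<Sum>j\<in>S. (4 * real (card {T\<in>Pow I. i \<in> T \<and> j \<notin> T})) * f i j)"
    by (simp add: sum_distrib_left mult.assoc)
  also have "\<dots> = (\<Sum>i\<in>S. \<Sum>j\<in>S. 2 ^ card I * (if i = j then 0 else f i j))"
  proof (intro sum.cong refl)
    fix i j assume "i \<in> S" "j \<in> S"
    then have "i \<in> I" "j \<in> I" using assms(2) by auto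
    then show "(4 * real (card {T\<in>Pow I. i \<in> T \<and> j \<notin> T})) * f i j = 2 ^ card I * (if i = j then 0 else f i j)"
      unfolding card_separating[OF assms(1) \<open>i \<in> I\<close> \<open>j \<in> I\<close>] by simp
  qed
  finally show ?thesis by (simp add: sum_distrib_left)
qed

text \<open>A unit vector attains the same \<open>N\<close> that bounds all bilinear forms. This
  lets \<open>tail_bound\<close> estimate N by decoupling at one vector and then absorb a multiple
  of N.\<close>

lemma spectral_norm_attained:
  assumes fin: "finite J" "J \<noteq> {}" and sym: "\<And>i k. i \<in> J \<Longrightarrow> k \<in> J \<Longrightarrow> a i k = a k i"
  shows "\<exists>N x. ip J x x = 1 \<and> \<bar>\<Sum>i\<in>J. \<Sum>k\<in>J. a i k * x i * x k\<bar> = N \<and>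
    (\<forall>x y. \<bar>\<Sum>i\<in>J. \<Sum>k\<in>J. a i k * x i * y k\<bar> \<le> N * (sqrt (ip J x x) * sqrt (ip J y y)))"
proof -
  obtain lam u where sp: "spectral J a lam u" using spectral_exists[of J a, OF fin(1) sym] by blast
  then have onb: "onb J u" by (simp add: spectral_def)
  define N where "N = Max ((\<lambda>l. \<bar>lam l\<bar>) ` J)"
  have "N \<in> (\<lambda>l. \<bar>lam l\<bar>) ` J" unfolding N_def using fin by (intro Max_in) auto
  then obtain l where l: "l \<in> J" "N = \<bar>lam l\<bar>" by auto
  have le: "\<bar>lam k\<bar> \<le> N" if "k \<in> J" for k unfolding N_def using that fin by auto
  have "(\<Sum>i\<in>J. \<Sum>k\<in>J. a i k * u l i * u l k) = (\<Sum>m\<in>J. lam m * (if m = l then 1 else 0))"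
    unfolding spectral_bilinear[OF fin(1) sp] by (intro sum.cong refl) (simp add: onb_ip[OF onb] l)
  then have "\<bar>\<Sum>i\<in>J. \<Sum>k\<in>J. a i k * u l i * u l k\<bar> = N"
    using sum_delta_real(3)[OF fin(1) l(1)] l by simp
  moreover have "ip J (u l) (u l) = 1" using onb_ip[OF onb l(1) l(1)] by simp
  moreover have "\<forall>x y. \<bar>\<Sum>i\<in>J. \<Sum>k\<in>J. a i k * x i * y k\<bar> \<le> N * (sqrt (ip J x x) * sqrt (ip J y y))"
    using spectral_bilinear_le[OF fin(1) sp le] l by auto
  ultimately show ?thesis by blast
qed

context sampling_setup
begin

text \<open>Decoupling: a quadratic form with zero diagonal is four times the average of its off-diagonal
  blocks over all splittings \<open>T\<close>. The few bad splittings cost at most a fixed fraction of the norm of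
  the form itself, which is then absorbed.\<close>
lemma tail_bound:
  assumes S: "S \<subseteq> I" and few: "real (card {T\<in>Pow I. \<not> cross_ok (S \<inter> T) (S - T)}) < 2 ^ card I / 8"
  shows "\<bar>\<Sum>i\<in>S. \<Sum>k\<in>S. low i k * x i * x k\<bar> \<le> 9 * p * \<theta> * ip S x x"
proof (cases "S = {}")
  case False
  have finS: "finite S" using S finI finite_subset by blast
  define b where "b i k = (if i = k then 0 else low i k)" for i k
  have bsym: "b i k = b k i" for i k by (simp add: b_def low_sym)
  obtain N z where z: "ip S z z = 1" "\<bar>\<Sum>i\<in>S. \<Sum>k\<in>S. b i k * z i * z k\<bar> = N"
    and N: "\<And>x y. \<bar>\<Sum>i\<in>S. \<Sum>k\<in>S. b i k * x i * y k\<bar> \<le> N * (sqrt (ip S x x) * sqrt (ip S y y))"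
    using spectral_norm_attained[OF finS False, of b] bsym by blast
  have N0: "0 \<le> N" using z(2) by auto
  define f where "f T = (\<Sum>i\<in>S \<inter> T. \<Sum>j\<in>S - T. low i j * z i * z j)" for T
  let ?B = "{T\<in>Pow I. \<not> cross_ok (S \<inter> T) (S - T)}"
  \<comment> \<open>AM-GM, as the squared norms of the two pieces of \<open>z\<close> add up to
    1.\<close>
  have half: "sqrt (ip (S \<inter> T) z z) * sqrt (ip (S - T) z z) \<le> 1 / 2" for T
  proof -
    have S': "S = (S \<inter> T) \<union> (S - T)" by auto
    have "ip S z z = ip (S \<inter> T) z z + ip (S - T) z z"
      unfolding ip_def by (subst (1) S', rule sum.union_disjoint) (use finS in auto)
    moreover have "0 \<le> (sqrt (ip (S \<inter> T) z z) - sqrt (ip (S - T) z z))\<^sup>2" by simp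
    ultimately show ?thesis using z(1) by (simp add: power2_diff)
  qed
  \<comment> \<open>The fallback for bad splittings: zero padding exhibits the block as a value of
    the whole form at the two pieces of \<open>z\<close>, so its norm \<open>N\<close>
    applies.\<close>
  have all: "\<bar>f T\<bar> \<le> N / 2" for T
  proof -
    let ?x = "\<lambda>i. if i \<in> S \<inter> T then z i else 0" and ?y = "\<lambda>i. if i \<in> S - T then z i else 0"
    have "f T = (\<Sum>i\<in>S. of_bool (i \<in> S \<inter> T) * (\<Sum>j\<in>S. of_bool (j \<in> S - T) * (low i j * z i * z j)))"
      unfolding f_def using finS by (simp only: sum_indicator_subset Int_lower1 Diff_subset)
    also have "\<dots> = (\<Sum>i\<in>S. \<Sum>k\<in>S. b i k * ?x i * ?y k)"
      unfolding sum_distrib_left by (intro sum.cong refl) (auto simp: b_def)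
    finally have fT: "f T = (\<Sum>i\<in>S. \<Sum>k\<in>S. b i k * ?x i * ?y k)" .
    have "\<bar>f T\<bar> \<le> N * (sqrt (ip S ?x ?x) * sqrt (ip S ?y ?y))" unfolding fT by (rule N)
    also have "ip S ?x ?x = ip (S \<inter> T) z z"
      unfolding ip_self_subset_indicator[OF finS Int_lower1] by (simp add: ip_def power2_eq_square)
    also have "ip S ?y ?y = ip (S - T) z z"
      unfolding ip_self_subset_indicator[OF finS Diff_subset] by (simp add: ip_def power2_eq_square)
    also have "N * (sqrt (ip (S \<inter> T) z z) * sqrt (ip (S - T) z z)) \<le> N * (1 / 2)"
      using half[of T] N0 by (intro mult_left_mono) auto
    finally show ?thesis by simp
  qed
  have pt: "0 \<le> 3 * p * \<theta>" using p01 \<theta>0 by simp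
  have bound: "\<bar>f T\<bar> \<le> 3 / 2 * p * \<theta> + of_bool (T \<in> ?B) * (N / 2)" if T: "T \<in> Pow I" for T
  proof (cases "T \<in> ?B")
    case True
    then have "of_bool (T \<in> ?B) * (N / 2) = N / 2" by simp
    then show ?thesis using all[of T] pt by linarith
  next
    case False
    then have "cross_ok (S \<inter> T) (S - T)" using T by simp
    then have "\<bar>f T\<bar> \<le> 3 * p * \<theta> * (sqrt (ip (S \<inter> T) z z) * sqrt (ip (S - T) z z))"
      unfolding cross_ok_def f_def by blast
    also have "\<dots> \<le> 3 * p * \<theta> * (1 / 2)" using half[of T] pt by (intro mult_left_mono) auto
    finally have "\<bar>f T\<bar> \<le> 3 / 2 * p * \<theta>" by simp
    moreover have "of_bool (T \<in> ?B) * (N / 2) = 0" using False by (simp only: of_bool_eq mult_zero_left)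
    ultimately show ?thesis by linarith
  qed
  have "2 ^ card I * N = \<bar>2 ^ card I * (\<Sum>i\<in>S. \<Sum>k\<in>S. b i k * z i * z k)\<bar>"
    by (simp add: z(2) abs_mult)
  also have "(\<Sum>i\<in>S. \<Sum>k\<in>S. b i k * z i * z k) = (\<Sum>i\<in>S. \<Sum>k\<in>S. if i = k then 0 else low i k * z i * z k)"
    by (intro sum.cong refl) (simp add: b_def)
  also have "2 ^ card I * \<dots> = 4 * (\<Sum>T\<in>Pow I. f T)"
    unfolding f_def by (rule decoupled_sum[OF finI S, symmetric])
  also have "\<bar>4 * (\<Sum>T\<in>Pow I. f T)\<bar> \<le> 4 * (\<Sum>T\<in>Pow I. \<bar>f T\<bar>)" by (simp add: abs_mult)
  also have "\<dots> \<le> 4 * (\<Sum>T\<in>Pow I. 3 / 2 * p * \<theta> + of_bool (T \<in> ?B) * (N / 2))"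
    by (intro mult_left_mono sum_mono bound) auto
  also have "(\<Sum>T\<in>Pow I. 3 / 2 * p * \<theta> + of_bool (T \<in> ?B) * (N / 2))
      = 2 ^ card I * (3 / 2 * p * \<theta>) + real (card ?B) * (N / 2)"
  proof -
    have BP: "?B \<subseteq> Pow I" and finP: "finite (Pow I)" using finI by auto
    show ?thesis
      unfolding sum.distrib sum_indicator_subset[OF finP BP] using finI by (simp add: card_Pow)
  qed
  also have "\<dots> \<le> 2 ^ card I * (3 / 2 * p * \<theta>) + (2 ^ card I / 8) * (N / 2)"
    using few N0 by (intro add_left_mono mult_right_mono) auto
  also have "4 * \<dots> = 2 ^ card I * (6 * p * \<theta> + N / 4)" by (simp add: algebra_simps)
  \<comment> \<open>Bad splittings are at most an eighth of all and cost N / 2 each, which the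
    factor 4 turns into N / 4.\<close>
  finally have "N \<le> 6 * p * \<theta> + N / 4" by simp
  then have N8: "N \<le> 8 * p * \<theta>" by simp
  \<comment> \<open>Decoupling does not see the diagonal, but its entries are at most 2 / e, which
    is below p \<theta> = s e because e^2 s \<ge> 80.\<close>
  have diag: "\<bar>\<Sum>i\<in>S. low i i * x i * x i\<bar> \<le> p * \<theta> * ip S x x"
  proof -
    have "p * \<theta> = s * e" using n0 by (simp add: p_def \<theta>_def)
    also have "\<dots> = e\<^sup>2 * s * (1 / e)" using e0 by (simp add: power2_eq_square)
    also have "\<dots> \<ge> 2 * (1 / e)" unfolding es using Q1 e0 by (intro mult_right_mono) auto
    finally have 2: "2 / e \<le> p * \<theta>" by simp
    have "\<bar>\<Sum>i\<in>S. low i i * x i * x i\<bar> \<le> (\<Sum>i\<in>S. \<bar>low i i * x i * x i\<bar>)" by (rule sum_abs)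
    also have "\<dots> \<le> (\<Sum>i\<in>S. p * \<theta> * (x i * x i))"
    proof (rule sum_mono)
      fix i assume "i \<in> S"
      then have "\<bar>low i i\<bar> \<le> p * \<theta>" using low_bounded[of i i] S 2 by auto
      then have "\<bar>low i i\<bar> * (x i * x i) \<le> p * \<theta> * (x i * x i)" by (intro mult_right_mono) auto
      then show "\<bar>low i i * x i * x i\<bar> \<le> p * \<theta> * (x i * x i)" by (simp add: abs_mult mult.assoc)
    qed
    finally show ?thesis by (simp add: ip_def sum_distrib_left)
  qed
  have "(\<Sum>i\<in>S. \<Sum>k\<in>S. low i k * x i * x k)
      = (\<Sum>i\<in>S. \<Sum>k\<in>S. b i k * x i * x k + (if i = k then 1 else 0) * (low i k * x i * x k))"
    by (intro sum.cong refl) (simp add: b_def)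
  also have "\<dots> = (\<Sum>i\<in>S. \<Sum>k\<in>S. b i k * x i * x k) + (\<Sum>i\<in>S. low i i * x i * x i)"
    unfolding sum.distrib by (intro arg_cong2[where f = "(+)"] refl sum.cong) (simp add: sum_delta_real(2)[OF finS])
  finally have split: "(\<Sum>i\<in>S. \<Sum>k\<in>S. low i k * x i * x k) = \<dots>" .
  have "\<bar>\<Sum>i\<in>S. \<Sum>k\<in>S. b i k * x i * x k\<bar> \<le> N * ip S x x" using N[of x x] by simp
  also have "\<dots> \<le> 8 * p * \<theta> * ip S x x" by (intro mult_right_mono N8) auto
  finally show ?thesis unfolding split using diag by linarith
qed (simp add: ip_def)

text \<open>The union bound runs only over the eigenvalues beyond \<theta>, at most 1 / e^2 \<le> s
  / 80 of them. The exponentially many splittings admit no union bound; Markov's inequality for the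
  number of bad ones suffices, as \<open>tail_bound\<close> tolerates any share below an
  eighth.\<close>

lemma good_sample_prob:
  assumes Qs: "s \<le> 2 ^ Q"
  shows "samp_prob p I (\<lambda>S. \<not> good_sample I S lam u p \<theta>) \<le> 17 / s\<^sup>2"
proof -
  let ?r = "(1 / 16 :: real) ^ Q"
  let ?K = "\<lambda>j. {l\<in>I. \<bar>lam j\<bar> / 2 \<le> \<bar>lam l\<bar>}"
  let ?w = "\<lambda>j i l. sqrt (min \<bar>lam l\<bar> \<bar>lam j\<bar>) * u l i"
  define E1 where "E1 j S \<longleftrightarrow> \<not> coin_bounded p I (?K j) (\<lambda>i l. u l i) S (2 * \<theta> / \<bar>lam j\<bar>)" for j S
  define E2 where "E2 j S \<longleftrightarrow> \<not> coin_bounded p I Out (?w j) S (sqrt (\<theta> * \<bar>lam j\<bar>))" for j S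
  define f where "f S = (\<Sum>T\<in>Pow I. of_bool (\<not> cross_ok (S \<inter> T) (S - T)) :: real)" for S
  have f_card: "f S = real (card {T\<in>Pow I. \<not> cross_ok (S \<inter> T) (S - T)})" for S
    unfolding f_def using finI by (subst sum_of_bool_eq) (auto simp: Int_def)
  have "samp_prob p I (\<lambda>S. \<not> good_sample I S lam u p \<theta>)
      \<le> samp_prob p I (\<lambda>S. (\<exists>j\<in>Out. E1 j S \<or> E2 j S) \<or> 2 ^ card I / 8 \<le> f S)"
  proof (rule samp_prob_mono)
    fix S assume S: "S \<subseteq> I" and bad: "\<not> good_sample I S lam u p \<theta>"
    show "(\<exists>j\<in>Out. E1 j S \<or> E2 j S) \<or> 2 ^ card I / 8 \<le> f S"
    proof (rule ccontr)
      assume H: "\<not> ?thesis"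
      then have E: "\<not> E1 j S" "\<not> E2 j S" if "j \<in> I" "\<theta> \<le> \<bar>lam j\<bar>" for j using that by auto
      have few: "real (card {T\<in>Pow I. \<not> cross_ok (S \<inter> T) (S - T)}) < 2 ^ card I / 8"
        using H unfolding f_card by linarith
      have "good_sample I S lam u p \<theta>"
      proof
        show "finite I" "S \<subseteq> I" "0 < p" "0 < \<theta>" "onb I u" using finI S p01 \<theta>0 onb by auto
        show "\<bar>\<Sum>i\<in>S. \<Sum>k\<in>S. (\<Sum>l\<in>{l\<in>I. \<bar>lam l\<bar> < \<theta>}. lam l * u l i * u l k) * x i * x k\<bar> \<le> 9 * p * \<theta> * ip S x x" for x
          using tail_bound[OF S few, of x] unfolding low_def .
      qed (use E in \<open>simp_all add: E1_def E2_def\<close>)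
      then show False using bad by blast
    qed
  qed (use p01 in auto)
  also have "\<dots> \<le> samp_prob p I (\<lambda>S. \<exists>j\<in>Out. E1 j S \<or> E2 j S) + samp_prob p I (\<lambda>S. 2 ^ card I / 8 \<le> f S)"
    using p01 by (intro samp_prob_disj) auto
  also have "samp_prob p I (\<lambda>S. \<exists>j\<in>Out. E1 j S \<or> E2 j S) \<le> (\<Sum>j\<in>Out. ?r * (4 / e\<^sup>2) + ?r * (1 / e\<^sup>2))"
  proof -
    have "samp_prob p I (\<lambda>S. \<exists>j\<in>Out. E1 j S \<or> E2 j S) \<le> (\<Sum>j\<in>Out. samp_prob p I (\<lambda>S. E1 j S \<or> E2 j S))"
      using p01 finI by (intro samp_prob_Bex) auto
    also have "\<dots> \<le> (\<Sum>j\<in>Out. ?r * (4 / e\<^sup>2) + ?r * (1 / e\<^sup>2))"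
    proof (rule sum_mono)
      fix j assume j: "j \<in> Out"
      have "samp_prob p I (\<lambda>S. E1 j S \<or> E2 j S) \<le> samp_prob p I (E1 j) + samp_prob p I (E2 j)"
        using p01 by (intro samp_prob_disj) auto
      also have "\<dots> \<le> ?r * (4 / e\<^sup>2) + ?r * (1 / e\<^sup>2)"
      proof (rule add_mono)
        have jO: "j \<in> I" "\<theta> \<le> \<bar>lam j\<bar>" using j by auto
        show "samp_prob p I (E1 j) \<le> ?r * (4 / e\<^sup>2)"
          unfolding E1_def[abs_def] by (rule gram_event[OF jO])
        show "samp_prob p I (E2 j) \<le> ?r * (1 / e\<^sup>2)"
          unfolding E2_def[abs_def] by (rule weighted_gram_event[OF jO])
      qed
      finally show "samp_prob p I (\<lambda>S. E1 j S \<or> E2 j S) \<le> ?r * (4 / e\<^sup>2) + ?r * (1 / e\<^sup>2)" .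
    qed
    finally show ?thesis .
  qed
  also have "(\<Sum>j\<in>Out. ?r * (4 / e\<^sup>2) + ?r * (1 / e\<^sup>2)) = real (card Out) * (?r * (5 * (1 / e\<^sup>2)))"
    by (simp add: algebra_simps add_divide_distrib[symmetric])
  also have "\<dots> \<le> (s / 80) * (?r * (5 * (s / 80)))"
  proof (intro mult_mono mult_left_mono)
    have "real (card Out) \<le> 1 / e\<^sup>2"
      using large_count[OF \<theta>0] n0 by (simp add: \<theta>_def power_mult_distrib)
    then show "real (card Out) \<le> s / 80" using e_inv by linarith
  qed (use e_inv s1 in auto)
  also have "samp_prob p I (\<lambda>S. 2 ^ card I / 8 \<le> f S) \<le> samp_exp p I f / (2 ^ card I / 8)"
    using p01 by (intro samp_prob_markov) (auto simp: f_def sum_nonneg)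
  also have "samp_exp p I f \<le> (\<Sum>T\<in>Pow I. ?r * (2 * s))"
    unfolding f_def[abs_def] samp_exp_sum samp_prob_def[symmetric]
    by (intro sum_mono decoupled_event) auto
  also have "(\<Sum>T\<in>Pow I. ?r * (2 * s)) / (2 ^ card I / 8) = ?r * (16 * s)"
    using finI by (simp add: card_Pow)
  finally have "samp_prob p I (\<lambda>S. \<not> good_sample I S lam u p \<theta>) \<le> ?r * (s * s / 1280 + 16 * s)"
    by (simp add: algebra_simps divide_right_mono)
  also have "\<dots> \<le> (1 / s ^ 4) * (17 * s\<^sup>2)"
  proof (rule mult_mono)
    have "s ^ 4 \<le> (2 ^ Q) ^ 4" using Qs s1 by (intro power_mono) auto
    also have "\<dots> = (16 :: real) ^ Q" by (simp add: power_mult[symmetric] mult.commute[of Q] power_mult)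
    finally have "s ^ 4 \<le> 16 ^ Q" .
    moreover have "0 < s ^ 4" using s1 by simp
    ultimately show "?r \<le> 1 / s ^ 4" unfolding power_one_over by (intro divide_left_mono) auto
    have "s \<le> s * s" using mult_left_mono[OF s1, of s] s1 by simp
    then show "s * s / 1280 + 16 * s \<le> 17 * s\<^sup>2" unfolding power2_eq_square using s1 by linarith
  qed (use s1 in auto)
  also have "\<dots> = 17 / s\<^sup>2" using s1 by (simp add: power2_eq_square power4_eq_xxxx)
  finally show ?thesis .
qed

end

subsection \<open>From spectral decompositions to sorted lists of eigenvalues\<close>

lemma proots_linear_factors:
  "proots (\<Prod>a\<leftarrow>xs. [:- a, 1:]) = mset (xs :: real list)"
proof (induction xs)
  case (Cons x xs)
  have "(\<Prod>a\<leftarrow>xs. [:- a, 1:]) \<noteq> (0 :: real poly)"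
    by (auto simp: prod_list_zero_iff)
  then show ?case using Cons.IH by (simp add: proots_mult del: mult_pCons_left)
qed simp

text \<open>The polynomial fixes its roots with multiplicities, and sorting fixes their order, so
  any factorization into linear factors identifies the list that \<open>THE\<close> selects.\<close>

lemma eigs_eqI:
  assumes "length xs = dim_row A" "char_poly A = (\<Prod>a\<leftarrow>xs. [:- a, 1:])"
  shows "eigs A = rev (sort xs)"
  unfolding eigs_def
proof (rule the_equality)
  have "(\<Prod>a\<leftarrow>rev (sort xs). [:- a, 1:]) = (\<Prod>a\<leftarrow>xs. [:- a, 1:])"
    unfolding prod_mset_prod_list[symmetric] by simp
  then show "sorted (rev (rev (sort xs))) \<and> length (rev (sort xs)) = dim_row A \<and>
      char_poly A = (\<Prod>a\<leftarrow>rev (sort xs). [:- a, 1:])"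
    using assms by simp
next
  fix ys assume ys: "sorted (rev ys) \<and> length ys = dim_row A \<and> char_poly A = (\<Prod>a\<leftarrow>ys. [:- a, 1:])"
  then have "mset ys = mset xs"
    using assms(2) proots_linear_factors by metis
  then have "sort xs = rev ys"
    using ys by (intro properties_for_sort) auto
  then show "ys = rev (sort xs)" by simp
qed

text \<open>\<open>h\<close> enumerates the abstract index set. The enumerated eigenvectors form an
  orthogonal matrix that conjugates \<open>A\<close> to a diagonal one, and similar matrices share
  the characteristic polynomial.\<close>

lemma eigs_spectral:
  assumes A: "A \<in> carrier_mat k k" and h: "bij_betw h {0..<k} J" and sp: "spectral J m lam u"
    and Am: "\<And>r t. r < k \<Longrightarrow> t < k \<Longrightarrow> A $$ (r, t) = m (h r) (h t)"
  shows "eigs A = rev (sort (map (\<lambda>r. lam (h r)) [0..<k]))"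
proof (rule eigs_eqI)
  define P where "P = Matrix.mat k k (\<lambda>(r, l). u (h l) (h r))"
  define Q where "Q = Matrix.mat k k (\<lambda>(l, r). u (h l) (h r))"
  define D where "D = Matrix.mat k k (\<lambda>(r, t). if r = t then lam (h r) else 0)"
  have car: "P \<in> carrier_mat k k" "Q \<in> carrier_mat k k" "D \<in> carrier_mat k k"
    by (auto simp: P_def Q_def D_def)
  have hJ: "h r \<in> J" if "r < k" for r using h that by (auto simp: bij_betw_def)
  have heq: "h r = h t \<longleftrightarrow> r = t" if "r < k" "t < k" for r t
    using h that by (auto simp: bij_betw_def inj_on_def)
  have reidx: "(\<Sum>l = 0..<k. g (h l)) = (\<Sum>l\<in>J. g l)" for g :: "_ \<Rightarrow> real"
    by (rule sum.reindex_bij_betw[OF h])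
  have onb: "onb J u" using sp by (simp add: spectral_def)
  have PQ: "P * Q = 1\<^sub>m k"
  proof (rule eq_matI)
    fix r t assume rt: "r < dim_row (1\<^sub>m k :: real mat)" "t < dim_col (1\<^sub>m k :: real mat)"
    then have "(P * Q) $$ (r, t) = (\<Sum>l = 0..<k. u (h l) (h r) * u (h l) (h t))"
      by (simp add: P_def Q_def scalar_prod_def)
    also have "\<dots> = (\<Sum>l\<in>J. u l (h r) * u l (h t))" by (rule reidx)
    also have "\<dots> = (if h r = h t then 1 else 0)" using onb hJ rt by (simp add: onb_def)
    finally show "(P * Q) $$ (r, t) = 1\<^sub>m k $$ (r, t)" using rt heq by simp
  qed (use car in auto)
  have QP: "Q * P = 1\<^sub>m k"
  proof (rule eq_matI)
    fix r t assume rt: "r < dim_row (1\<^sub>m k :: real mat)" "t < dim_col (1\<^sub>m k :: real mat)"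
    then have "(Q * P) $$ (r, t) = (\<Sum>l = 0..<k. u (h r) (h l) * u (h t) (h l))"
      by (simp add: P_def Q_def scalar_prod_def)
    also have "\<dots> = ip J (u (h r)) (u (h t))" unfolding ip_def by (rule reidx)
    also have "\<dots> = (if h r = h t then 1 else 0)" using onb hJ rt by (simp add: onb_def)
    finally show "(Q * P) $$ (r, t) = 1\<^sub>m k $$ (r, t)" using rt heq by simp
  qed (use car in auto)
  have "A = P * D * Q"
  proof (rule eq_matI)
    fix r t assume rt: "r < dim_row (P * D * Q)" "t < dim_col (P * D * Q)"
    then have rt: "r < k" "t < k" using car by auto
    have PD: "(P * D) $$ (r, l) = u (h l) (h r) * lam (h l)" if "l < k" for l
    proof -
      have "(P * D) $$ (r, l) = (\<Sum>i = 0..<k. u (h i) (h r) * (if i = l then lam (h i) else 0))"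
        using that rt by (simp add: P_def D_def scalar_prod_def)
      also have "\<dots> = (\<Sum>i = 0..<k. (if i = l then 1 else 0) * (u (h i) (h r) * lam (h i)))"
        by (intro sum.cong refl) auto
      also have "\<dots> = u (h l) (h r) * lam (h l)"
        by (rule sum_delta_real(1)) (use that in auto)
      finally show ?thesis .
    qed
    have "(P * D * Q) $$ (r, t) = (\<Sum>l = 0..<k. (P * D) $$ (r, l) * Q $$ (l, t))"
      using rt car by (subst index_mult_mat(1)) (auto simp: scalar_prod_def intro!: sum.cong)
    also have "\<dots> = (\<Sum>l = 0..<k. lam (h l) * u (h l) (h r) * u (h l) (h t))"
      using rt by (intro sum.cong refl) (simp add: PD Q_def)
    also have "\<dots> = (\<Sum>l\<in>J. lam l * u l (h r) * u l (h t))" by (rule reidx)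
    also have "\<dots> = A $$ (r, t)" using sp Am rt hJ by (simp add: spectral_def)
    finally show "A $$ (r, t) = (P * D * Q) $$ (r, t)" by simp
  qed (use car A in auto)
  then have "similar_mat A D"
    using A car PQ QP unfolding similar_mat_def similar_mat_wit_def Let_def by blast
  then have "char_poly A = char_poly D" by (rule char_poly_similar)
  also have "\<dots> = (\<Prod>a\<leftarrow>diag_mat D. [:- a, 1:])"
    by (rule char_poly_upper_triangular[OF car(3)]) (auto simp: upper_triangular_def D_def)
  also have "diag_mat D = map (\<lambda>r. lam (h r)) [0..<k]"
    by (auto simp: diag_mat_def D_def)
  finally show "char_poly A = (\<Prod>a\<leftarrow>map (\<lambda>r. lam (h r)) [0..<k]. [:- a, 1:])" .
qed (use A in simp)

section \<open>Comparing descending lists through counts\<close>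

lemma length_filter_map_bij:
  assumes h: "bij_betw h {0..<k} J"
  shows "length (filter P (map (\<lambda>r. f (h r)) [0..<k])) = card {l\<in>J. P (f l)}"
proof -
  have "length (filter P (map (\<lambda>r. f (h r)) [0..<k])) = card {r\<in>{0..<k}. P (f (h r))}"
    by (simp add: length_filter_conv_card cong: conj_cong)
  also have "\<dots> = card (h ` {r\<in>{0..<k}. P (f (h r))})"
    using h by (intro card_image[symmetric]) (auto simp: bij_betw_def inj_on_def)
  also have "h ` {r\<in>{0..<k}. P (f (h r))} = {l\<in>J. P (f l)}"
    using h by (auto simp: bij_betw_def)
  finally show ?thesis .
qed

lemma length_filter_rev_sort: "length (filter P (rev (sort xs))) = length (filter P xs)"
proof -
  have "mset (filter P (rev (sort xs))) = mset (filter P xs)" by simp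
  then show ?thesis by (rule mset_eq_length)
qed

text \<open>In a descending list the entries above c form an initial segment, so its length locates
  position i relative to c.\<close>

lemma descending_filter_greater:
  fixes xs :: "real list"
  assumes "sorted (rev xs)" "i < length xs"
  shows "c < xs ! i \<Longrightarrow> Suc i \<le> length (filter (\<lambda>x. x > c) xs)"
    and "xs ! i \<le> c \<Longrightarrow> length (filter (\<lambda>x. x > c) xs) \<le> i"
proof -
  note mono = sorted_rev_nth_mono[OF assms(1)]
  show "Suc i \<le> length (filter (\<lambda>x. x > c) xs)" if "c < xs ! i"
  proof -
    have "{..i} \<subseteq> {j. j < length xs \<and> xs ! j > c}"
      using mono[of _ i] that assms(2) by (auto intro: less_le_trans)
    then have "card {..i} \<le> card {j. j < length xs \<and> xs ! j > c}" by (intro card_mono) auto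
    then show ?thesis by (simp add: length_filter_conv_card)
  qed
  show "length (filter (\<lambda>x. x > c) xs) \<le> i" if "xs ! i \<le> c"
  proof -
    have "{j. j < length xs \<and> xs ! j > c} \<subseteq> {..<i}"
    proof
      fix j assume "j \<in> {j. j < length xs \<and> xs ! j > c}"
      then show "j \<in> {..<i}" using mono[of i j] that by (cases "i \<le> j") auto
    qed
    then have "card {j. j < length xs \<and> xs ! j > c} \<le> card {..<i}" by (intro card_mono) auto
    then show ?thesis by (simp add: length_filter_conv_card)
  qed
qed

lemma descending_filter_less:
  fixes xs :: "real list"
  assumes "sorted (rev xs)" "i < length xs"
  shows "xs ! i < c \<Longrightarrow> length xs - i \<le> length (filter (\<lambda>x. x < c) xs)"
    and "c \<le> xs ! i \<Longrightarrow> length (filter (\<lambda>x. x < c) xs) < length xs - i"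
proof -
  note mono = sorted_rev_nth_mono[OF assms(1)]
  show "length xs - i \<le> length (filter (\<lambda>x. x < c) xs)" if "xs ! i < c"
  proof -
    have "{i..<length xs} \<subseteq> {j. j < length xs \<and> xs ! j < c}"
    proof
      fix j assume "j \<in> {i..<length xs}"
      then show "j \<in> {j. j < length xs \<and> xs ! j < c}" using mono[of i j] that by auto
    qed
    then have "card {i..<length xs} \<le> card {j. j < length xs \<and> xs ! j < c}" by (intro card_mono) auto
    then show ?thesis by (simp add: length_filter_conv_card)
  qed
  show "length (filter (\<lambda>x. x < c) xs) < length xs - i" if "c \<le> xs ! i"
  proof -
    have "{j. j < length xs \<and> xs ! j < c} \<subseteq> {Suc i..<length xs}"
    proof
      fix j assume "j \<in> {j. j < length xs \<and> xs ! j < c}"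
      then show "j \<in> {Suc i..<length xs}" using mono[of j i] that assms(2) by (cases "j \<le> i") auto
    qed
    then have "card {j. j < length xs \<and> xs ! j < c} \<le> card {Suc i..<length xs}" by (intro card_mono) auto
    then show ?thesis using assms(2) by (simp add: length_filter_conv_card)
  qed
qed

text \<open>Counts are compared only beyond positive or below negative thresholds, since the zeros
  padded by the algorithm spoil counts that include 0. If ys ! i \<ge> -\<alpha>, a violation makes
  xs ! i exceed \<alpha> and the positive counts decide; otherwise the negative ones do. The factor
  2 is the price of this distinction.\<close>

lemma descending_counts_le:
  fixes xs ys :: "real list"
  assumes xs: "sorted (rev xs)" and ys: "sorted (rev ys)" and len: "length xs = length ys" "i < length ys"
    and \<alpha>: "\<alpha> > 0"
    and pos: "\<And>t. t > 0 \<Longrightarrow> length (filter (\<lambda>x. x > t + \<alpha>) xs) \<le> length (filter (\<lambda>y. y > t) ys)"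
    and neg: "\<And>t. t > 0 \<Longrightarrow> length (filter (\<lambda>y. y < - t - \<alpha>) ys) \<le> length (filter (\<lambda>x. x < - t) xs)"
  shows "xs ! i \<le> ys ! i + 2 * \<alpha>"
proof (rule ccontr)
  assume "\<not> ?thesis"
  then have gt: "xs ! i > ys ! i + 2 * \<alpha>" by simp
  show False
  proof (cases "ys ! i \<ge> - \<alpha>")
    case True
    define m where "m = max (ys ! i) 0"
    \<comment> \<open>The midpoint of a nonempty interval that starts at m \<ge> 0, hence strictly
      positive and strictly below xs ! i - \<alpha>.\<close>
    define t where "t = (m + (xs ! i - \<alpha>)) / 2"
    have m: "ys ! i \<le> m" "0 \<le> m" "m + \<alpha> < xs ! i" using gt True \<alpha> by (auto simp: m_def)
    have t: "t > 0" "ys ! i \<le> t" "t + \<alpha> < xs ! i" using m \<alpha> by (simp_all add: t_def field_simps)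
    have "Suc i \<le> length (filter (\<lambda>x. x > t + \<alpha>) xs)"
      using t len by (intro descending_filter_greater(1)[OF xs]) auto
    also have "\<dots> \<le> length (filter (\<lambda>y. y > t) ys)" by (rule pos[OF t(1)])
    also have "\<dots> \<le> i" using t len by (intro descending_filter_greater(2)[OF ys]) auto
    finally show False by simp
  next
    case False
    define m where "m = max (- (xs ! i)) 0"
    define t where "t = (m + (- (ys ! i) - \<alpha>)) / 2"
    have m: "- (xs ! i) \<le> m" "0 \<le> m" "m < - (ys ! i) - \<alpha>" using gt False \<alpha> by (auto simp: m_def)
    have t: "t > 0" "ys ! i < - t - \<alpha>" "- t \<le> xs ! i" using m \<alpha> by (simp_all add: t_def field_simps)
    have "length ys - i \<le> length (filter (\<lambda>y. y < - t - \<alpha>) ys)"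
      using t len by (intro descending_filter_less(1)[OF ys]) auto
    also have "\<dots> \<le> length (filter (\<lambda>x. x < - t) xs)" by (rule neg[OF t(1)])
    also have "\<dots> < length xs - i" using t len by (intro descending_filter_less(2)[OF xs]) auto
    finally show False using len by simp
  qed
qed

section \<open>The output of the algorithm on a good sample\<close>

context good_sample
begin

lemma lower_tail_counts:
  assumes A: "\<And>i k. i \<in> S \<Longrightarrow> k \<in> S \<Longrightarrow> a i k = (\<Sum>l\<in>I. lam l * u l i * u l k)"
    and sp: "spectral S (\<lambda>i k. a i k / p) \<kappa> v" and t: "t > 0"
  shows "card {l\<in>S. \<kappa> l < - t - 20 * \<theta>} \<le> card {l\<in>I. lam l < - t}"
    and "card {l\<in>I. lam l < - t - 20 * \<theta>} \<le> card {l\<in>S. \<kappa> l < - t}"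
proof -
  interpret neg: good_sample I S "\<lambda>l. - lam l" u p \<theta> by (rule negated)
  have A': "- a i k = (\<Sum>l\<in>I. - lam l * u l i * u l k)" if "i \<in> S" "k \<in> S" for i k
    using A[OF that] by (simp add: sum_negf)
  have sp': "spectral S (\<lambda>i k. - a i k / p) (\<lambda>l. - \<kappa> l) v"
    using sp unfolding spectral_def by (simp add: sum_negf)
  have e: "t + 20 * \<theta> < - x \<longleftrightarrow> x < - t - 20 * \<theta>" "t < - x \<longleftrightarrow> x < - t" for x by auto
  show "card {l\<in>S. \<kappa> l < - t - 20 * \<theta>} \<le> card {l\<in>I. lam l < - t}"
    using neg.upper_count[OF A' sp' t] unfolding e .
  show "card {l\<in>I. lam l < - t - 20 * \<theta>} \<le> card {l\<in>S. \<kappa> l < - t}"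
    using neg.lower_count[OF A' sp' t] unfolding e .
qed

end

lemma good_sample_output:
  fixes A :: "real mat"
  assumes A: "A \<in> carrier_mat n n" and sp: "spectral {..<n} (\<lambda>i k. A $$ (i, k)) lam u"
    and good: "good_sample {..<n} {i\<in>{..<n}. b i} lam u p \<theta>"
  shows "additive_approx (algU_output A p b) A (40 * \<theta>)"
proof -
  define S where "S = {i\<in>{..<n}. b i}"
  interpret good_sample "{..<n}" S lam u p \<theta> using good by (simp add: S_def)
  define L where "L = sorted_list_of_set S"
  define k where "k = length L"
  have k: "k = card S" by (simp add: k_def L_def)
  have kn: "k \<le> n" unfolding k using card_mono[of "{..<n}" S] SI by simp
  have h: "bij_betw (\<lambda>r. L ! r) {0..<k} S"
    unfolding k_def L_def using finS by (intro bij_betw_nth) (auto simp: lessThan_atLeast0)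
  have a_eq: "A $$ (i, j) = (\<Sum>l\<in>{..<n}. lam l * u l i * u l j)" if "i \<in> {..<n}" "j \<in> {..<n}" for i j
    using sp that by (simp add: spectral_def)
  have aS: "A $$ (i, j) = (\<Sum>l\<in>{..<n}. lam l * u l i * u l j)" if "i \<in> S" "j \<in> S" for i j
    using a_eq that SI by auto
  have "\<exists>\<kappa> v. spectral S (\<lambda>i j. A $$ (i, j) / p) \<kappa> v"
    by (rule spectral_exists[OF finS]) (simp add: aS mult_ac)
  then obtain \<kappa> v where spS: "spectral S (\<lambda>i j. A $$ (i, j) / p) \<kappa> v" by blast
  define M where "M = Matrix.mat k k (\<lambda>(r, t). A $$ (L ! r, L ! t) / p)"
  have eM: "eigs M = rev (sort (map (\<lambda>r. \<kappa> (L ! r)) [0..<k]))"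
    by (rule eigs_spectral[OF _ h spS]) (auto simp: M_def)
  have h': "bij_betw (\<lambda>r. r) {0..<n} {..<n}" by (auto simp: bij_betw_def)
  have eA: "eigs A = rev (sort (map lam [0..<n]))"
    by (rule eigs_spectral[OF A h' sp]) auto
  define xs where "xs = algU_output A p b"
  have xs: "xs = rev (sort (eigs M @ replicate (n - k) 0))"
    unfolding xs_def algU_output_def Let_def M_def k_def L_def S_def using A by (simp add: lessThan_def)
  have len: "length xs = n" "length (eigs A) = n"
    unfolding xs eM eA using kn by auto
  have srt: "sorted (rev xs)" "sorted (rev (eigs A))" unfolding xs eA by auto
  \<comment> \<open>A predicate that excludes 0 does not see the padding zeros, so filtering the
    output counts sampled eigenvalues only.\<close>
  have cx: "length (filter P xs) = card {l\<in>S. P (\<kappa> l)}" if "\<not> P 0" for P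
    unfolding xs length_filter_rev_sort filter_append eM using that length_filter_map_bij[OF h, of P \<kappa>]
    by (simp add: filter_replicate length_filter_rev_sort)
  have cy: "length (filter P (eigs A)) = card {l\<in>{..<n}. P (lam l)}" for P
    unfolding eA length_filter_rev_sort by (rule length_filter_map_bij[OF h'])
  have upper: "card {l\<in>S. \<kappa> l > t + 20 * \<theta>} \<le> card {l\<in>{..<n}. lam l > t}"
    and lower: "card {l\<in>{..<n}. lam l > t + 20 * \<theta>} \<le> card {l\<in>S. \<kappa> l > t}"
    and tails: "card {l\<in>S. \<kappa> l < - t - 20 * \<theta>} \<le> card {l\<in>{..<n}. lam l < - t}"
      "card {l\<in>{..<n}. lam l < - t - 20 * \<theta>} \<le> card {l\<in>S. \<kappa> l < - t}" if "t > 0" for t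
    by (rule upper_count[OF _ spS that] lower_count[OF _ spS that] lower_tail_counts[OF _ spS that], rule aS, assumption+)+
  have \<alpha>: "20 * \<theta> > 0" using \<theta>0 by simp
  have "\<bar>xs ! i - eigs A ! i\<bar> \<le> 40 * \<theta>" if i: "i < n" for i
  proof -
    have "xs ! i \<le> eigs A ! i + 2 * (20 * \<theta>)"
    proof (rule descending_counts_le[OF srt _ _ \<alpha>])
      fix t :: real assume t: "t > 0"
      show "length (filter (\<lambda>x. x > t + 20 * \<theta>) xs) \<le> length (filter (\<lambda>y. y > t) (eigs A))"
        unfolding cy using t \<theta>0 upper[OF t] by (subst cx) auto
      show "length (filter (\<lambda>y. y < - t - 20 * \<theta>) (eigs A)) \<le> length (filter (\<lambda>x. x < - t) xs)"
        unfolding cy using t tails(2)[OF t] by (subst cx) auto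
    qed (use len i in auto)
    moreover have "eigs A ! i \<le> xs ! i + 2 * (20 * \<theta>)"
    proof (rule descending_counts_le[OF srt(2,1) _ _ \<alpha>])
      fix t :: real assume t: "t > 0"
      show "length (filter (\<lambda>x. x > t + 20 * \<theta>) (eigs A)) \<le> length (filter (\<lambda>y. y > t) xs)"
        unfolding cy using t lower[OF t] by (subst cx) auto
      show "length (filter (\<lambda>y. y < - t - 20 * \<theta>) xs) \<le> length (filter (\<lambda>x. x < - t) (eigs A))"
        unfolding cy using t \<theta>0 tails(1)[OF t] by (subst cx) auto
    qed (use len i in auto)
    ultimately show ?thesis by (simp add: abs_le_iff)
  qed
  then show ?thesis unfolding additive_approx_def xs_def[symmetric] using A len by auto
qed

section \<open>Passage to the product distribution and choice of constants\<close>

lemma prob_Pi_bernoulli: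
  assumes fin: "finite I" and p: "0 \<le> p" "p \<le> 1"
  shows "measure_pmf.prob (Pi_pmf I False (\<lambda>_. bernoulli_pmf p)) {b. P {i\<in>I. b i}} = samp_prob p I P"
proof -
  let ?D = "Pi_pmf I False (\<lambda>_. bernoulli_pmf p)"
  let ?f = "\<lambda>S i. i \<in> S"
  have supp: "set_pmf ?D \<subseteq> ?f ` Pow I"
  proof
    fix b assume "b \<in> set_pmf ?D"
    then have out: "b i = False" if "i \<notin> I" for i
      using set_Pi_pmf_subset[OF fin, of False "\<lambda>_. bernoulli_pmf p"] that by auto
    then have "b = ?f {i\<in>I. b i}" by (auto simp: fun_eq_iff)
    then show "b \<in> ?f ` Pow I" by blast
  qed
  have inj: "inj_on ?f (Pow I)" by (auto simp: inj_on_def fun_eq_iff)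
  have pm: "pmf ?D (?f S) = p ^ card S * (1 - p) ^ card (I - S)" if S: "S \<in> Pow I" for S
  proof -
    have "pmf ?D (?f S) = (\<Prod>i\<in>I. pmf (bernoulli_pmf p) (i \<in> S))"
      using S by (intro pmf_Pi'[OF fin]) auto
    also have "\<dots> = (\<Prod>i\<in>I. if i \<in> S then p else 1 - p)" using p by (intro prod.cong) auto
    also have "\<dots> = (\<Prod>i\<in>I \<inter> S. p) * (\<Prod>i\<in>I - S. 1 - p)"
      using fin by (subst prod.If_cases) (auto simp: Diff_eq Collect_mem_eq)
    also have "I \<inter> S = S" using S by auto
    finally show ?thesis by simp
  qed
  \<comment> \<open>Functions that are true somewhere outside \<open>I\<close> have probability zero
    because the default value is \<open>False\<close>; the remaining ones correspond to the subsets
    of \<open>I\<close>.\<close>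
  have "measure_pmf.prob ?D {b. P {i\<in>I. b i}} = measure_pmf.prob ?D ({b. P {i\<in>I. b i}} \<inter> ?f ` Pow I)"
    by (rule measure_prob_cong_0) (use supp in \<open>auto simp: set_pmf_eq\<close>)
  also have "{b. P {i\<in>I. b i}} \<inter> ?f ` Pow I = ?f ` {S\<in>Pow I. P S}"
  proof -
    have "{i\<in>I. i \<in> S} = S" if "S \<subseteq> I" for S using that by auto
    then show ?thesis by force
  qed
  also have "measure_pmf.prob ?D \<dots> = (\<Sum>b\<in>?f ` {S\<in>Pow I. P S}. pmf ?D b)"
    using fin by (intro measure_measure_pmf_finite) auto
  also have "\<dots> = (\<Sum>S\<in>{S\<in>Pow I. P S}. pmf ?D (?f S))"
    by (subst sum.reindex) (auto intro: inj_on_subset[OF inj])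
  also have "\<dots> = (\<Sum>S\<in>{S\<in>Pow I. P S}. p ^ card S * (1 - p) ^ card (I - S))"
    by (intro sum.cong refl pm) auto
  also have "\<dots> = samp_prob p I P"
    unfolding samp_prob_def samp_exp_def using fin
    by (intro sum.mono_neutral_cong_left) auto
  finally show ?thesis .
qed

text \<open>128000 = 80 * 40^2 turns e^2 = 80 Q / s into e \<le> \<epsilon> / 40, as the spectral
  error is 40 \<theta>. The condition is implicit because Q grows like log s. With y = \<epsilon>^2
  s one has ln s = ln y + 2 ln (1 / \<epsilon>), where the first term is at most 2 sqrt y and the
  second at most 2 L.\<close>

lemma sample_size_bounds:
  fixes \<epsilon> \<delta> s :: real
  assumes \<epsilon>: "0 < \<epsilon>" "\<epsilon> < 1 / 2" and \<delta>: "0 < \<delta>" "\<delta> < 1 / 2"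
    and s: "s \<ge> 10 ^ 13 / (\<epsilon>\<^sup>2 * \<delta>) * ln (1 / (\<epsilon> * \<delta>))"
  defines "Q \<equiv> nat \<lceil>log 2 s\<rceil>"
  shows "s \<ge> 2" "1 \<le> Q" "s \<le> 2 ^ Q" "17 / s\<^sup>2 \<le> \<delta>" "128000 * real Q \<le> \<epsilon>\<^sup>2 * s"
proof -
  define L where "L = ln (1 / (\<epsilon> * \<delta>))"
  have ed: "0 < \<epsilon> * \<delta>" using \<epsilon> \<delta> by simp
  have "\<epsilon> * \<delta> \<le> (1 / 2) * (1 / 2)" using \<epsilon> \<delta> by (intro mult_mono) auto
  then have "4 \<le> 1 / (\<epsilon> * \<delta>)" using ed by (simp add: field_simps)
  moreover have "exp (1 :: real) \<le> 3" by (rule exp_le)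
  ultimately have "exp 1 \<le> 1 / (\<epsilon> * \<delta>)" by linarith
  then have L1: "1 \<le> L" unfolding L_def using ed by (subst ln_ge_iff) auto
  have "ln (1 / \<epsilon>) \<le> L"
  proof -
    have "\<epsilon> * \<delta> \<le> \<epsilon>" using \<epsilon> \<delta> by simp
    then show ?thesis unfolding L_def using \<epsilon> ed by (subst ln_le_cancel_iff) (auto intro!: divide_left_mono)
  qed
  then have Le: "- ln \<epsilon> \<le> L" using \<epsilon> by (simp add: ln_div)
  define y where "y = \<epsilon>\<^sup>2 * s"
  have ys: "10000000000000 * L \<le> y * \<delta>"
    using s \<epsilon> \<delta> unfolding y_def L_def[symmetric] by (simp add: field_simps)
  have y0: "y \<ge> 0"
  proof (rule ccontr)
    assume "\<not> y \<ge> 0"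
    then have "y * \<delta> < 0" using \<delta> by (simp add: mult_neg_pos)
    then show False using ys L1 by simp
  qed
  have yd: "y * \<delta> \<le> y" using mult_left_mono[of \<delta> 1 y] y0 \<delta> by simp
  have yL: "10000000000000 * L \<le> y" using ys yd by linarith
  have e21: "\<epsilon>\<^sup>2 \<le> 1" using \<epsilon> by (simp add: power_le_one)
  have "0 < y" using yL L1 by linarith
  then have "0 < \<epsilon>\<^sup>2 * s" by (simp only: y_def)
  then have s0: "s > 0" by (rule zero_less_mult_pos) (use \<epsilon> in simp)
  have "y \<le> s" unfolding y_def using mult_right_mono[OF e21, of s] s0 by simp
  then show s2: "s \<ge> 2" using yL L1 by linarith
  have sd: "10000000000000 \<le> s * \<delta>"
  proof -
    have "y * \<delta> \<le> s * \<delta>" using \<open>y \<le> s\<close> \<delta> by (intro mult_right_mono) auto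
    then show ?thesis using ys L1 by linarith
  qed
  show "17 / s\<^sup>2 \<le> \<delta>"
  proof -
    have "s * \<delta> \<le> s * (s * \<delta>)" using mult_right_mono[of 1 s "s * \<delta>"] s2 \<delta> by simp
    then have "17 \<le> \<delta> * s\<^sup>2" using sd by (simp add: power2_eq_square mult_ac)
    then show ?thesis using s0 by (simp add: field_simps)
  qed
  have log1: "1 \<le> log 2 s" using s2 by (subst le_log_iff) auto
  then have Q_ge: "log 2 s \<le> real Q" and Q_le: "real Q \<le> log 2 s + 1"
    unfolding Q_def by linarith+
  show "1 \<le> Q" using log1 Q_ge by linarith
  have "s = 2 powr log 2 s" using s0 by simp
  also have "\<dots> \<le> 2 powr real Q" using Q_ge by (intro powr_mono) auto
  finally show "s \<le> 2 ^ Q" by (simp add: powr_realpow)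
  have ln2: "ln 2 \<ge> (1 / 2 :: real)"
  proof -
    have "exp (1 :: real) \<le> 2\<^sup>2" using exp_le by simp
    then have "1 \<le> ln ((2 :: real)\<^sup>2)" by (subst ln_ge_iff) auto
    also have "\<dots> = 2 * ln 2" by (subst ln_realpow) auto
    finally show ?thesis by simp
  qed
  have lns: "0 \<le> ln s" using s2 by simp
  have "log 2 s \<le> 2 * ln s"
  proof -
    have "ln s * 1 \<le> ln s * (2 * ln 2)" using ln2 lns by (intro mult_left_mono) auto
    then show ?thesis using ln2 unfolding log_def by (simp add: field_simps)
  qed
  moreover have "ln s \<le> 2 * sqrt y + 2 * L"
  proof -
    have ypos: "y > 0" unfolding y_def using s0 \<epsilon> by simp
    have "ln y = 2 * ln (sqrt y)" using ypos by (simp add: ln_sqrt)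
    also have "\<dots> \<le> 2 * (sqrt y - 1)" using ypos by (intro mult_left_mono ln_le_minus_one) auto
    finally have "ln y \<le> 2 * sqrt y" by simp
    moreover have "ln y = 2 * ln \<epsilon> + ln s" unfolding y_def using \<epsilon> s0 by (simp add: ln_mult ln_realpow)
    ultimately show ?thesis using Le by linarith
  qed
  ultimately have Q4: "real Q \<le> 4 * sqrt y + 4 * L + 1" using Q_le by linarith
  \<comment> \<open>2048000 = 16 * 128000 lets the term 4 sqrt y in the bound on Q use only a
    quarter of y. This asks for y \<ge> 2048000^2, about 4.2 * 10^12, which explains the constant
    10^13.\<close>
  have "2048000 * sqrt y \<le> y"
  proof -
    have "(2048000 :: real)\<^sup>2 \<le> y" using yL L1 by simp
    then have "2048000 \<le> sqrt y" by (rule real_le_rsqrt)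
    then have "2048000 * sqrt y \<le> sqrt y * sqrt y" using y0 by (intro mult_right_mono) auto
    then show ?thesis using y0 by simp
  qed
  then show "128000 * real Q \<le> \<epsilon>\<^sup>2 * s"
    unfolding y_def[symmetric] using Q4 yL L1 by linarith
qed

theorem mainTheorem1:
  "\<exists>c c0 :: real. c > 0 \<and> c0 > 0 \<and>
    (\<forall>(n::nat) (\<epsilon>::real) (\<delta>::real) (A::real mat) (s::real).
       n \<ge> 1 \<longrightarrow> 0 < \<epsilon> \<longrightarrow> \<epsilon> < c0 \<longrightarrow> 0 < \<delta> \<longrightarrow> \<delta> < c0 \<longrightarrow>
       A \<in> carrier_mat n n \<longrightarrow> transpose_mat A = A \<longrightarrow>
       (\<forall>i<n. \<forall>j<n. \<bar>A $$ (i, j)\<bar> \<le> 1) \<longrightarrow>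
       s > 0 \<longrightarrow> s \<ge> c / (\<epsilon>\<^sup>2 * \<delta>) * ln (1 / (\<epsilon> * \<delta>)) \<longrightarrow>
       measure_pmf.prob (algU A s) {lam. additive_approx lam A (\<epsilon> * real n)} \<ge> 1 - \<delta>)"
proof (intro exI conjI allI impI)
  show "(10 :: real) ^ 13 > 0" "(1 / 2 :: real) > 0" by auto
next
  fix n :: nat and \<epsilon> \<delta> s :: real and A :: "real mat"
  assume n: "n \<ge> 1" and \<epsilon>: "0 < \<epsilon>" "\<epsilon> < 1 / 2" and \<delta>: "0 < \<delta>" "\<delta> < 1 / 2"
    and A: "A \<in> carrier_mat n n" and sym: "transpose_mat A = A"
    and bounded: "\<forall>i<n. \<forall>j<n. \<bar>A $$ (i, j)\<bar> \<le> 1"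
    and s: "s > 0" "s \<ge> 10 ^ 13 / (\<epsilon>\<^sup>2 * \<delta>) * ln (1 / (\<epsilon> * \<delta>))"
  have Asym: "A $$ (i, k) = A $$ (k, i)" if "i \<in> {..<n}" "k \<in> {..<n}" for i k
    using that A arg_cong[OF sym, of "\<lambda>B. B $$ (i, k)"] by simp
  obtain lam u where sp: "spectral {..<n} (\<lambda>i k. A $$ (i, k)) lam u"
    using spectral_exists[of "{..<n}" "\<lambda>i k. A $$ (i, k)", OF finite_lessThan Asym] by blast
  have h': "bij_betw (\<lambda>r. r) {0..<n} {..<n}" by (auto simp: bij_betw_def)
  have eA: "eigs A = rev (sort (map lam [0..<n]))"
    by (rule eigs_spectral[OF A h' sp]) auto
  show "1 - \<delta> \<le> measure_pmf.prob (algU A s) {lam. additive_approx lam A (\<epsilon> * real n)}"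
  proof (cases "s \<ge> real n")
    case True
    have "additive_approx (eigs A) A (\<epsilon> * real n)"
      using A \<epsilon> by (simp add: additive_approx_def eA)
    then show ?thesis using True A \<delta> by (simp add: algU_def Let_def)
  next
    case False
    \<comment> \<open>The number of moments, just large enough for s \<le> 2^Q; then e is forced by
      the relation e^2 s = 80 Q in \<open>sampling_setup\<close>.\<close>
    define Q where "Q = nat \<lceil>log 2 s\<rceil>"
    note sb = sample_size_bounds[OF \<epsilon> \<delta> s(2), folded Q_def]
    define e where "e = sqrt (80 * real Q / s)"
    have e2: "e\<^sup>2 = 80 * real Q / s" using s(1) by (simp add: e_def)
    have e_pos: "0 < e" using sb(2) s(1) by (simp add: e_def)
    have "e\<^sup>2 \<le> (\<epsilon> / 40)\<^sup>2"
      unfolding e2 using sb(5) s(1) by (simp add: power_divide field_simps)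
    then have e_le: "e \<le> \<epsilon> / 40" by (rule power2_le_imp_le) (use \<epsilon> in simp)
    interpret sampling_setup "{..<n}" "\<lambda>i k. A $$ (i, k)" lam u "real n" s e Q
      using sp bounded sb False e_pos e_le \<epsilon> s(1) by unfold_locales (auto simp: e2)
    let ?D = "Pi_pmf {..<n} False (\<lambda>_. bernoulli_pmf p)"
    have alg: "algU A s = map_pmf (algU_output A p) ?D"
      using False A by (simp add: algU_def Let_def p_def)
    have "1 - \<delta> \<le> 1 - samp_prob p {..<n} (\<lambda>S. \<not> good_sample {..<n} S lam u p \<theta>)"
      using good_sample_prob[OF sb(3)] sb(4) by linarith
    also have "\<dots> = samp_prob p {..<n} (\<lambda>S. good_sample {..<n} S lam u p \<theta>)"
    proof -
      have "samp_prob p {..<n} (\<lambda>S. good_sample {..<n} S lam u p \<theta>)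
          + samp_prob p {..<n} (\<lambda>S. \<not> good_sample {..<n} S lam u p \<theta>) = samp_exp p {..<n} (\<lambda>_. 1)"
        unfolding samp_prob_def samp_exp_add[symmetric] by (rule samp_exp_cong) simp
      then show ?thesis by (simp add: samp_exp_const)
    qed
    also have "\<dots> = measure_pmf.prob ?D {b. good_sample {..<n} {i\<in>{..<n}. b i} lam u p \<theta>}"
      using p01 by (intro prob_Pi_bernoulli[symmetric]) auto
    also have "\<dots> \<le> measure_pmf.prob ?D (algU_output A p -` {lam. additive_approx lam A (\<epsilon> * real n)})"
    proof (rule measure_pmf.finite_measure_mono)
      have "40 * \<theta> \<le> \<epsilon> * real n"
        using mult_right_mono[OF e_le, of "real n"] by (simp add: \<theta>_def)
      then have "additive_approx l A (40 * \<theta>) \<Longrightarrow> additive_approx l A (\<epsilon> * real n)" for l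
        unfolding additive_approx_def by force
      then show "{b. good_sample {..<n} {i\<in>{..<n}. b i} lam u p \<theta>}
          \<subseteq> algU_output A p -` {lam. additive_approx lam A (\<epsilon> * real n)}"
        using good_sample_output[OF A sp] by blast
    qed simp
    also have "\<dots> = measure_pmf.prob (algU A s) {lam. additive_approx lam A (\<epsilon> * real n)}"
      unfolding alg by simp
    finally show ?thesis .
  qed
qed

end
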